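(* Let $k$ be a field. For any $k$-algebra $\Lambda$ which is $E$-triangular with respect to a system $E$, there is a decomposition (isomorphism of graded vector spaces) $$HH_*(\Lambda)=\bigoplus_{x\in E}HH_*(x\Lambda x).$$
   Context: Algebras are associative and unital over $k$. For a $k$-algebra $A$, $HH_n(A)=\mathrm{Tor}_n^{A\otimes A^{\mathrm{op}}}(A,A)$ denotes Hochschild homology. A system of a $k$-algebra $\Lambda$ is a finite set $E$ of non zero pairwise orthogonal idempotents (not necessarily primitive) with $\sum_{x\in E}x=1$; it is trivial if $E=\{1\}$. The Peirce $E$-quiver $Q_E$ of $\Lambda$ has vertex set $E$ and, for $x\neq y$ in $E$, an arrow from $x$ to $y$ exactly when $y\Lambda x\neq 0$ (there are no loops). $\Lambda$ is $E$-triangular with respect to a non trivial system $E$ if $Q_E$ has no oriented cycles. For $x\in E$, $x\Lambda x$ is a $k$-algebra with unit $x$. *)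

theory Defs
  imports "HOL-Library.FSet" "HOL-Algebra.AbelCoset" "HOL-Algebra.Module"
begin

section \<open>Modules: direct sums, free modules, quotients\<close>

text \<open>
  The locale \<^locale>\<open>module\<close> is restricted to commutative base rings, but the record type
  \<^typ>\<open>('r, 'm) module\<close> is used below for left modules over arbitrary rings.  The fields
  \<^const>\<open>mult\<close> and \<^const>\<open>one\<close> of a record used as a module carry no meaning.
\<close>

text \<open>Families are extended by zero outside the index set.\<close>

definition direct_sum :: "'i set \<Rightarrow> ('i \<Rightarrow> ('r, 'm) module) \<Rightarrow> ('r, 'i \<Rightarrow> 'm) module" where
  "direct_sum I M =
    \<lparr>carrier = {f. (\<forall>i\<in>I. f i \<in> carrier (M i)) \<and> (\<forall>i. i \<notin> I \<longrightarrow> f i = \<zero>\<^bsub>M i\<^esub>) \<and>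
                   finite {i. f i \<noteq> \<zero>\<^bsub>M i\<^esub>}},
     mult = undefined, one = undefined,
     zero = (\<lambda>i. \<zero>\<^bsub>M i\<^esub>),
     add = (\<lambda>f g i. if i \<in> I then f i \<oplus>\<^bsub>M i\<^esub> g i else \<zero>\<^bsub>M i\<^esub>),
     smult = (\<lambda>r f i. if i \<in> I then r \<odot>\<^bsub>M i\<^esub> f i else \<zero>\<^bsub>M i\<^esub>)\<rparr>"

definition regular_module :: "('r, 'x) ring_scheme \<Rightarrow> ('r, 'r) module" where
  "regular_module R =
    \<lparr>carrier = carrier R, mult = mult R, one = one R, zero = zero R, add = add R,
     smult = mult R\<rparr>"

definition free_module :: "('r, 'x) ring_scheme \<Rightarrow> 'b set \<Rightarrow> ('r, 'b \<Rightarrow> 'r) module" where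
  "free_module R B = direct_sum B (\<lambda>_. regular_module R)"

definition basis_vector :: "('r, 'x) ring_scheme \<Rightarrow> 'b \<Rightarrow> 'b \<Rightarrow> 'r" where
  "basis_vector R b = (\<lambda>c. if c = b then \<one>\<^bsub>R\<^esub> else \<zero>\<^bsub>R\<^esub>)"

text \<open>The linear extension to a free module of a map \<open>\<phi>\<close> given on the basis.\<close>

definition lin_ext ::
    "('r, 'x) ring_scheme \<Rightarrow> ('r, 'm, 'y) module_scheme \<Rightarrow> ('b \<Rightarrow> 'm) \<Rightarrow> ('b \<Rightarrow> 'r) \<Rightarrow> 'm" where
  "lin_ext R M \<phi> f = (\<Oplus>\<^bsub>M\<^esub>b\<in>{b. f b \<noteq> \<zero>\<^bsub>R\<^esub>}. f b \<odot>\<^bsub>M\<^esub> \<phi> b)"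

definition module_span ::
    "('r, 'x) ring_scheme \<Rightarrow> ('r, 'm, 'y) module_scheme \<Rightarrow> 'm set \<Rightarrow> 'm set" where
  "module_span R M S = \<Inter>{H. submodule H R M \<and> S \<subseteq> H}"

definition quotient_module :: "('r, 'm, 'y) module_scheme \<Rightarrow> 'm set \<Rightarrow> ('r, 'm set) module" where
  "quotient_module M H =
    \<lparr>carrier = a_rcosets\<^bsub>M\<^esub> H, mult = undefined, one = undefined, zero = H, add = set_add M,
     smult = (\<lambda>r X. \<Union>x\<in>X. H +>\<^bsub>M\<^esub> (r \<odot>\<^bsub>M\<^esub> x))\<rparr>"

definition kernel_module ::
    "('r, 'm) module \<Rightarrow> ('s, 'n) module \<Rightarrow> ('m \<Rightarrow> 'n) \<Rightarrow> ('r, 'm) module" where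
  "kernel_module M N h = M\<lparr>carrier := a_kernel M N h\<rparr>"

definition module_isomorphic ::
    "('r, 'x) ring_scheme \<Rightarrow> ('r, 'm) module \<Rightarrow> ('r, 'n) module \<Rightarrow> bool" where
  "module_isomorphic R M N \<longleftrightarrow>
    (\<exists>h. bij_betw h (carrier M) (carrier N) \<and>
         (\<forall>x\<in>carrier M. \<forall>y\<in>carrier M. h (x \<oplus>\<^bsub>M\<^esub> y) = h x \<oplus>\<^bsub>N\<^esub> h y) \<and>
         (\<forall>r\<in>carrier R. \<forall>x\<in>carrier M. h (r \<odot>\<^bsub>M\<^esub> x) = r \<odot>\<^bsub>N\<^esub> h x))"


section \<open>Tensor products\<close>

text \<open>A \<open>K\<close>-module with, in addition, a right action of a \<open>K\<close>-algebra.\<close>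

record ('k, 'r, 'm) right_module = "('k, 'm) module" +
  rsmult :: "'m \<Rightarrow> 'r \<Rightarrow> 'm"

text \<open>
  For a \<open>K\<close>-algebra \<open>R\<close>, a right \<open>R\<close>-module \<open>M\<close> and a left \<open>R\<close>-module \<open>N\<close>, the \<open>K\<close>-module
  \<open>M \<otimes>\<^sub>R N\<close> is the free \<open>K\<close>-module on \<open>M \<times> N\<close> modulo the relations below.  Linearity over \<open>K\<close>
  in the second variable follows from the last relation.
\<close>

definition tensor_rel ::
    "('k, 'x) ring_scheme \<Rightarrow> ('r, 'y) ring_scheme \<Rightarrow> ('k, 'r, 'm) right_module \<Rightarrow>
     ('r, 'n) module \<Rightarrow> ('m \<times> 'n \<Rightarrow> 'k) set" where
  "tensor_rel K R M N =
    (let V = free_module K (carrier M \<times> carrier N); e = basis_vector K in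
     module_span K V
      ({e (m \<oplus>\<^bsub>M\<^esub> m', n) \<ominus>\<^bsub>V\<^esub> (e (m, n) \<oplus>\<^bsub>V\<^esub> e (m', n)) | m m' n.
          m \<in> carrier M \<and> m' \<in> carrier M \<and> n \<in> carrier N} \<union>
       {e (m, n \<oplus>\<^bsub>N\<^esub> n') \<ominus>\<^bsub>V\<^esub> (e (m, n) \<oplus>\<^bsub>V\<^esub> e (m, n')) | m n n'.
          m \<in> carrier M \<and> n \<in> carrier N \<and> n' \<in> carrier N} \<union>
       {e (c \<odot>\<^bsub>M\<^esub> m, n) \<ominus>\<^bsub>V\<^esub> c \<odot>\<^bsub>V\<^esub> e (m, n) | c m n.
          c \<in> carrier K \<and> m \<in> carrier M \<and> n \<in> carrier N} \<union>
       {e (rsmult M m r, n) \<ominus>\<^bsub>V\<^esub> e (m, r \<odot>\<^bsub>N\<^esub> n) | m r n.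
          m \<in> carrier M \<and> r \<in> carrier R \<and> n \<in> carrier N}))"

definition tensor ::
    "('k, 'x) ring_scheme \<Rightarrow> ('r, 'y) ring_scheme \<Rightarrow> ('k, 'r, 'm) right_module \<Rightarrow>
     ('r, 'n) module \<Rightarrow> ('k, ('m \<times> 'n \<Rightarrow> 'k) set) module" where
  "tensor K R M N =
    quotient_module (free_module K (carrier M \<times> carrier N)) (tensor_rel K R M N)"

definition pure_tensor ::
    "('k, 'x) ring_scheme \<Rightarrow> ('r, 'y) ring_scheme \<Rightarrow> ('k, 'r, 'm) right_module \<Rightarrow>
     ('r, 'n) module \<Rightarrow> 'm \<Rightarrow> 'n \<Rightarrow> ('m \<times> 'n \<Rightarrow> 'k) set" where
  "pure_tensor K R M N m n =
    tensor_rel K R M N +>\<^bsub>free_module K (carrier M \<times> carrier N)\<^esub> basis_vector K (m, n)"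

text \<open>
  The linear map into \<open>T\<close> which a balanced map \<open>\<phi>\<close> induces on a tensor product: for such \<open>\<phi>\<close>
  the linear extension is constant on each coset \<open>X\<close>.
\<close>

definition tensor_lift ::
    "('k, 'x) ring_scheme \<Rightarrow> ('k, 't, 'y) module_scheme \<Rightarrow> ('m \<times> 'n \<Rightarrow> 't) \<Rightarrow>
     ('m \<times> 'n \<Rightarrow> 'k) set \<Rightarrow> 't" where
  "tensor_lift K T \<phi> X = the_elem (lin_ext K T \<phi> ` X)"


section \<open>The canonical free resolution and Tor\<close>

text \<open>
  Every module \<open>X\<close> is the image of the free module on its underlying set.  Iterating this on the
  kernels gives the canonical free resolution
  \<open>\<dots> \<rightarrow> F\<^sub>1 \<rightarrow> F\<^sub>0 \<rightarrow> N \<rightarrow> 0\<close>, where \<open>F\<^sub>0\<close> is free on the set \<open>N\<close> and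
  \<open>F\<^sub>n\<^sub>+\<^sub>1\<close> is free on the set of elements of the kernel of the preceding map on \<open>F\<^sub>n\<close>.
  To keep all \<open>F\<^sub>n\<close> in one type, the basis elements are coded in the following datatype: a
  finitely supported function \<open>f\<close> on cells is coded injectively by the graph of its restriction to
  its support.
\<close>

datatype ('r, 'm) cell = Elt 'm | Chain "(('r, 'm) cell \<times> 'r) fset"

definition chain_cell ::
    "('r, 'x) ring_scheme \<Rightarrow> (('r, 'm) cell \<Rightarrow> 'r) \<Rightarrow> ('r, 'm) cell" where
  "chain_cell R f = Chain (Abs_fset {(b, f b) | b. f b \<noteq> \<zero>\<^bsub>R\<^esub>})"

definition cover_module ::
    "('r, 'x) ring_scheme \<Rightarrow> ('a \<Rightarrow> 'b) \<Rightarrow> ('r, 'a) module \<Rightarrow> ('r, 'b \<Rightarrow> 'r) module" where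
  "cover_module R \<iota> X = free_module R (\<iota> ` carrier X)"

definition cover_map ::
    "('r, 'x) ring_scheme \<Rightarrow> ('a \<Rightarrow> 'b) \<Rightarrow> ('r, 'a) module \<Rightarrow> ('b \<Rightarrow> 'r) \<Rightarrow> 'a" where
  "cover_map R \<iota> X = lin_ext R X (the_inv_into (carrier X) \<iota>)"

primrec syzygy ::
    "('r, 'x) ring_scheme \<Rightarrow> ('r, 'm) module \<Rightarrow> nat \<Rightarrow>
     ('r, ('r, 'm) cell \<Rightarrow> 'r) module" where
  "syzygy R N 0 = kernel_module (cover_module R Elt N) N (cover_map R Elt N)"
| "syzygy R N (Suc n) =
    kernel_module (cover_module R (chain_cell R) (syzygy R N n)) (syzygy R N n)
      (cover_map R (chain_cell R) (syzygy R N n))"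

primrec resolution ::
    "('r, 'x) ring_scheme \<Rightarrow> ('r, 'm) module \<Rightarrow> nat \<Rightarrow>
     ('r, ('r, 'm) cell \<Rightarrow> 'r) module" where
  "resolution R N 0 = cover_module R Elt N"
| "resolution R N (Suc n) = cover_module R (chain_cell R) (syzygy R N n)"

text \<open>The differential from degree \<open>n + 1\<close> to degree \<open>n\<close>.\<close>

definition resolution_diff ::
    "('r, 'x) ring_scheme \<Rightarrow> ('r, 'm) module \<Rightarrow> nat \<Rightarrow>
     (('r, 'm) cell \<Rightarrow> 'r) \<Rightarrow> ('r, 'm) cell \<Rightarrow> 'r" where
  "resolution_diff R N n = cover_map R (chain_cell R) (syzygy R N n)"

definition Tor_complex ::
    "('k, 'x) ring_scheme \<Rightarrow> ('r, 'y) ring_scheme \<Rightarrow> ('k, 'r, 'm) right_module \<Rightarrow>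
     ('r, 'n) module \<Rightarrow> nat \<Rightarrow> ('k, ('m \<times> (('r, 'n) cell \<Rightarrow> 'r) \<Rightarrow> 'k) set) module" where
  "Tor_complex K R M N n = tensor K R M (resolution R N n)"

definition Tor_diff ::
    "('k, 'x) ring_scheme \<Rightarrow> ('r, 'y) ring_scheme \<Rightarrow> ('k, 'r, 'm) right_module \<Rightarrow>
     ('r, 'n) module \<Rightarrow> nat \<Rightarrow> ('m \<times> (('r, 'n) cell \<Rightarrow> 'r) \<Rightarrow> 'k) set \<Rightarrow>
     ('m \<times> (('r, 'n) cell \<Rightarrow> 'r) \<Rightarrow> 'k) set" where
  "Tor_diff K R M N n =
    tensor_lift K (Tor_complex K R M N n)
      (\<lambda>(m, f). pure_tensor K R M (resolution R N n) m (resolution_diff R N n f))"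

definition Tor_cycles ::
    "('k, 'x) ring_scheme \<Rightarrow> ('r, 'y) ring_scheme \<Rightarrow> ('k, 'r, 'm) right_module \<Rightarrow>
     ('r, 'n) module \<Rightarrow> nat \<Rightarrow> ('k, ('m \<times> (('r, 'n) cell \<Rightarrow> 'r) \<Rightarrow> 'k) set) module" where
  "Tor_cycles K R M N n =
    (case n of
       0 \<Rightarrow> Tor_complex K R M N 0
     | Suc n' \<Rightarrow> kernel_module (Tor_complex K R M N (Suc n')) (Tor_complex K R M N n')
                   (Tor_diff K R M N n'))"

definition Tor ::
    "('k, 'x) ring_scheme \<Rightarrow> ('r, 'y) ring_scheme \<Rightarrow> ('k, 'r, 'm) right_module \<Rightarrow>
     ('r, 'n) module \<Rightarrow> nat \<Rightarrow> ('k, ('m \<times> (('r, 'n) cell \<Rightarrow> 'r) \<Rightarrow> 'k) set set) module" where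
  "Tor K R M N n =
    quotient_module (Tor_cycles K R M N n)
      (Tor_diff K R M N n ` carrier (Tor_complex K R M N (Suc n)))"


section \<open>Algebras and Hochschild homology\<close>

text \<open>Unlike in the library locale \<^locale>\<open>algebra\<close>, commutativity is not required.\<close>

locale assoc_algebra = module + ring M +
  assumes smult_mult_left:
      "\<lbrakk>a \<in> carrier R; x \<in> carrier M; y \<in> carrier M\<rbrakk> \<Longrightarrow>
        (a \<odot>\<^bsub>M\<^esub> x) \<otimes>\<^bsub>M\<^esub> y = a \<odot>\<^bsub>M\<^esub> (x \<otimes>\<^bsub>M\<^esub> y)"
    and smult_mult_right:
      "\<lbrakk>a \<in> carrier R; x \<in> carrier M; y \<in> carrier M\<rbrakk> \<Longrightarrow>
        x \<otimes>\<^bsub>M\<^esub> (a \<odot>\<^bsub>M\<^esub> y) = a \<odot>\<^bsub>M\<^esub> (x \<otimes>\<^bsub>M\<^esub> y)"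

definition opposite :: "('k, 'a) module \<Rightarrow> ('k, 'a) module" where
  "opposite A = A\<lparr>mult := \<lambda>a b. b \<otimes>\<^bsub>A\<^esub> a\<rparr>"

definition scalar_right_module :: "('k, 'm) module \<Rightarrow> ('k, 'k, 'm) right_module" where
  "scalar_right_module M = module.extend M \<lparr>rsmult = (\<lambda>m c. c \<odot>\<^bsub>M\<^esub> m)\<rparr>"

definition tensor_algebra ::
    "('k, 'x) ring_scheme \<Rightarrow> ('k, 'a) module \<Rightarrow> ('k, 'b) module \<Rightarrow>
     ('k, ('a \<times> 'b \<Rightarrow> 'k) set) module" where
  "tensor_algebra K A B =
    (let T = tensor K K (scalar_right_module A) B;
         t = pure_tensor K K (scalar_right_module A) B in
     T\<lparr>mult := (\<lambda>X Y. tensor_lift K T (\<lambda>(a, b).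
                 tensor_lift K T (\<lambda>(a', b'). t (a \<otimes>\<^bsub>A\<^esub> a') (b \<otimes>\<^bsub>B\<^esub> b')) Y) X),
       one := t \<one>\<^bsub>A\<^esub> \<one>\<^bsub>B\<^esub>\<rparr>)"

definition enveloping_algebra ::
    "('k, 'x) ring_scheme \<Rightarrow> ('k, 'a) module \<Rightarrow> ('k, ('a \<times> 'a \<Rightarrow> 'k) set) module" where
  "enveloping_algebra K A = tensor_algebra K A (opposite A)"

text \<open>\<open>A\<close> as a left module over its enveloping algebra, \<open>(a \<otimes> b) x = a x b\<close>,\<close>

definition env_left_module ::
    "('k, 'x) ring_scheme \<Rightarrow> ('k, 'a) module \<Rightarrow> (('a \<times> 'a \<Rightarrow> 'k) set, 'a) module" where
  "env_left_module K A =
    \<lparr>carrier = carrier A, mult = mult A, one = one A, zero = zero A, add = add A,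
     smult = (\<lambda>X x. tensor_lift K A (\<lambda>(a, b). a \<otimes>\<^bsub>A\<^esub> x \<otimes>\<^bsub>A\<^esub> b) X)\<rparr>"

text \<open>and as a right module, \<open>x (a \<otimes> b) = b x a\<close>.\<close>

definition env_right_module ::
    "('k, 'x) ring_scheme \<Rightarrow> ('k, 'a) module \<Rightarrow>
     ('k, ('a \<times> 'a \<Rightarrow> 'k) set, 'a) right_module" where
  "env_right_module K A =
    module.extend A
      \<lparr>rsmult = (\<lambda>x X. tensor_lift K A (\<lambda>(a, b). b \<otimes>\<^bsub>A\<^esub> x \<otimes>\<^bsub>A\<^esub> a) X)\<rparr>"

definition HH where
  "HH K A n = Tor K (enveloping_algebra K A) (env_right_module K A) (env_left_module K A) n"


section \<open>Systems of idempotents and the Peirce quiver\<close>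

definition idempotent_system :: "('k, 'a) module \<Rightarrow> 'a set \<Rightarrow> bool" where
  "idempotent_system A E \<longleftrightarrow>
    finite E \<and> E \<subseteq> carrier A \<and> \<zero>\<^bsub>A\<^esub> \<notin> E \<and>
    (\<forall>x\<in>E. x \<otimes>\<^bsub>A\<^esub> x = x) \<and>
    (\<forall>x\<in>E. \<forall>y\<in>E. x \<noteq> y \<longrightarrow> x \<otimes>\<^bsub>A\<^esub> y = \<zero>\<^bsub>A\<^esub>) \<and>
    (\<Oplus>\<^bsub>A\<^esub>x\<in>E. x) = \<one>\<^bsub>A\<^esub>"

definition trivial_system :: "('k, 'a) module \<Rightarrow> 'a set \<Rightarrow> bool" where
  "trivial_system A E \<longleftrightarrow> E = {\<one>\<^bsub>A\<^esub>}"

definition peirce_quiver :: "('k, 'a) module \<Rightarrow> 'a set \<Rightarrow> ('a \<times> 'a) set" where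
  "peirce_quiver A E =
    {(x, y). x \<in> E \<and> y \<in> E \<and> x \<noteq> y \<and> (\<exists>a\<in>carrier A. y \<otimes>\<^bsub>A\<^esub> a \<otimes>\<^bsub>A\<^esub> x \<noteq> \<zero>\<^bsub>A\<^esub>)}"

definition triangular :: "('k, 'a) module \<Rightarrow> 'a set \<Rightarrow> bool" where
  "triangular A E \<longleftrightarrow>
    idempotent_system A E \<and> \<not> trivial_system A E \<and> acyclic (peirce_quiver A E)"

definition corner :: "('k, 'a) module \<Rightarrow> 'a \<Rightarrow> ('k, 'a) module" where
  "corner A x = A\<lparr>carrier := {x \<otimes>\<^bsub>A\<^esub> a \<otimes>\<^bsub>A\<^esub> x | a. a \<in> carrier A}, one := x\<rparr>"

end

theory Submission
  imports Defs
begin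

text \<open>
  Put \<open>R = \<Lambda> \<otimes> \<Lambda>\<^sup>o\<^sup>p\<close> and \<open>\<epsilon>\<^sub>a\<^sub>b = a \<otimes> b \<in> R\<close> for \<open>a, b \<in> E\<close>, and write \<open>b \<le> a\<close> if there is a path from \<open>b\<close> to
  \<open>a\<close> in the Peirce quiver.  The bimodule \<open>\<Lambda>\<close> is triangular: \<open>a \<Lambda> b = 0\<close> unless \<open>b \<le> a\<close>.  Hence it has
  a resolution \<open>P\<close> by direct sums of the projective bimodules \<open>\<Lambda> a \<otimes> b \<Lambda> = R \<epsilon>\<^sub>a\<^sub>b\<close> with \<open>b \<le> a\<close>, which are
  again triangular.  Now \<open>\<Lambda> \<otimes>\<^sub>R R \<epsilon>\<^sub>a\<^sub>b = b \<Lambda> a\<close> vanishes for \<open>b < a\<close> and, for \<open>x \<in> E\<close>, so does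
  \<open>x (\<Lambda> a \<otimes> b \<Lambda>) x\<close> unless \<open>a = b = x\<close>.  So \<open>x P x\<close> is a free resolution of \<open>x \<Lambda> x\<close> over the enveloping
  algebra \<open>R\<^sub>x\<close> of the corner, and \<open>\<Lambda> \<otimes>\<^sub>R P\<close> is the direct sum over \<open>x \<in> E\<close> of the complexes
  \<open>x \<Lambda> x \<otimes> x P x\<close>, the tensor product being taken over \<open>R\<^sub>x\<close>.

  Inside the canonical free resolution \<open>F\<close> of \<open>\<Lambda>\<close> one can choose \<open>P\<close> as a degreewise direct
  summand such that \<open>x P x\<close> is exactly the canonical free resolution of \<open>x \<Lambda> x\<close>.  The quotient
  \<open>F / P\<close> is an exact, bounded below complex of projectives, hence contractible, so that
  \<open>\<Lambda> \<otimes>\<^sub>R P \<rightarrow> \<Lambda> \<otimes>\<^sub>R F\<close> is a quasi-isomorphism.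
\<close>

section \<open>Additive maps and left modules\<close>

text \<open>\<open>HH\<close> is computed from one fixed resolution, free on all elements of
  \<open>\<Lambda>\<close> and then of the successive kernels, so a smaller resolution can enter
  only as a subcomplex of it. This is possible because every homogeneous element \<open>v\<close>,
  one with \<open>\<epsilon> c \<odot> v = v\<close>, has a basis cell of its own: at the cell of a
  non zero such \<open>v\<close> in the triangular part, \<open>P\<close> admits only coefficients
  in the left ideal of \<open>\<epsilon> c\<close>. All homogeneous elements are taken, not just
  generators; this makes the corner part of \<open>P\<close> canonical cell by cell. The order
  \<open>b \<le> a\<close> must be transitive: a non zero component of
  \<open>\<Lambda> a \<otimes> b \<Lambda>\<close> between \<open>u\<close> and \<open>v\<close>
  yields \<open>v \<le> b \<le> a \<le> u\<close>, but \<open>u \<Lambda> v\<close> itself may be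
  zero, so non vanishing of \<open>a \<Lambda> b\<close> alone would not pass to the next term.
  Exactness of \<open>F / P\<close> by itself is lost under a tensor product; a contraction is made
  of linear maps and survives. It is built on \<open>F\<close>, by maps that vanish on
  \<open>P\<close> and have their defect in \<open>P\<close>, so the quotient complex is never
  formed.\<close>

definition additive_map ::
    "('a, 'x) ring_scheme \<Rightarrow> ('b, 'y) ring_scheme \<Rightarrow> ('a \<Rightarrow> 'b) \<Rightarrow> bool" where
  "additive_map G H h \<longleftrightarrow>
    (\<forall>x\<in>carrier G. h x \<in> carrier H) \<and>
    (\<forall>x\<in>carrier G. \<forall>y\<in>carrier G. h (x \<oplus>\<^bsub>G\<^esub> y) = h x \<oplus>\<^bsub>H\<^esub> h y)"

lemma additive_mapI:
  assumes "\<And>x. x \<in> carrier G \<Longrightarrow> h x \<in> carrier H"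
    and "\<And>x y. x \<in> carrier G \<Longrightarrow> y \<in> carrier G \<Longrightarrow> h (x \<oplus>\<^bsub>G\<^esub> y) = h x \<oplus>\<^bsub>H\<^esub> h y"
  shows "additive_map G H h"
  using assms by (auto simp: additive_map_def)

lemma additive_map_closed: "additive_map G H h \<Longrightarrow> x \<in> carrier G \<Longrightarrow> h x \<in> carrier H"
  by (auto simp: additive_map_def)

lemma additive_map_add:
  "additive_map G H h \<Longrightarrow> x \<in> carrier G \<Longrightarrow> y \<in> carrier G \<Longrightarrow> h (x \<oplus>\<^bsub>G\<^esub> y) = h x \<oplus>\<^bsub>H\<^esub> h y"
  by (auto simp: additive_map_def)

lemma additive_map_comp:
  "additive_map G H h \<Longrightarrow> additive_map H L g \<Longrightarrow> additive_map G L (\<lambda>x. g (h x))"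
  by (auto simp: additive_map_def)

lemma additive_map_zero:
  assumes "abelian_group G" "abelian_group H" "additive_map G H h"
  shows "h \<zero>\<^bsub>G\<^esub> = \<zero>\<^bsub>H\<^esub>"
proof -
  interpret G: abelian_group G by fact
  interpret H: abelian_group H by fact
  have "h (\<zero>\<^bsub>G\<^esub> \<oplus>\<^bsub>G\<^esub> \<zero>\<^bsub>G\<^esub>) = h \<zero>\<^bsub>G\<^esub> \<oplus>\<^bsub>H\<^esub> h \<zero>\<^bsub>G\<^esub>"
    using assms(3) by (intro additive_map_add) auto
  then show ?thesis
    using additive_map_closed[OF assms(3), of "\<zero>\<^bsub>G\<^esub>"] by (simp add: H.add.l_cancel_one')
qed

lemma additive_map_a_inv:
  assumes "abelian_group G" "abelian_group H" "additive_map G H h" "x \<in> carrier G"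
  shows "h (\<ominus>\<^bsub>G\<^esub> x) = \<ominus>\<^bsub>H\<^esub> h x"
proof -
  interpret G: abelian_group G by fact
  interpret H: abelian_group H by fact
  have "h (\<ominus>\<^bsub>G\<^esub> x) \<oplus>\<^bsub>H\<^esub> h x = \<zero>\<^bsub>H\<^esub>"
    using assms additive_map_add[OF assms(3), of "\<ominus>\<^bsub>G\<^esub> x" x] additive_map_zero[OF assms(1-3)]
    by (simp add: G.l_neg)
  then show ?thesis
    using additive_map_closed[OF assms(3)] assms(4) by (simp add: H.minus_equality)
qed

lemma additive_map_minus:
  assumes "abelian_group G" "abelian_group H" "additive_map G H h" "x \<in> carrier G" "y \<in> carrier G"
  shows "h (x \<ominus>\<^bsub>G\<^esub> y) = h x \<ominus>\<^bsub>H\<^esub> h y"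
  using assms by (simp add: a_minus_def additive_map_add additive_map_a_inv abelian_group.a_inv_closed)

lemma additive_map_finsum:
  assumes "abelian_group G" "abelian_group H" "additive_map G H h"
    and "finite I" "\<And>i. i \<in> I \<Longrightarrow> f i \<in> carrier G"
  shows "h (\<Oplus>\<^bsub>G\<^esub>i\<in>I. f i) = (\<Oplus>\<^bsub>H\<^esub>i\<in>I. h (f i))"
  using assms(4,5)
proof (induction I)
  case empty
  interpret G: abelian_group G by fact
  interpret H: abelian_group H by fact
  show ?case by (simp add: additive_map_zero[OF assms(1-3)])
next
  case (insert i I)
  interpret G: abelian_group G by fact
  interpret H: abelian_group H by fact
  have "h (f i \<oplus>\<^bsub>G\<^esub> (\<Oplus>\<^bsub>G\<^esub>i\<in>I. f i)) = h (f i) \<oplus>\<^bsub>H\<^esub> h (\<Oplus>\<^bsub>G\<^esub>i\<in>I. f i)"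
    using insert.prems by (intro additive_map_add[OF assms(3)]) auto
  with insert show ?case
    by (simp add: Pi_def additive_map_closed[OF assms(3)])
qed

lemma additive_map_sum:
  assumes "abelian_group H" "additive_map G H f" "additive_map G H g"
  shows "additive_map G H (\<lambda>x. f x \<oplus>\<^bsub>H\<^esub> g x)"
proof -
  interpret H: abelian_group H by fact
  show ?thesis
    using assms(2,3) by (auto simp: additive_map_def H.a_ac)
qed

lemma additive_map_diff:
  assumes "abelian_group H" "additive_map G H f" "additive_map G H g"
  shows "additive_map G H (\<lambda>x. f x \<ominus>\<^bsub>H\<^esub> g x)"
proof -
  interpret H: abelian_group H by fact
  show ?thesis
    using assms(2,3) by (auto simp: additive_map_def a_minus_def H.minus_add H.a_ac)
qed

context abelian_group
begin

lemma minus_self [simp]: "x \<in> carrier G \<Longrightarrow> x \<ominus> x = \<zero>"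
  by (simp add: a_minus_def r_neg)

lemma minus_zero_right [simp]: "x \<in> carrier G \<Longrightarrow> x \<ominus> \<zero> = x"
  by (simp add: a_minus_def)

lemma minus_eq_zero_iff: "x \<in> carrier G \<Longrightarrow> y \<in> carrier G \<Longrightarrow> x \<ominus> y = \<zero> \<longleftrightarrow> x = y"
  by (metis a_minus_def add.inv_closed minus_equality minus_minus minus_self)

end

lemma (in abelian_group) finsum_minus:
  assumes "finite I" "\<And>i. i \<in> I \<Longrightarrow> f i \<in> carrier G" "\<And>i. i \<in> I \<Longrightarrow> g i \<in> carrier G"
  shows "(\<Oplus>i\<in>I. f i \<ominus> g i) = (\<Oplus>i\<in>I. f i) \<ominus> (\<Oplus>i\<in>I. g i)"
proof -
  have inv: "additive_map G G (\<lambda>x. \<ominus> x)"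
    by (rule additive_mapI) (simp_all add: minus_add a_comm)
  have "(\<Oplus>i\<in>I. f i \<ominus> g i) = (\<Oplus>i\<in>I. f i) \<oplus> (\<Oplus>i\<in>I. \<ominus> g i)"
    unfolding a_minus_def using assms by (intro finsum_addf) auto
  also have "(\<Oplus>i\<in>I. \<ominus> g i) = \<ominus> (\<Oplus>i\<in>I. g i)"
    by (rule additive_map_finsum[OF abelian_group_axioms abelian_group_axioms inv assms(1,3), symmetric])
  finally show ?thesis by (simp add: a_minus_def)
qed

text \<open>The scalars form only a ring, since the main instances are modules over an enveloping
  algebra.\<close>

locale left_module = R?: ring + M?: abelian_group M for M (structure) +
  assumes smult_closed [simp, intro]:
      "\<lbrakk>a \<in> carrier R; x \<in> carrier M\<rbrakk> \<Longrightarrow> a \<odot>\<^bsub>M\<^esub> x \<in> carrier M"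
    and smult_l_distr:
      "\<lbrakk>a \<in> carrier R; b \<in> carrier R; x \<in> carrier M\<rbrakk> \<Longrightarrow>
        (a \<oplus> b) \<odot>\<^bsub>M\<^esub> x = a \<odot>\<^bsub>M\<^esub> x \<oplus>\<^bsub>M\<^esub> b \<odot>\<^bsub>M\<^esub> x"
    and smult_r_distr:
      "\<lbrakk>a \<in> carrier R; x \<in> carrier M; y \<in> carrier M\<rbrakk> \<Longrightarrow>
        a \<odot>\<^bsub>M\<^esub> (x \<oplus>\<^bsub>M\<^esub> y) = a \<odot>\<^bsub>M\<^esub> x \<oplus>\<^bsub>M\<^esub> a \<odot>\<^bsub>M\<^esub> y"
    and smult_assoc:
      "\<lbrakk>a \<in> carrier R; b \<in> carrier R; x \<in> carrier M\<rbrakk> \<Longrightarrow>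
        (a \<otimes> b) \<odot>\<^bsub>M\<^esub> x = a \<odot>\<^bsub>M\<^esub> (b \<odot>\<^bsub>M\<^esub> x)"
    and smult_one [simp]: "x \<in> carrier M \<Longrightarrow> \<one> \<odot>\<^bsub>M\<^esub> x = x"
begin

lemma left_module: "left_module R M" ..

lemma additive_smult_left: "x \<in> carrier M \<Longrightarrow> additive_map R M (\<lambda>a. a \<odot>\<^bsub>M\<^esub> x)"
  by (simp add: additive_map_def smult_l_distr)

lemma additive_smult_right: "a \<in> carrier R \<Longrightarrow> additive_map M M (\<lambda>x. a \<odot>\<^bsub>M\<^esub> x)"
  by (simp add: additive_map_def smult_r_distr)

lemma smult_l_null [simp]: "x \<in> carrier M \<Longrightarrow> \<zero> \<odot>\<^bsub>M\<^esub> x = \<zero>\<^bsub>M\<^esub>"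
  using additive_map_zero[OF R.is_abelian_group M.abelian_group_axioms additive_smult_left] .

lemma smult_r_null [simp]: "a \<in> carrier R \<Longrightarrow> a \<odot>\<^bsub>M\<^esub> \<zero>\<^bsub>M\<^esub> = \<zero>\<^bsub>M\<^esub>"
  using additive_map_zero[OF M.abelian_group_axioms M.abelian_group_axioms additive_smult_right] .

lemma smult_r_minus:
  "a \<in> carrier R \<Longrightarrow> x \<in> carrier M \<Longrightarrow> y \<in> carrier M \<Longrightarrow>
    a \<odot>\<^bsub>M\<^esub> (x \<ominus>\<^bsub>M\<^esub> y) = a \<odot>\<^bsub>M\<^esub> x \<ominus>\<^bsub>M\<^esub> a \<odot>\<^bsub>M\<^esub> y"
  using additive_map_minus[OF M.abelian_group_axioms M.abelian_group_axioms additive_smult_right] .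

lemma smult_finsum_left:
  "x \<in> carrier M \<Longrightarrow> finite I \<Longrightarrow> (\<And>i. i \<in> I \<Longrightarrow> f i \<in> carrier R) \<Longrightarrow>
    (\<Oplus>i\<in>I. f i) \<odot>\<^bsub>M\<^esub> x = (\<Oplus>\<^bsub>M\<^esub>i\<in>I. f i \<odot>\<^bsub>M\<^esub> x)"
  using additive_map_finsum[OF R.is_abelian_group M.abelian_group_axioms additive_smult_left] .

lemma a_inv_eq_smult: "x \<in> carrier M \<Longrightarrow> \<ominus>\<^bsub>M\<^esub> x = (\<ominus> \<one>) \<odot>\<^bsub>M\<^esub> x"
  using additive_map_a_inv[OF R.is_abelian_group M.abelian_group_axioms additive_smult_left, of x \<one>]
  by simp

lemma submoduleI:
  assumes "H \<subseteq> carrier M" "\<zero>\<^bsub>M\<^esub> \<in> H"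
    and "\<And>x y. \<lbrakk>x \<in> H; y \<in> H\<rbrakk> \<Longrightarrow> x \<oplus>\<^bsub>M\<^esub> y \<in> H"
    and smult: "\<And>a x. \<lbrakk>a \<in> carrier R; x \<in> H\<rbrakk> \<Longrightarrow> a \<odot>\<^bsub>M\<^esub> x \<in> H"
  shows "submodule H R M"
proof (intro submodule.intro subgroup.intro)
  fix x assume x: "x \<in> H"
  then have "\<ominus>\<^bsub>M\<^esub> x \<in> H"
    using assms(1) smult[of "\<ominus> \<one>" x] a_inv_eq_smult by auto
  then show "inv\<^bsub>add_monoid M\<^esub> x \<in> H"
    by (simp add: a_inv_def)
qed (use assms in \<open>auto simp: submodule_axioms_def\<close>)

end

lemma left_moduleI:
  fixes R (structure) and M (structure)
  assumes "ring R" "abelian_group M"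
    and "\<And>a x. \<lbrakk>a \<in> carrier R; x \<in> carrier M\<rbrakk> \<Longrightarrow> a \<odot>\<^bsub>M\<^esub> x \<in> carrier M"
    and "\<And>a b x. \<lbrakk>a \<in> carrier R; b \<in> carrier R; x \<in> carrier M\<rbrakk> \<Longrightarrow>
        (a \<oplus> b) \<odot>\<^bsub>M\<^esub> x = a \<odot>\<^bsub>M\<^esub> x \<oplus>\<^bsub>M\<^esub> b \<odot>\<^bsub>M\<^esub> x"
    and "\<And>a x y. \<lbrakk>a \<in> carrier R; x \<in> carrier M; y \<in> carrier M\<rbrakk> \<Longrightarrow>
        a \<odot>\<^bsub>M\<^esub> (x \<oplus>\<^bsub>M\<^esub> y) = a \<odot>\<^bsub>M\<^esub> x \<oplus>\<^bsub>M\<^esub> a \<odot>\<^bsub>M\<^esub> y"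
    and "\<And>a b x. \<lbrakk>a \<in> carrier R; b \<in> carrier R; x \<in> carrier M\<rbrakk> \<Longrightarrow>
        (a \<otimes> b) \<odot>\<^bsub>M\<^esub> x = a \<odot>\<^bsub>M\<^esub> (b \<odot>\<^bsub>M\<^esub> x)"
    and "\<And>x. x \<in> carrier M \<Longrightarrow> \<one> \<odot>\<^bsub>M\<^esub> x = x"
  shows "left_module R M"
  by (intro left_module.intro left_module_axioms.intro assms)

lemma module_imp_left_module: "module K M \<Longrightarrow> left_module K M"
  unfolding module_def module_axioms_def
  by (intro left_moduleI) (auto simp: cring.axioms)

context
  fixes H and R :: "('r, 'x) ring_scheme" and M :: "('r, 'm, 'y) module_scheme"
  assumes H: "submodule H R M"
begin

lemma submodule_subset: "H \<subseteq> carrier M"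
  using H by (auto simp: submodule_def subgroup_def)

lemma submodule_add: "x \<in> H \<Longrightarrow> y \<in> H \<Longrightarrow> x \<oplus>\<^bsub>M\<^esub> y \<in> H"
  using H by (auto simp: submodule_def subgroup_def)

lemma submodule_zero: "\<zero>\<^bsub>M\<^esub> \<in> H"
  using H by (auto simp: submodule_def subgroup_def)

lemma submodule_a_inv: "x \<in> H \<Longrightarrow> \<ominus>\<^bsub>M\<^esub> x \<in> H"
  using H by (auto simp: submodule_def subgroup_def a_inv_def)

lemma submodule_smult: "a \<in> carrier R \<Longrightarrow> x \<in> H \<Longrightarrow> a \<odot>\<^bsub>M\<^esub> x \<in> H"
  using H by (auto simp: submodule_def submodule_axioms_def)

lemma submodule_finsum:
  assumes "abelian_group M" "finite I" "\<And>i. i \<in> I \<Longrightarrow> f i \<in> H"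
  shows "(\<Oplus>\<^bsub>M\<^esub>i\<in>I. f i) \<in> H"
proof -
  interpret M: abelian_group M by fact
  have sub: "f i \<in> carrier M" if "i \<in> I" for i
    using assms(3) that submodule_subset by blast
  show ?thesis
    using assms(2,3) sub
    by (induction I) (auto simp: submodule_zero submodule_add Pi_def)
qed

lemma submodule_left_module:
  assumes "left_module R M"
  shows "left_module R (M\<lparr>carrier := H\<rparr>)"
proof -
  interpret M: left_module R M by fact
  have sub: "x \<in> carrier M" if "x \<in> H" for x
    using that submodule_subset by blast
  show ?thesis
  proof (intro left_moduleI abelian_groupI)
    show "\<exists>y\<in>carrier (M\<lparr>carrier := H\<rparr>). y \<oplus>\<^bsub>M\<lparr>carrier := H\<rparr>\<^esub> x = \<zero>\<^bsub>M\<lparr>carrier := H\<rparr>\<^esub>"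
      if "x \<in> carrier (M\<lparr>carrier := H\<rparr>)" for x
      using that submodule_a_inv by (intro bexI[of _ "\<ominus>\<^bsub>M\<^esub> x"]) (auto simp: M.l_neg sub)
  qed (auto simp: sub submodule_add submodule_zero submodule_smult M.a_ac M.smult_l_distr
        M.smult_r_distr M.smult_assoc M.ring_axioms)
qed

end

definition linear_map ::
    "('r, 'x) ring_scheme \<Rightarrow> ('r, 'm, 'y) module_scheme \<Rightarrow> ('r, 'n, 'z) module_scheme \<Rightarrow>
     ('m \<Rightarrow> 'n) \<Rightarrow> bool" where
  "linear_map R M N h \<longleftrightarrow>
    additive_map M N h \<and> (\<forall>r\<in>carrier R. \<forall>x\<in>carrier M. h (r \<odot>\<^bsub>M\<^esub> x) = r \<odot>\<^bsub>N\<^esub> h x)"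

lemma linear_mapI:
  assumes "\<And>x. x \<in> carrier M \<Longrightarrow> h x \<in> carrier N"
    and "\<And>x y. x \<in> carrier M \<Longrightarrow> y \<in> carrier M \<Longrightarrow> h (x \<oplus>\<^bsub>M\<^esub> y) = h x \<oplus>\<^bsub>N\<^esub> h y"
    and "\<And>r x. r \<in> carrier R \<Longrightarrow> x \<in> carrier M \<Longrightarrow> h (r \<odot>\<^bsub>M\<^esub> x) = r \<odot>\<^bsub>N\<^esub> h x"
  shows "linear_map R M N h"
  using assms by (auto simp: linear_map_def additive_map_def)

lemma linear_map_additive: "linear_map R M N h \<Longrightarrow> additive_map M N h"
  by (simp add: linear_map_def)

lemma linear_map_smult:
  "linear_map R M N h \<Longrightarrow> r \<in> carrier R \<Longrightarrow> x \<in> carrier M \<Longrightarrow> h (r \<odot>\<^bsub>M\<^esub> x) = r \<odot>\<^bsub>N\<^esub> h x"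
  by (simp add: linear_map_def)

lemmas linear_map_closed = additive_map_closed[OF linear_map_additive]
  and linear_map_add = additive_map_add[OF linear_map_additive]

lemma linear_map_comp:
  "linear_map R M N h \<Longrightarrow> linear_map R N L g \<Longrightarrow> linear_map R M L (\<lambda>x. g (h x))"
  by (auto simp: linear_map_def additive_map_def)

lemma mem_a_kernel: "x \<in> a_kernel M N h \<longleftrightarrow> x \<in> carrier M \<and> h x = \<zero>\<^bsub>N\<^esub>"
  by (simp add: a_kernel_def kernel_def)

lemma a_kernel_submodule:
  assumes "left_module R M" "left_module R N" "linear_map R M N h"
  shows "submodule (a_kernel M N h) R M"
proof -
  interpret M: left_module R M by fact
  interpret N: left_module R N by fact
  show ?thesis
    using additive_map_zero[OF M.abelian_group_axioms N.abelian_group_axioms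
        linear_map_additive[OF assms(3)]]
    by (intro M.submoduleI)
      (auto simp: mem_a_kernel linear_map_add[OF assms(3)] linear_map_smult[OF assms(3)])
qed

lemma image_submodule:
  assumes "left_module R M" "left_module R N" "linear_map R M N h"
  shows "submodule (h ` carrier M) R N"
proof -
  interpret M: left_module R M by fact
  interpret N: left_module R N by fact
  note h = assms(3)
  show ?thesis
  proof (intro N.submoduleI)
    show "h ` carrier M \<subseteq> carrier N" using linear_map_closed[OF h] by auto
    show "\<zero>\<^bsub>N\<^esub> \<in> h ` carrier M"
      using additive_map_zero[OF M.abelian_group_axioms N.abelian_group_axioms
        linear_map_additive[OF assms(3)]] by (metis M.zero_closed image_eqI)
    fix x y assume "x \<in> h ` carrier M" "y \<in> h ` carrier M"
    then obtain x' y' where "x' \<in> carrier M" "y' \<in> carrier M" "x = h x'" "y = h y'"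
      by blast
    then show "x \<oplus>\<^bsub>N\<^esub> y \<in> h ` carrier M"
      by (intro image_eqI[of _ _ "x' \<oplus>\<^bsub>M\<^esub> y'"]) (simp_all add: linear_map_add[OF h])
  next
    fix a x assume a: "a \<in> carrier R" and "x \<in> h ` carrier M"
    then obtain x' where "x' \<in> carrier M" "x = h x'"
      by blast
    then show "a \<odot>\<^bsub>N\<^esub> x \<in> h ` carrier M"
      using a by (intro image_eqI[of _ _ "a \<odot>\<^bsub>M\<^esub> x'"]) (simp_all add: linear_map_smult[OF h])
  qed
qed

section \<open>Direct sums and free modules\<close>

lemma carrier_direct_sum:
  "f \<in> carrier (direct_sum I M) \<longleftrightarrow>
    (\<forall>i\<in>I. f i \<in> carrier (M i)) \<and> (\<forall>i. i \<notin> I \<longrightarrow> f i = \<zero>\<^bsub>M i\<^esub>) \<and> finite {i. f i \<noteq> \<zero>\<^bsub>M i\<^esub>}"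
  by (simp add: direct_sum_def)

lemma zero_direct_sum: "\<zero>\<^bsub>direct_sum I M\<^esub> = (\<lambda>i. \<zero>\<^bsub>M i\<^esub>)"
  by (simp add: direct_sum_def)

lemma add_direct_sum:
  "f \<oplus>\<^bsub>direct_sum I M\<^esub> g = (\<lambda>i. if i \<in> I then f i \<oplus>\<^bsub>M i\<^esub> g i else \<zero>\<^bsub>M i\<^esub>)"
  by (simp add: direct_sum_def)

lemma smult_direct_sum:
  "r \<odot>\<^bsub>direct_sum I M\<^esub> f = (\<lambda>i. if i \<in> I then r \<odot>\<^bsub>M i\<^esub> f i else \<zero>\<^bsub>M i\<^esub>)"
  by (simp add: direct_sum_def)

lemma direct_sum_abelian_group:
  assumes "\<And>i. i \<in> I \<Longrightarrow> abelian_group (M i)"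
  shows "abelian_group (direct_sum I M)"
proof (rule abelian_groupI)
  fix f g assume fg: "f \<in> carrier (direct_sum I M)" "g \<in> carrier (direct_sum I M)"
  have "f i \<oplus>\<^bsub>M i\<^esub> g i = \<zero>\<^bsub>M i\<^esub>" if "i \<in> I" "f i = \<zero>\<^bsub>M i\<^esub>" "g i = \<zero>\<^bsub>M i\<^esub>" for i
  proof -
    interpret abelian_group "M i" using assms that by blast
    show ?thesis using that by simp
  qed
  then have "{i. (f \<oplus>\<^bsub>direct_sum I M\<^esub> g) i \<noteq> \<zero>\<^bsub>M i\<^esub>}
      \<subseteq> {i. f i \<noteq> \<zero>\<^bsub>M i\<^esub>} \<union> {i. g i \<noteq> \<zero>\<^bsub>M i\<^esub>}"
    by (auto simp: add_direct_sum)
  then have "finite {i. (f \<oplus>\<^bsub>direct_sum I M\<^esub> g) i \<noteq> \<zero>\<^bsub>M i\<^esub>}"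
    using fg by (simp add: carrier_direct_sum finite_subset)
  moreover have "\<forall>i\<in>I. (f \<oplus>\<^bsub>direct_sum I M\<^esub> g) i \<in> carrier (M i)"
    using fg abelian_groupE(1)[OF assms] by (simp add: carrier_direct_sum add_direct_sum)
  moreover have "\<forall>i. i \<notin> I \<longrightarrow> (f \<oplus>\<^bsub>direct_sum I M\<^esub> g) i = \<zero>\<^bsub>M i\<^esub>"
    by (simp add: add_direct_sum)
  ultimately show "f \<oplus>\<^bsub>direct_sum I M\<^esub> g \<in> carrier (direct_sum I M)"
    unfolding carrier_direct_sum by blast
  show "f \<oplus>\<^bsub>direct_sum I M\<^esub> g = g \<oplus>\<^bsub>direct_sum I M\<^esub> f"
    using fg abelian_groupE(4)[OF assms] by (auto simp: carrier_direct_sum add_direct_sum)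
  fix h assume h: "h \<in> carrier (direct_sum I M)"
  show "f \<oplus>\<^bsub>direct_sum I M\<^esub> g \<oplus>\<^bsub>direct_sum I M\<^esub> h
      = f \<oplus>\<^bsub>direct_sum I M\<^esub> (g \<oplus>\<^bsub>direct_sum I M\<^esub> h)"
    using fg h abelian_groupE(3)[OF assms] by (auto simp: carrier_direct_sum add_direct_sum)
next
  show "\<zero>\<^bsub>direct_sum I M\<^esub> \<in> carrier (direct_sum I M)"
    using abelian_groupE(2)[OF assms] by (auto simp: carrier_direct_sum zero_direct_sum)
next
  fix f assume f: "f \<in> carrier (direct_sum I M)"
  show "\<zero>\<^bsub>direct_sum I M\<^esub> \<oplus>\<^bsub>direct_sum I M\<^esub> f = f"
    using f abelian_groupE(5)[OF assms] by (auto simp: carrier_direct_sum zero_direct_sum add_direct_sum)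
  define g where "g = (\<lambda>i. if i \<in> I then \<ominus>\<^bsub>M i\<^esub> f i else \<zero>\<^bsub>M i\<^esub>)"
  have z: "\<ominus>\<^bsub>M i\<^esub> \<zero>\<^bsub>M i\<^esub> = \<zero>\<^bsub>M i\<^esub>" if "i \<in> I" for i
  proof -
    interpret abelian_group "M i" using assms that by blast
    show ?thesis by simp
  qed
  have "{i. g i \<noteq> \<zero>\<^bsub>M i\<^esub>} \<subseteq> {i. f i \<noteq> \<zero>\<^bsub>M i\<^esub>}"
    using z by (auto simp: g_def split: if_splits)
  then have "finite {i. g i \<noteq> \<zero>\<^bsub>M i\<^esub>}"
    using f by (simp add: carrier_direct_sum finite_subset)
  moreover have "\<forall>i\<in>I. g i \<in> carrier (M i)"
    using f abelian_group.a_inv_closed[OF assms] by (simp add: carrier_direct_sum g_def)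
  moreover have "\<forall>i. i \<notin> I \<longrightarrow> g i = \<zero>\<^bsub>M i\<^esub>"
    by (simp add: g_def)
  ultimately have "g \<in> carrier (direct_sum I M)"
    unfolding carrier_direct_sum by blast
  moreover have "g \<oplus>\<^bsub>direct_sum I M\<^esub> f = \<zero>\<^bsub>direct_sum I M\<^esub>"
    using f abelian_group.l_neg[OF assms] by (auto simp: carrier_direct_sum add_direct_sum zero_direct_sum g_def)
  ultimately show "\<exists>g\<in>carrier (direct_sum I M). g \<oplus>\<^bsub>direct_sum I M\<^esub> f = \<zero>\<^bsub>direct_sum I M\<^esub>"
    by blast
qed

lemma direct_sum_left_module:
  assumes "ring R" "\<And>i. i \<in> I \<Longrightarrow> left_module R (M i)"
  shows "left_module R (direct_sum I M)"
proof (rule left_moduleI)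
  show "abelian_group (direct_sum I M)"
    using assms(2) by (intro direct_sum_abelian_group) (simp add: left_module_def)
  fix a f assume af: "a \<in> carrier R" "f \<in> carrier (direct_sum I M)"
  have "a \<odot>\<^bsub>M i\<^esub> \<zero>\<^bsub>M i\<^esub> = \<zero>\<^bsub>M i\<^esub>" if "i \<in> I" for i
    using left_module.smult_r_null[OF assms(2)] that af by blast
  then have "{i. (a \<odot>\<^bsub>direct_sum I M\<^esub> f) i \<noteq> \<zero>\<^bsub>M i\<^esub>} \<subseteq> {i. f i \<noteq> \<zero>\<^bsub>M i\<^esub>}"
    by (auto simp: smult_direct_sum split: if_splits)
  then have "finite {i. (a \<odot>\<^bsub>direct_sum I M\<^esub> f) i \<noteq> \<zero>\<^bsub>M i\<^esub>}"
    using af by (simp add: carrier_direct_sum finite_subset)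
  moreover have "\<forall>i\<in>I. (a \<odot>\<^bsub>direct_sum I M\<^esub> f) i \<in> carrier (M i)"
    using af left_module.smult_closed[OF assms(2)] by (simp add: carrier_direct_sum smult_direct_sum)
  moreover have "\<forall>i. i \<notin> I \<longrightarrow> (a \<odot>\<^bsub>direct_sum I M\<^esub> f) i = \<zero>\<^bsub>M i\<^esub>"
    by (simp add: smult_direct_sum)
  ultimately show "a \<odot>\<^bsub>direct_sum I M\<^esub> f \<in> carrier (direct_sum I M)"
    unfolding carrier_direct_sum by blast
  fix b assume b: "b \<in> carrier R"
  show "(a \<oplus>\<^bsub>R\<^esub> b) \<odot>\<^bsub>direct_sum I M\<^esub> f
      = a \<odot>\<^bsub>direct_sum I M\<^esub> f \<oplus>\<^bsub>direct_sum I M\<^esub> b \<odot>\<^bsub>direct_sum I M\<^esub> f"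
    using af b left_module.smult_l_distr[OF assms(2)]
    by (auto simp: carrier_direct_sum smult_direct_sum add_direct_sum)
  show "(a \<otimes>\<^bsub>R\<^esub> b) \<odot>\<^bsub>direct_sum I M\<^esub> f = a \<odot>\<^bsub>direct_sum I M\<^esub> (b \<odot>\<^bsub>direct_sum I M\<^esub> f)"
    using af b left_module.smult_assoc[OF assms(2)]
    by (auto simp: carrier_direct_sum smult_direct_sum)
next
  fix a f g assume "a \<in> carrier R" "f \<in> carrier (direct_sum I M)" "g \<in> carrier (direct_sum I M)"
  then show "a \<odot>\<^bsub>direct_sum I M\<^esub> (f \<oplus>\<^bsub>direct_sum I M\<^esub> g)
      = a \<odot>\<^bsub>direct_sum I M\<^esub> f \<oplus>\<^bsub>direct_sum I M\<^esub> a \<odot>\<^bsub>direct_sum I M\<^esub> g"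
    using left_module.smult_r_distr[OF assms(2)]
    by (auto simp: carrier_direct_sum smult_direct_sum add_direct_sum)
next
  fix f assume "f \<in> carrier (direct_sum I M)"
  then show "\<one>\<^bsub>R\<^esub> \<odot>\<^bsub>direct_sum I M\<^esub> f = f"
    using left_module.smult_one[OF assms(2)]
    by (auto simp: carrier_direct_sum smult_direct_sum)
qed (rule assms)

section \<open>Direct sums of copies of one module\<close>

abbreviation copower :: "'b set \<Rightarrow> ('r, 'm) module \<Rightarrow> ('r, 'b \<Rightarrow> 'm) module" where
  "copower B M \<equiv> direct_sum B (\<lambda>_. M)"

definition single :: "'m \<Rightarrow> 'b \<Rightarrow> 'm \<Rightarrow> 'b \<Rightarrow> 'm" where
  "single z b m = (\<lambda>c. if c = b then m else z)"

text \<open>The map out of a coproduct given by one additive map per index. Both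
  \<open>lin_ext\<close> and \<open>tensor_map\<close> are instances, so that additivity is proved
  only once.\<close>

definition copower_ext ::
    "('m, 'x) ring_scheme \<Rightarrow> ('n, 'y) ring_scheme \<Rightarrow> ('b \<Rightarrow> 'm \<Rightarrow> 'n) \<Rightarrow> ('b \<Rightarrow> 'm) \<Rightarrow> 'n" where
  "copower_ext M N \<phi> f = (\<Oplus>\<^bsub>N\<^esub>b\<in>{b. f b \<noteq> \<zero>\<^bsub>M\<^esub>}. \<phi> b (f b))"

context
  fixes M :: "('r, 'm) module" and B :: "'b set"
  assumes M: "abelian_group M"
begin

interpretation M: abelian_group M by (rule M)

lemma copower_abelian_group: "abelian_group (copower B M)"
  using M by (rule direct_sum_abelian_group)

lemma copower_mem: "f \<in> carrier (copower B M) \<Longrightarrow> f b \<in> carrier M"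
  by (cases "b \<in> B") (auto simp: carrier_direct_sum)

lemma copower_outside: "f \<in> carrier (copower B M) \<Longrightarrow> b \<notin> B \<Longrightarrow> f b = \<zero>\<^bsub>M\<^esub>"
  by (auto simp: carrier_direct_sum)

lemma copower_add_apply:
  "f \<in> carrier (copower B M) \<Longrightarrow> g \<in> carrier (copower B M) \<Longrightarrow>
    (f \<oplus>\<^bsub>copower B M\<^esub> g) b = f b \<oplus>\<^bsub>M\<^esub> g b"
  by (auto simp: carrier_direct_sum add_direct_sum)

lemma additive_apply: "additive_map (copower B M) M (\<lambda>f. f b)"
  by (intro additive_mapI copower_mem copower_add_apply)

lemma single_closed:
  "b \<in> B \<Longrightarrow> m \<in> carrier M \<Longrightarrow> single \<zero>\<^bsub>M\<^esub> b m \<in> carrier (copower B M)"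
  by (auto simp: carrier_direct_sum single_def)

text \<open>Induction on the finite support: one coordinate at a time is split off as a
  \<open>single\<close>.\<close>

lemma copower_induct [consumes 1, case_names zero single add]:
  assumes f: "f \<in> carrier (copower B M)"
    and zero: "P (\<lambda>_. \<zero>\<^bsub>M\<^esub>)"
    and single: "\<And>b m. b \<in> B \<Longrightarrow> m \<in> carrier M \<Longrightarrow> P (single \<zero>\<^bsub>M\<^esub> b m)"
    and add: "\<And>f g. f \<in> carrier (copower B M) \<Longrightarrow> g \<in> carrier (copower B M) \<Longrightarrow> P f \<Longrightarrow> P g \<Longrightarrow>
      P (f \<oplus>\<^bsub>copower B M\<^esub> g)"
  shows "P f"
proof -
  have "finite {b. f b \<noteq> \<zero>\<^bsub>M\<^esub>}"
    using f by (simp add: carrier_direct_sum)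
  then show ?thesis
    using f
  proof (induction "{b. f b \<noteq> \<zero>\<^bsub>M\<^esub>}" arbitrary: f rule: finite_psubset_induct)
    case (psubset f)
    show ?case
    proof (cases "\<exists>b. f b \<noteq> \<zero>\<^bsub>M\<^esub>")
      case False
      then have "f = (\<lambda>_. \<zero>\<^bsub>M\<^esub>)" by auto
      with zero show ?thesis by simp
    next
      case True
      then obtain b where b: "f b \<noteq> \<zero>\<^bsub>M\<^esub>" by blast
      then have bB: "b \<in> B" using psubset.prems copower_outside by blast
      define g where "g = f(b := \<zero>\<^bsub>M\<^esub>)"
      have sub: "{c. g c \<noteq> \<zero>\<^bsub>M\<^esub>} \<subset> {b. f b \<noteq> \<zero>\<^bsub>M\<^esub>}"
        using b by (auto simp: g_def)
      then have fin: "finite {c. g c \<noteq> \<zero>\<^bsub>M\<^esub>}"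
        using psubset.hyps(1) by (meson finite_subset psubset_imp_subset)
      have "(\<forall>i\<in>B. g i \<in> carrier M) \<and> (\<forall>i. i \<notin> B \<longrightarrow> g i = \<zero>\<^bsub>M\<^esub>)"
        using psubset.prems by (simp add: carrier_direct_sum g_def)
      with fin have g: "g \<in> carrier (copower B M)"
        by (simp add: carrier_direct_sum)
      have s: "single \<zero>\<^bsub>M\<^esub> b (f b) \<in> carrier (copower B M)"
        using bB psubset.prems by (intro single_closed copower_mem)
      have "f = g \<oplus>\<^bsub>copower B M\<^esub> single \<zero>\<^bsub>M\<^esub> b (f b)"
      proof
        fix c show "f c = (g \<oplus>\<^bsub>copower B M\<^esub> single \<zero>\<^bsub>M\<^esub> b (f b)) c"
          using copower_mem[OF psubset.prems]
          unfolding copower_add_apply[OF g s] by (simp add: g_def single_def)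
      qed
      moreover have "P (g \<oplus>\<^bsub>copower B M\<^esub> single \<zero>\<^bsub>M\<^esub> b (f b))"
        using add[OF g s psubset.hyps(2)[OF sub g] single[OF bB copower_mem[OF psubset.prems]]] .
      ultimately show ?thesis by simp
    qed
  qed
qed

lemma additive_copower_eq:
  assumes N: "abelian_group N"
    and h: "additive_map (copower B M) N h" and h': "additive_map (copower B M) N h'"
    and eq: "\<And>b m. b \<in> B \<Longrightarrow> m \<in> carrier M \<Longrightarrow> h (single \<zero>\<^bsub>M\<^esub> b m) = h' (single \<zero>\<^bsub>M\<^esub> b m)"
    and f: "f \<in> carrier (copower B M)"
  shows "h f = h' f"
  using f
proof (induction rule: copower_induct)
  case zero
  show ?case
    using additive_map_zero[OF copower_abelian_group N h]
      additive_map_zero[OF copower_abelian_group N h'] by (simp add: zero_direct_sum)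
qed (simp_all add: eq additive_map_add[OF h] additive_map_add[OF h'])

context
  fixes N :: "('n, 'y) ring_scheme" and \<phi> :: "'b \<Rightarrow> 'm \<Rightarrow> 'n"
  assumes N: "abelian_group N"
    and \<phi>: "\<And>b. b \<in> B \<Longrightarrow> additive_map M N (\<phi> b)"
begin

interpretation N: abelian_group N by (rule N)

text \<open>The defining sum runs over the support, which changes under addition. A common finite
  index set makes the sums for two families comparable.\<close>

lemma copower_ext_superset:
  assumes f: "f \<in> carrier (copower B M)"
    and S: "finite S" "S \<subseteq> B" "{b. f b \<noteq> \<zero>\<^bsub>M\<^esub>} \<subseteq> S"
  shows "copower_ext M N \<phi> f = (\<Oplus>\<^bsub>N\<^esub>b\<in>S. \<phi> b (f b))"
  unfolding copower_ext_def
proof (rule N.add.finprod_mono_neutral_cong_left)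
  show "\<phi> b (f b) = \<zero>\<^bsub>N\<^esub>" if "b \<in> S - {b. f b \<noteq> \<zero>\<^bsub>M\<^esub>}" for b
    using that S additive_map_zero[OF M N \<phi>] by auto
  show "(\<lambda>b. \<phi> b (f b)) \<in> S \<rightarrow> carrier N"
    using S additive_map_closed[OF \<phi>] copower_mem[OF f] by blast
qed (use S in auto)

lemma copower_ext_additive: "additive_map (copower B M) N (copower_ext M N \<phi>)"
proof (rule additive_mapI)
  fix f assume f: "f \<in> carrier (copower B M)"
  have "\<phi> b (f b) \<in> carrier N" if "f b \<noteq> \<zero>\<^bsub>M\<^esub>" for b
    using that additive_map_closed[OF \<phi>] copower_mem[OF f] copower_outside[OF f] by blast
  then show "copower_ext M N \<phi> f \<in> carrier N"
    unfolding copower_ext_def by (intro N.finsum_closed) auto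
  fix g assume g: "g \<in> carrier (copower B M)"
  define S where "S = {b. f b \<noteq> \<zero>\<^bsub>M\<^esub>} \<union> {b. g b \<noteq> \<zero>\<^bsub>M\<^esub>}"
  have S: "finite S" "S \<subseteq> B"
    using f g by (auto simp: S_def carrier_direct_sum)
  have fg: "f \<oplus>\<^bsub>copower B M\<^esub> g \<in> carrier (copower B M)"
    using abelian_groupE(1)[OF copower_abelian_group f g] .
  have c: "\<phi> b (f b) \<in> carrier N" "\<phi> b (g b) \<in> carrier N" if "b \<in> S" for b
    using that additive_map_closed[OF \<phi>] copower_mem[OF f] copower_mem[OF g] S by blast+
  have "copower_ext M N \<phi> (f \<oplus>\<^bsub>copower B M\<^esub> g) = (\<Oplus>\<^bsub>N\<^esub>b\<in>S. \<phi> b (f b) \<oplus>\<^bsub>N\<^esub> \<phi> b (g b))"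
  proof (subst copower_ext_superset[OF fg S])
    show "{b. (f \<oplus>\<^bsub>copower B M\<^esub> g) b \<noteq> \<zero>\<^bsub>M\<^esub>} \<subseteq> S"
      by (auto simp: S_def copower_add_apply[OF f g])
    show "(\<Oplus>\<^bsub>N\<^esub>b\<in>S. \<phi> b ((f \<oplus>\<^bsub>copower B M\<^esub> g) b)) = (\<Oplus>\<^bsub>N\<^esub>b\<in>S. \<phi> b (f b) \<oplus>\<^bsub>N\<^esub> \<phi> b (g b))"
      using S c
      by (intro N.finsum_cong')
        (auto simp: copower_add_apply[OF f g] additive_map_add[OF \<phi>] copower_mem[OF f] copower_mem[OF g])
  qed
  also have "\<dots> = (\<Oplus>\<^bsub>N\<^esub>b\<in>S. \<phi> b (f b)) \<oplus>\<^bsub>N\<^esub> (\<Oplus>\<^bsub>N\<^esub>b\<in>S. \<phi> b (g b))"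
    using c by (intro N.finsum_addf) auto
  also have "\<dots> = copower_ext M N \<phi> f \<oplus>\<^bsub>N\<^esub> copower_ext M N \<phi> g"
    using copower_ext_superset[OF f S] copower_ext_superset[OF g S] by (simp add: S_def)
  finally show "copower_ext M N \<phi> (f \<oplus>\<^bsub>copower B M\<^esub> g) = copower_ext M N \<phi> f \<oplus>\<^bsub>N\<^esub> copower_ext M N \<phi> g" .
qed

lemma copower_ext_single:
  assumes "b \<in> B" "m \<in> carrier M"
  shows "copower_ext M N \<phi> (single \<zero>\<^bsub>M\<^esub> b m) = \<phi> b m"
proof -
  have "copower_ext M N \<phi> (single \<zero>\<^bsub>M\<^esub> b m) = (\<Oplus>\<^bsub>N\<^esub>c\<in>{b}. \<phi> c (single \<zero>\<^bsub>M\<^esub> b m c))"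
    using assms by (intro copower_ext_superset single_closed) (auto simp: single_def)
  also have "\<dots> = \<phi> b m"
    using assms additive_map_closed[OF \<phi>] by (simp add: single_def)
  finally show ?thesis .
qed

end

end

section \<open>Free modules as direct sums of copies of the scalar ring\<close>

lemma regular_module_simps [simp]:
  "carrier (regular_module R) = carrier R" "zero (regular_module R) = zero R"
  "add (regular_module R) = add R" "smult (regular_module R) = mult R"
  by (simp_all add: regular_module_def)

context ring
begin

lemma regular_left_module: "left_module R (regular_module R)"
proof (rule left_moduleI)
  show "abelian_group (regular_module R)"
  proof (rule abelian_groupI)
    show "\<exists>y\<in>carrier (regular_module R). y \<oplus>\<^bsub>regular_module R\<^esub> x = \<zero>\<^bsub>regular_module R\<^esub>"
      if "x \<in> carrier (regular_module R)" for x
      using that l_neg by auto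
  qed (auto simp: a_ac)
qed (auto simp: l_distr r_distr m_assoc ring_axioms)

lemma regular_abelian_group: "abelian_group (regular_module R)"
  using regular_left_module by (simp add: left_module_def)

lemma free_left_module: "left_module R (free_module R B)"
  unfolding free_module_def by (rule direct_sum_left_module[OF ring_axioms regular_left_module])

lemma free_abelian_group: "abelian_group (free_module R B)"
  by (rule left_module.axioms(2)[OF free_left_module])

lemma carrier_free_module:
  "f \<in> carrier (free_module R B) \<longleftrightarrow>
    (\<forall>b\<in>B. f b \<in> carrier R) \<and> (\<forall>b. b \<notin> B \<longrightarrow> f b = \<zero>) \<and> finite {b. f b \<noteq> \<zero>}"
  by (simp add: free_module_def carrier_direct_sum)

lemma free_mem: "f \<in> carrier (free_module R B) \<Longrightarrow> f b \<in> carrier R"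
  using copower_mem[OF regular_abelian_group] by (simp add: free_module_def)

lemma free_outside: "f \<in> carrier (free_module R B) \<Longrightarrow> b \<notin> B \<Longrightarrow> f b = \<zero>"
  by (simp add: carrier_free_module)

lemma zero_free: "\<zero>\<^bsub>free_module R B\<^esub> = (\<lambda>_. \<zero>)"
  by (simp add: free_module_def zero_direct_sum)

lemma free_add_apply:
  "f \<in> carrier (free_module R B) \<Longrightarrow> g \<in> carrier (free_module R B) \<Longrightarrow>
    (f \<oplus>\<^bsub>free_module R B\<^esub> g) b = f b \<oplus> g b"
  using copower_add_apply[OF regular_abelian_group] by (simp add: free_module_def)

lemma free_smult_apply:
  "r \<in> carrier R \<Longrightarrow> f \<in> carrier (free_module R B) \<Longrightarrow> (r \<odot>\<^bsub>free_module R B\<^esub> f) b = r \<otimes> f b"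
  by (cases "b \<in> B") (auto simp: free_module_def smult_direct_sum carrier_direct_sum)

lemma basis_closed: "b \<in> B \<Longrightarrow> basis_vector R b \<in> carrier (free_module R B)"
  by (auto simp: carrier_free_module basis_vector_def)

lemma basis_smult_eq_single:
  "b \<in> B \<Longrightarrow> r \<in> carrier R \<Longrightarrow> r \<odot>\<^bsub>free_module R B\<^esub> basis_vector R b = single \<zero> b r"
  by (rule ext) (simp add: free_smult_apply[OF _ basis_closed], simp add: basis_vector_def single_def)

lemma free_induct [consumes 1, case_names zero single add]:
  assumes "f \<in> carrier (free_module R B)"
    and "P \<zero>\<^bsub>free_module R B\<^esub>"
    and "\<And>b r. b \<in> B \<Longrightarrow> r \<in> carrier R \<Longrightarrow> P (r \<odot>\<^bsub>free_module R B\<^esub> basis_vector R b)"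
    and "\<And>f g. f \<in> carrier (free_module R B) \<Longrightarrow> g \<in> carrier (free_module R B) \<Longrightarrow> P f \<Longrightarrow> P g \<Longrightarrow>
      P (f \<oplus>\<^bsub>free_module R B\<^esub> g)"
  shows "P f"
  using copower_induct[OF regular_abelian_group, of f B P] assms
  by (simp add: free_module_def[symmetric] zero_free basis_smult_eq_single)

text \<open>Agreement is asked for on all multiples of basis vectors because the maps are merely
  additive. This covers maps that are semilinear along a ring homomorphism, as needed for comparing
  resolutions over two different rings.\<close>

lemma additive_free_eq:
  assumes N: "abelian_group N"
    and h: "additive_map (free_module R B) N h" and h': "additive_map (free_module R B) N h'"
    and eq: "\<And>b r. b \<in> B \<Longrightarrow> r \<in> carrier R \<Longrightarrow> h (r \<odot>\<^bsub>free_module R B\<^esub> basis_vector R b) =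
      h' (r \<odot>\<^bsub>free_module R B\<^esub> basis_vector R b)"
    and f: "f \<in> carrier (free_module R B)"
  shows "h f = h' f"
  using f
proof (induction rule: free_induct)
  case zero
  show ?case
    using additive_map_zero[OF free_abelian_group N h]
      additive_map_zero[OF free_abelian_group N h'] by simp
qed (simp_all add: eq additive_map_add[OF h] additive_map_add[OF h'])

end

context left_module
begin

lemma lin_ext_copower: "lin_ext R M \<phi> = copower_ext (regular_module R) M (\<lambda>b r. r \<odot>\<^bsub>M\<^esub> \<phi> b)"
  by (simp add: lin_ext_def copower_ext_def fun_eq_iff)

context
  fixes B :: "'idx set" and \<phi>
  assumes \<phi>: "\<And>b. b \<in> B \<Longrightarrow> \<phi> b \<in> carrier M"
begin

lemma additive_smult_regular: "b \<in> B \<Longrightarrow> additive_map (regular_module R) M (\<lambda>r. r \<odot>\<^bsub>M\<^esub> \<phi> b)"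
  using additive_smult_left[OF \<phi>] by (simp add: additive_map_def)

lemma lin_ext_additive: "additive_map (free_module R B) M (lin_ext R M \<phi>)"
  unfolding lin_ext_copower free_module_def
  by (rule copower_ext_additive[OF R.regular_abelian_group M.abelian_group_axioms additive_smult_regular])

lemma lin_ext_smult_basis:
  "b \<in> B \<Longrightarrow> r \<in> carrier R \<Longrightarrow>
    lin_ext R M \<phi> (r \<odot>\<^bsub>free_module R B\<^esub> basis_vector R b) = r \<odot>\<^bsub>M\<^esub> \<phi> b"
  using copower_ext_single[OF R.regular_abelian_group M.abelian_group_axioms additive_smult_regular, where b=b and m=r]
  by (simp add: lin_ext_copower R.basis_smult_eq_single)

lemma lin_ext_basis: "b \<in> B \<Longrightarrow> lin_ext R M \<phi> (basis_vector R b) = \<phi> b"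
  using lin_ext_smult_basis[of b \<one>] \<phi>[of b]
  by (simp add: left_module.smult_one[OF R.free_left_module R.basis_closed])

lemma lin_ext_linear: "linear_map R (free_module R B) M (lin_ext R M \<phi>)"
  unfolding linear_map_def
proof (intro conjI ballI)
  show "additive_map (free_module R B) M (lin_ext R M \<phi>)" by (rule lin_ext_additive)
  fix r f assume r: "r \<in> carrier R" and f: "f \<in> carrier (free_module R B)"
  interpret F: left_module R "free_module R B" by (rule R.free_left_module)
  show "lin_ext R M \<phi> (r \<odot>\<^bsub>free_module R B\<^esub> f) = r \<odot>\<^bsub>M\<^esub> lin_ext R M \<phi> f"
  proof (rule R.additive_free_eq[OF M.abelian_group_axioms _ _ _ f])
    show "additive_map (free_module R B) M (\<lambda>f. lin_ext R M \<phi> (r \<odot>\<^bsub>free_module R B\<^esub> f))"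
      using additive_map_comp[OF F.additive_smult_right[OF r] lin_ext_additive] .
    show "additive_map (free_module R B) M (\<lambda>f. r \<odot>\<^bsub>M\<^esub> lin_ext R M \<phi> f)"
      using additive_map_comp[OF lin_ext_additive additive_smult_right[OF r]] .
    fix b s assume bs: "b \<in> B" "s \<in> carrier R"
    then show "lin_ext R M \<phi> (r \<odot>\<^bsub>free_module R B\<^esub> (s \<odot>\<^bsub>free_module R B\<^esub> basis_vector R b))
        = r \<odot>\<^bsub>M\<^esub> lin_ext R M \<phi> (s \<odot>\<^bsub>free_module R B\<^esub> basis_vector R b)"
      using r F.smult_assoc[of r s "basis_vector R b"] lin_ext_smult_basis[of b "r \<otimes> s"]
      by (simp add: R.basis_closed lin_ext_smult_basis \<phi> smult_assoc)
  qed
qed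

end

end

section \<open>Quotients\<close>

lemma carrier_quotient: "X \<in> carrier (quotient_module M H) \<longleftrightarrow> (\<exists>x\<in>carrier M. X = H +>\<^bsub>M\<^esub> x)"
  by (auto simp: quotient_module_def A_RCOSETS_def' )

lemma zero_quotient: "\<zero>\<^bsub>quotient_module M H\<^esub> = H"
  by (simp add: quotient_module_def)

lemma add_quotient: "X \<oplus>\<^bsub>quotient_module M H\<^esub> Y = X <+>\<^bsub>M\<^esub> Y"
  by (simp add: quotient_module_def)

lemma smult_quotient:
  "r \<odot>\<^bsub>quotient_module M H\<^esub> X = (\<Union>x\<in>X. H +>\<^bsub>M\<^esub> (r \<odot>\<^bsub>M\<^esub> x))"
  by (simp add: quotient_module_def)

locale module_quotient = left_module R M for R (structure) and M (structure) +
  fixes H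
  assumes submodule: "submodule H R M"
begin

lemma abelian_subgroup: "abelian_subgroup H M"
  using submodule by (intro abelian_subgroupI3 additive_subgroupI M.abelian_group_axioms)
    (simp add: submodule_def)

sublocale S: abelian_subgroup H M
  by (rule abelian_subgroup)

lemma mem_coset: "x \<in> carrier M \<Longrightarrow> y \<in> H +>\<^bsub>M\<^esub> x \<longleftrightarrow> y \<in> carrier M \<and> y \<ominus>\<^bsub>M\<^esub> x \<in> H"
  using S.a_rcos_module[of x y] S.a_elemrcos_carrier[of x y] by (auto simp: a_minus_def)

lemma self_mem_coset: "x \<in> carrier M \<Longrightarrow> x \<in> H +>\<^bsub>M\<^esub> x"
  by (simp add: mem_coset S.zero_closed)

lemma coset_eq_iff:
  assumes "x \<in> carrier M" "y \<in> carrier M"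
  shows "H +>\<^bsub>M\<^esub> x = H +>\<^bsub>M\<^esub> y \<longleftrightarrow> x \<ominus>\<^bsub>M\<^esub> y \<in> H"
proof
  assume "H +>\<^bsub>M\<^esub> x = H +>\<^bsub>M\<^esub> y"
  then show "x \<ominus>\<^bsub>M\<^esub> y \<in> H"
    using self_mem_coset[OF assms(1)] mem_coset[OF assms(2)] by simp
next
  assume "x \<ominus>\<^bsub>M\<^esub> y \<in> H"
  then have "x \<in> H +>\<^bsub>M\<^esub> y" using assms by (simp add: mem_coset)
  then show "H +>\<^bsub>M\<^esub> x = H +>\<^bsub>M\<^esub> y"
    using S.a_repr_independence'[of x y] assms by simp
qed

lemma coset_zero: "H +>\<^bsub>M\<^esub> \<zero>\<^bsub>M\<^esub> = H"
  using S.a_rcos_const[OF S.zero_closed] .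

lemma coset_closed: "x \<in> carrier M \<Longrightarrow> H +>\<^bsub>M\<^esub> x \<in> carrier (quotient_module M H)"
  by (auto simp: carrier_quotient)

lemma coset_add:
  "x \<in> carrier M \<Longrightarrow> y \<in> carrier M \<Longrightarrow>
    (H +>\<^bsub>M\<^esub> x) \<oplus>\<^bsub>quotient_module M H\<^esub> (H +>\<^bsub>M\<^esub> y) = H +>\<^bsub>M\<^esub> (x \<oplus>\<^bsub>M\<^esub> y)"
  by (simp add: add_quotient S.a_rcos_sum)

text \<open>The scalar multiple of a coset is defined as a union of cosets, one for each
  representative. They all coincide because \<open>H\<close> is stable under scalars.\<close>

lemma coset_smult:
  assumes "r \<in> carrier R" "x \<in> carrier M"
  shows "r \<odot>\<^bsub>quotient_module M H\<^esub> (H +>\<^bsub>M\<^esub> x) = H +>\<^bsub>M\<^esub> (r \<odot>\<^bsub>M\<^esub> x)"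
proof -
  have eq: "H +>\<^bsub>M\<^esub> (r \<odot>\<^bsub>M\<^esub> y) = H +>\<^bsub>M\<^esub> (r \<odot>\<^bsub>M\<^esub> x)" if "y \<in> H +>\<^bsub>M\<^esub> x" for y
    using that assms submodule_smult[OF submodule, of r "y \<ominus>\<^bsub>M\<^esub> x"]
    by (simp add: mem_coset coset_eq_iff smult_r_minus)
  show ?thesis
    unfolding smult_quotient using self_mem_coset[OF assms(2)] by (intro SUP_eq_const eq) blast+
qed

lemma quotient_left_module: "left_module R (quotient_module M H)"
proof (rule left_moduleI)
  show "abelian_group (quotient_module M H)"
  proof (rule abelian_groupI)
    fix X assume "X \<in> carrier (quotient_module M H)"
    then obtain x where x: "x \<in> carrier M" "X = H +>\<^bsub>M\<^esub> x" by (auto simp: carrier_quotient)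
    then show "\<exists>Y\<in>carrier (quotient_module M H). Y \<oplus>\<^bsub>quotient_module M H\<^esub> X = \<zero>\<^bsub>quotient_module M H\<^esub>"
      by (intro bexI[of _ "H +>\<^bsub>M\<^esub> (\<ominus>\<^bsub>M\<^esub> x)"])
        (auto simp: coset_add zero_quotient M.l_neg coset_zero coset_closed)
    show "\<zero>\<^bsub>quotient_module M H\<^esub> \<oplus>\<^bsub>quotient_module M H\<^esub> X = X"
      using x coset_add[of "\<zero>\<^bsub>M\<^esub>" x] by (simp add: zero_quotient coset_zero)
  next
    show "\<zero>\<^bsub>quotient_module M H\<^esub> \<in> carrier (quotient_module M H)"
      using coset_closed[of "\<zero>\<^bsub>M\<^esub>"] by (simp add: zero_quotient coset_zero)
  qed (auto simp: carrier_quotient coset_add M.a_ac intro: bexI)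
qed (auto simp: carrier_quotient coset_add coset_smult smult_l_distr smult_r_distr smult_assoc
    R.ring_axioms)

text \<open>This gives meaning to \<open>the_elem\<close> in \<open>tensor_lift\<close>: a map that
  kills \<open>H\<close> has a singleton as image of each coset.\<close>

lemma image_coset:
  assumes "abelian_group N" "additive_map M N h" "\<And>x. x \<in> H \<Longrightarrow> h x = \<zero>\<^bsub>N\<^esub>" "x \<in> carrier M"
  shows "h ` (H +>\<^bsub>M\<^esub> x) = {h x}"
proof -
  interpret N: abelian_group N by fact
  have eq: "h y = h x" if "y \<in> H +>\<^bsub>M\<^esub> x" for y
  proof -
    have y: "y \<in> carrier M" "y \<ominus>\<^bsub>M\<^esub> x \<in> H" using that assms(4) by (auto simp: mem_coset)
    have "h y \<ominus>\<^bsub>N\<^esub> h x = \<zero>\<^bsub>N\<^esub>"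
      using additive_map_minus[OF M.abelian_group_axioms assms(1,2) y(1) assms(4)] assms(3)[OF y(2)]
      by simp
    then show ?thesis
      using additive_map_closed[OF assms(2)] y(1) assms(4) by (simp add: N.minus_eq_zero_iff)
  qed
  show ?thesis
  proof
    show "h ` (H +>\<^bsub>M\<^esub> x) \<subseteq> {h x}" using eq by blast
    show "{h x} \<subseteq> h ` (H +>\<^bsub>M\<^esub> x)" using self_mem_coset[OF assms(4)] by blast
  qed
qed

end

context left_module
begin

lemma span_submodule:
  assumes "S \<subseteq> carrier M"
  shows "submodule (module_span R M S) R M"
proof -
  have c: "submodule (carrier M) R M" by (rule submoduleI) auto
  show ?thesis
  proof (rule submoduleI)
    show "module_span R M S \<subseteq> carrier M"
      using c assms by (auto simp: module_span_def)
  qed (auto simp: module_span_def intro: submodule_zero submodule_add submodule_smult)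
qed

end

lemma span_superset: "S \<subseteq> module_span R M S"
  by (auto simp: module_span_def)

lemma span_least: "submodule H R M \<Longrightarrow> S \<subseteq> H \<Longrightarrow> module_span R M S \<subseteq> H"
  by (auto simp: module_span_def)

section \<open>Tensor products\<close>

locale right_module_over = K?: left_module K M + R?: ring R
    for K :: "('k, 'x) ring_scheme" and R :: "('r, 'y) ring_scheme"
      and M :: "('k, 'r, 'm) right_module" (structure) +
  assumes rsmult_closed [simp, intro]:
      "\<lbrakk>m \<in> carrier M; r \<in> carrier R\<rbrakk> \<Longrightarrow> rsmult M m r \<in> carrier M"
    and rsmult_add_left:
      "\<lbrakk>m \<in> carrier M; m' \<in> carrier M; r \<in> carrier R\<rbrakk> \<Longrightarrow>
        rsmult M (m \<oplus> m') r = rsmult M m r \<oplus> rsmult M m' r"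
    and rsmult_add_right:
      "\<lbrakk>m \<in> carrier M; r \<in> carrier R; s \<in> carrier R\<rbrakk> \<Longrightarrow>
        rsmult M m (r \<oplus>\<^bsub>R\<^esub> s) = rsmult M m r \<oplus> rsmult M m s"
    and rsmult_assoc:
      "\<lbrakk>m \<in> carrier M; r \<in> carrier R; s \<in> carrier R\<rbrakk> \<Longrightarrow>
        rsmult M m (r \<otimes>\<^bsub>R\<^esub> s) = rsmult M (rsmult M m r) s"
    and rsmult_one [simp]: "m \<in> carrier M \<Longrightarrow> rsmult M m \<one>\<^bsub>R\<^esub> = m"
    and rsmult_smult:
      "\<lbrakk>c \<in> carrier K; m \<in> carrier M; r \<in> carrier R\<rbrakk> \<Longrightarrow>
        rsmult M (c \<odot> m) r = c \<odot> rsmult M m r"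
begin

lemma additive_rsmult_left: "r \<in> carrier R \<Longrightarrow> additive_map M M (\<lambda>m. rsmult M m r)"
  by (intro additive_mapI) (simp_all add: rsmult_add_left)

lemma additive_rsmult_right: "m \<in> carrier M \<Longrightarrow> additive_map R M (\<lambda>r. rsmult M m r)"
  by (intro additive_mapI) (simp_all add: rsmult_add_right)

lemma rsmult_zero_left [simp]: "r \<in> carrier R \<Longrightarrow> rsmult M \<zero> r = \<zero>"
  using additive_map_zero[OF M.abelian_group_axioms M.abelian_group_axioms additive_rsmult_left] .

lemma rsmult_zero_right [simp]: "m \<in> carrier M \<Longrightarrow> rsmult M m \<zero>\<^bsub>R\<^esub> = \<zero>"
  using additive_map_zero[OF R.is_abelian_group M.abelian_group_axioms additive_rsmult_right] .

end

definition balanced where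
  "balanced K R M N T \<phi> \<longleftrightarrow>
    (\<forall>m\<in>carrier M. \<forall>n\<in>carrier N. \<phi> m n \<in> carrier T) \<and>
    (\<forall>m\<in>carrier M. \<forall>m'\<in>carrier M. \<forall>n\<in>carrier N. \<phi> (m \<oplus>\<^bsub>M\<^esub> m') n = \<phi> m n \<oplus>\<^bsub>T\<^esub> \<phi> m' n) \<and>
    (\<forall>m\<in>carrier M. \<forall>n\<in>carrier N. \<forall>n'\<in>carrier N. \<phi> m (n \<oplus>\<^bsub>N\<^esub> n') = \<phi> m n \<oplus>\<^bsub>T\<^esub> \<phi> m n') \<and>
    (\<forall>c\<in>carrier K. \<forall>m\<in>carrier M. \<forall>n\<in>carrier N. \<phi> (c \<odot>\<^bsub>M\<^esub> m) n = c \<odot>\<^bsub>T\<^esub> \<phi> m n) \<and>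
    (\<forall>m\<in>carrier M. \<forall>r\<in>carrier R. \<forall>n\<in>carrier N. \<phi> (rsmult M m r) n = \<phi> m (r \<odot>\<^bsub>N\<^esub> n))"

lemma balancedI:
  assumes "\<And>m n. \<lbrakk>m \<in> carrier M; n \<in> carrier N\<rbrakk> \<Longrightarrow> \<phi> m n \<in> carrier T"
    and "\<And>m m' n. \<lbrakk>m \<in> carrier M; m' \<in> carrier M; n \<in> carrier N\<rbrakk> \<Longrightarrow>
      \<phi> (m \<oplus>\<^bsub>M\<^esub> m') n = \<phi> m n \<oplus>\<^bsub>T\<^esub> \<phi> m' n"
    and "\<And>m n n'. \<lbrakk>m \<in> carrier M; n \<in> carrier N; n' \<in> carrier N\<rbrakk> \<Longrightarrow>
      \<phi> m (n \<oplus>\<^bsub>N\<^esub> n') = \<phi> m n \<oplus>\<^bsub>T\<^esub> \<phi> m n'"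
    and "\<And>c m n. \<lbrakk>c \<in> carrier K; m \<in> carrier M; n \<in> carrier N\<rbrakk> \<Longrightarrow>
      \<phi> (c \<odot>\<^bsub>M\<^esub> m) n = c \<odot>\<^bsub>T\<^esub> \<phi> m n"
    and "\<And>m r n. \<lbrakk>m \<in> carrier M; r \<in> carrier R; n \<in> carrier N\<rbrakk> \<Longrightarrow>
      \<phi> (rsmult M m r) n = \<phi> m (r \<odot>\<^bsub>N\<^esub> n)"
  shows "balanced K R M N T \<phi>"
  using assms by (simp add: balanced_def)

locale tensor_product = right_module_over K R M + N?: left_module R N
    for K :: "('k, 'x) ring_scheme" and R :: "('r, 'y) ring_scheme"
      and M :: "('k, 'r, 'm) right_module" and N :: "('r, 'n) module"
begin

abbreviation "V \<equiv> free_module K (carrier M \<times> carrier N)"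
abbreviation "Rel \<equiv> tensor_rel K R M N"
abbreviation "T \<equiv> tensor K R M N"
abbreviation "pure \<equiv> pure_tensor K R M N"

sublocale V: left_module K V
  by (rule K.R.free_left_module)

definition "gens =
      {basis_vector K (m \<oplus>\<^bsub>M\<^esub> m', n) \<ominus>\<^bsub>V\<^esub> (basis_vector K (m, n) \<oplus>\<^bsub>V\<^esub> basis_vector K (m', n)) | m m' n.
          m \<in> carrier M \<and> m' \<in> carrier M \<and> n \<in> carrier N} \<union>
       {basis_vector K (m, n \<oplus>\<^bsub>N\<^esub> n') \<ominus>\<^bsub>V\<^esub> (basis_vector K (m, n) \<oplus>\<^bsub>V\<^esub> basis_vector K (m, n')) | m n n'.
          m \<in> carrier M \<and> n \<in> carrier N \<and> n' \<in> carrier N} \<union>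
       {basis_vector K (c \<odot>\<^bsub>M\<^esub> m, n) \<ominus>\<^bsub>V\<^esub> c \<odot>\<^bsub>V\<^esub> basis_vector K (m, n) | c m n.
          c \<in> carrier K \<and> m \<in> carrier M \<and> n \<in> carrier N} \<union>
       {basis_vector K (rsmult M m r, n) \<ominus>\<^bsub>V\<^esub> basis_vector K (m, r \<odot>\<^bsub>N\<^esub> n) | m r n.
          m \<in> carrier M \<and> r \<in> carrier R \<and> n \<in> carrier N}"

lemma Rel_eq: "Rel = module_span K V gens"
  by (simp add: tensor_rel_def gens_def Let_def)

lemma basis_closed': "m \<in> carrier M \<Longrightarrow> n \<in> carrier N \<Longrightarrow> basis_vector K (m, n) \<in> carrier V"
  by (rule K.R.basis_closed) simp

lemma gens_subset: "gens \<subseteq> carrier V"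
  unfolding gens_def by (auto intro!: V.minus_closed basis_closed')

sublocale Q: module_quotient K V Rel
  by (intro module_quotient.intro module_quotient_axioms.intro V.left_module)
    (simp add: Rel_eq V.span_submodule[OF gens_subset])

lemma T_eq: "T = quotient_module V Rel"
  by (simp add: tensor_def)

sublocale T: left_module K T
  unfolding T_eq by (rule Q.quotient_left_module)

lemma pure_eq: "pure m n = Rel +>\<^bsub>V\<^esub> basis_vector K (m, n)"
  by (simp add: pure_tensor_def)

lemma pure_closed: "m \<in> carrier M \<Longrightarrow> n \<in> carrier N \<Longrightarrow> pure m n \<in> carrier T"
  unfolding pure_eq T_eq by (intro Q.coset_closed basis_closed')

lemma pure_eqI:
  assumes "x \<in> carrier V" "y \<in> carrier V" "x \<ominus>\<^bsub>V\<^esub> y \<in> gens"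
  shows "Rel +>\<^bsub>V\<^esub> x = Rel +>\<^bsub>V\<^esub> y"
proof -
  have "x \<ominus>\<^bsub>V\<^esub> y \<in> Rel"
    unfolding Rel_eq by (rule subsetD[OF span_superset assms(3)])
  then show ?thesis using Q.coset_eq_iff[OF assms(1,2)] by simp
qed

lemma pure_balanced: "balanced K R M N T pure"
proof (rule balancedI)
  fix m m' n assume a: "m \<in> carrier M" "m' \<in> carrier M" "n \<in> carrier N"
  have "pure (m \<oplus>\<^bsub>M\<^esub> m') n = Rel +>\<^bsub>V\<^esub> (basis_vector K (m, n) \<oplus>\<^bsub>V\<^esub> basis_vector K (m', n))"
    unfolding pure_eq using a by (intro pure_eqI V.a_closed basis_closed' K.M.a_closed) (auto simp: gens_def)
  then show "pure (m \<oplus>\<^bsub>M\<^esub> m') n = pure m n \<oplus>\<^bsub>T\<^esub> pure m' n"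
    using a by (simp add: pure_eq T_eq Q.coset_add basis_closed')
next
  fix m n n' assume a: "m \<in> carrier M" "n \<in> carrier N" "n' \<in> carrier N"
  have "pure m (n \<oplus>\<^bsub>N\<^esub> n') = Rel +>\<^bsub>V\<^esub> (basis_vector K (m, n) \<oplus>\<^bsub>V\<^esub> basis_vector K (m, n'))"
    unfolding pure_eq using a by (intro pure_eqI V.a_closed basis_closed' N.M.a_closed) (auto simp: gens_def)
  then show "pure m (n \<oplus>\<^bsub>N\<^esub> n') = pure m n \<oplus>\<^bsub>T\<^esub> pure m n'"
    using a by (simp add: pure_eq T_eq Q.coset_add basis_closed')
next
  fix c m n assume a: "c \<in> carrier K" "m \<in> carrier M" "n \<in> carrier N"
  have "pure (c \<odot>\<^bsub>M\<^esub> m) n = Rel +>\<^bsub>V\<^esub> (c \<odot>\<^bsub>V\<^esub> basis_vector K (m, n))"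
    unfolding pure_eq using a
    by (intro pure_eqI V.smult_closed basis_closed' K.smult_closed) (auto simp: gens_def)
  then show "pure (c \<odot>\<^bsub>M\<^esub> m) n = c \<odot>\<^bsub>T\<^esub> pure m n"
    using a by (simp add: pure_eq T_eq Q.coset_smult basis_closed')
next
  fix m r n assume a: "m \<in> carrier M" "r \<in> carrier R" "n \<in> carrier N"
  show "pure (rsmult M m r) n = pure m (r \<odot>\<^bsub>N\<^esub> n)"
    unfolding pure_eq using a
    by (intro pure_eqI basis_closed' rsmult_closed N.smult_closed) (auto simp: gens_def)
qed (rule pure_closed)

lemma
  shows pure_add_left: "\<lbrakk>m \<in> carrier M; m' \<in> carrier M; n \<in> carrier N\<rbrakk> \<Longrightarrow>
      pure (m \<oplus>\<^bsub>M\<^esub> m') n = pure m n \<oplus>\<^bsub>T\<^esub> pure m' n"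
    and pure_add_right: "\<lbrakk>m \<in> carrier M; n \<in> carrier N; n' \<in> carrier N\<rbrakk> \<Longrightarrow>
      pure m (n \<oplus>\<^bsub>N\<^esub> n') = pure m n \<oplus>\<^bsub>T\<^esub> pure m n'"
    and pure_smult: "\<lbrakk>c \<in> carrier K; m \<in> carrier M; n \<in> carrier N\<rbrakk> \<Longrightarrow>
      pure (c \<odot>\<^bsub>M\<^esub> m) n = c \<odot>\<^bsub>T\<^esub> pure m n"
    and pure_rsmult: "\<lbrakk>m \<in> carrier M; r \<in> carrier R; n \<in> carrier N\<rbrakk> \<Longrightarrow>
      pure (rsmult M m r) n = pure m (r \<odot>\<^bsub>N\<^esub> n)"
  using pure_balanced by (simp_all add: balanced_def)

text \<open>A scalar can be absorbed into the first factor of a pure tensor, so the pure tensors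
  generate the tensor product already as an additive group.\<close>

lemma tensor_induct [consumes 1, case_names zero pure add]:
  assumes X: "X \<in> carrier T"
    and zero: "P \<zero>\<^bsub>T\<^esub>"
    and pure: "\<And>m n. m \<in> carrier M \<Longrightarrow> n \<in> carrier N \<Longrightarrow> P (pure m n)"
    and add: "\<And>X Y. X \<in> carrier T \<Longrightarrow> Y \<in> carrier T \<Longrightarrow> P X \<Longrightarrow> P Y \<Longrightarrow> P (X \<oplus>\<^bsub>T\<^esub> Y)"
  shows "P X"
proof -
  obtain v where v: "v \<in> carrier V" "X = Rel +>\<^bsub>V\<^esub> v"
    using X by (auto simp: T_eq carrier_quotient)
  from v(1) have "P (Rel +>\<^bsub>V\<^esub> v)"
  proof (induction rule: K.R.free_induct)
    case zero
    then show ?case using assms(2) by (simp add: T_eq zero_quotient Q.coset_zero)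
  next
    case (single b r)
    then obtain m n where b: "b = (m, n)" "m \<in> carrier M" "n \<in> carrier N" by auto
    have "pure (r \<odot>\<^bsub>M\<^esub> m) n = r \<odot>\<^bsub>T\<^esub> pure m n"
      using b single by (simp add: pure_smult)
    also have "\<dots> = Rel +>\<^bsub>V\<^esub> (r \<odot>\<^bsub>V\<^esub> basis_vector K b)"
      using b single by (simp add: pure_eq T_eq Q.coset_smult basis_closed')
    finally show ?case using pure b single by (metis K.smult_closed)
  next
    case (add f g)
    then show ?case
      using assms(4)[of "Rel +>\<^bsub>V\<^esub> f" "Rel +>\<^bsub>V\<^esub> g"] by (simp add: T_eq Q.coset_add Q.coset_closed)
  qed
  with v show ?thesis by simp
qed

lemma additive_tensor_eq:
  assumes N': "abelian_group N'"
    and h: "additive_map T N' h" and h': "additive_map T N' h'"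
    and eq: "\<And>m n. m \<in> carrier M \<Longrightarrow> n \<in> carrier N \<Longrightarrow> h (pure m n) = h' (pure m n)"
    and X: "X \<in> carrier T"
  shows "h X = h' X"
  using X
proof (induction rule: tensor_induct)
  case zero
  show ?case
    using additive_map_zero[OF T.M.abelian_group_axioms N' h]
      additive_map_zero[OF T.M.abelian_group_axioms N' h'] by simp
qed (simp_all add: eq additive_map_add[OF h] additive_map_add[OF h'])

context
  fixes L :: "('k, 't, 'z) module_scheme" and \<phi>
  assumes L: "left_module K L" and \<phi>: "balanced K R M N L \<phi>"
begin

interpretation L: left_module K L by (rule L)

lemma lin_ext_balanced_linear: "linear_map K V L (lin_ext K L (\<lambda>(m, n). \<phi> m n))"
  by (rule L.lin_ext_linear) (use \<phi> in \<open>auto simp: balanced_def\<close>)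

lemma lin_ext_balanced_basis:
  "m \<in> carrier M \<Longrightarrow> n \<in> carrier N \<Longrightarrow>
    lin_ext K L (\<lambda>(m, n). \<phi> m n) (basis_vector K (m, n)) = \<phi> m n"
  using \<phi> L.lin_ext_basis[where B = "carrier M \<times> carrier N" and \<phi> = "\<lambda>(m, n). \<phi> m n" and b = "(m, n)"]
  by (auto simp: balanced_def)

text \<open>The kernel of the linear extension is a submodule, so it suffices that it contains the
  generators. Each kind of generator corresponds to one identity in \<open>balanced\<close>.\<close>

lemma lin_ext_balanced_Rel: "x \<in> Rel \<Longrightarrow> lin_ext K L (\<lambda>(m, n). \<phi> m n) x = \<zero>\<^bsub>L\<^esub>"
proof -
  let ?h = "lin_ext K L (\<lambda>(m, n). \<phi> m n)"
  note lin = lin_ext_balanced_linear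
  note add = linear_map_add[OF lin] and sm = linear_map_smult[OF lin]
    and mi = additive_map_minus[OF V.M.abelian_group_axioms L.M.abelian_group_axioms linear_map_additive[OF lin]]
  have "gens \<subseteq> a_kernel V L ?h"
    using \<phi> gens_subset unfolding gens_def
    by (auto simp: mem_a_kernel mi add sm lin_ext_balanced_basis basis_closed' balanced_def)
  then have "Rel \<subseteq> a_kernel V L ?h"
    unfolding Rel_eq by (intro span_least a_kernel_submodule[OF V.left_module L lin])
  then show "x \<in> Rel \<Longrightarrow> ?h x = \<zero>\<^bsub>L\<^esub>" by (auto simp: mem_a_kernel)
qed

lemma tensor_lift_coset:
  assumes "x \<in> carrier V"
  shows "tensor_lift K L (\<lambda>(m, n). \<phi> m n) (Rel +>\<^bsub>V\<^esub> x) = lin_ext K L (\<lambda>(m, n). \<phi> m n) x"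
  using Q.image_coset[OF L.M.abelian_group_axioms linear_map_additive[OF lin_ext_balanced_linear]
      lin_ext_balanced_Rel assms]
  by (simp add: tensor_lift_def)

lemma tensor_lift_pure:
  "m \<in> carrier M \<Longrightarrow> n \<in> carrier N \<Longrightarrow> tensor_lift K L (\<lambda>(m, n). \<phi> m n) (pure m n) = \<phi> m n"
  by (simp add: pure_eq tensor_lift_coset basis_closed' lin_ext_balanced_basis)

lemma tensor_lift_linear: "linear_map K T L (tensor_lift K L (\<lambda>(m, n). \<phi> m n))"
proof (rule linear_mapI)
  note lin = lin_ext_balanced_linear
  fix X assume "X \<in> carrier T"
  then obtain x where x: "x \<in> carrier V" "X = Rel +>\<^bsub>V\<^esub> x" by (auto simp: T_eq carrier_quotient)
  then show "tensor_lift K L (\<lambda>(m, n). \<phi> m n) X \<in> carrier L"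
    by (simp add: tensor_lift_coset linear_map_closed[OF lin])
  show "tensor_lift K L (\<lambda>(m, n). \<phi> m n) (r \<odot>\<^bsub>T\<^esub> X) = r \<odot>\<^bsub>L\<^esub> tensor_lift K L (\<lambda>(m, n). \<phi> m n) X"
    if "r \<in> carrier K" for r
    using x that by (simp add: T_eq Q.coset_smult tensor_lift_coset linear_map_smult[OF lin])
  fix Y assume "Y \<in> carrier T"
  then obtain y where y: "y \<in> carrier V" "Y = Rel +>\<^bsub>V\<^esub> y" by (auto simp: T_eq carrier_quotient)
  show "tensor_lift K L (\<lambda>(m, n). \<phi> m n) (X \<oplus>\<^bsub>T\<^esub> Y)
      = tensor_lift K L (\<lambda>(m, n). \<phi> m n) X \<oplus>\<^bsub>L\<^esub> tensor_lift K L (\<lambda>(m, n). \<phi> m n) Y"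
    using x y by (simp add: T_eq Q.coset_add tensor_lift_coset linear_map_add[OF lin])
qed

end

end

section \<open>Tensor products with free modules\<close>

text \<open>\<open>direct_sum\<close> expects plain \<open>module\<close> records; this forgets the
  right action stored in the larger record.\<close>

definition underlying_module :: "('k, 'r, 'm) right_module \<Rightarrow> ('k, 'm) module" where
  "underlying_module M =
    \<lparr>carrier = carrier M, mult = mult M, one = one M, zero = zero M, add = add M, smult = smult M\<rparr>"

lemma underlying_module_simps [simp]:
  "carrier (underlying_module M) = carrier M" "zero (underlying_module M) = zero M"
  "add (underlying_module M) = add M" "smult (underlying_module M) = smult M"
  by (simp_all add: underlying_module_def)

context right_module_over
begin

abbreviation "U \<equiv> underlying_module M"

lemma underlying_left_module: "left_module K U"
proof (rule left_moduleI)
  show "abelian_group U"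
  proof (rule abelian_groupI)
    show "\<exists>y\<in>carrier U. y \<oplus>\<^bsub>U\<^esub> x = \<zero>\<^bsub>U\<^esub>" if "x \<in> carrier U" for x
      using that M.l_neg by auto
  qed (auto simp: M.a_ac)
qed (auto simp: smult_l_distr smult_r_distr smult_assoc K.R.ring_axioms)

lemma underlying_abelian_group: "abelian_group U"
  by (rule left_module.axioms(2)[OF underlying_left_module])

lemma copower_left_module: "left_module K (copower B U)"
  by (rule direct_sum_left_module[OF K.R.ring_axioms underlying_left_module])

lemma copower_mem': "y \<in> carrier (copower B U) \<Longrightarrow> y b \<in> carrier M"
  using copower_mem[OF underlying_abelian_group] by simp

lemma copower_smult_apply:
  "c \<in> carrier K \<Longrightarrow> y \<in> carrier (copower B U) \<Longrightarrow> (c \<odot>\<^bsub>copower B U\<^esub> y) b = c \<odot> y b"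
  by (auto simp: smult_direct_sum carrier_direct_sum)

text \<open>The image of \<open>m \<otimes> f\<close> under the identification of the tensor product
  of \<open>M\<close> and a free module with a direct sum of copies of \<open>M\<close>.\<close>

definition tens :: "'m \<Rightarrow> ('b \<Rightarrow> 'r) \<Rightarrow> 'b \<Rightarrow> 'm" where
  "tens m f = (\<lambda>b. rsmult M m (f b))"

lemma tens_closed:
  assumes m: "m \<in> carrier M" and f: "f \<in> carrier (free_module R B)"
  shows "tens m f \<in> carrier (copower B U)"
proof -
  have "{b. tens m f b \<noteq> \<zero>} \<subseteq> {b. f b \<noteq> \<zero>\<^bsub>R\<^esub>}"
    using m by (auto simp: tens_def)
  then have "finite {b. tens m f b \<noteq> \<zero>}"
    using f by (simp add: R.carrier_free_module finite_subset)
  then show ?thesis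
    using m f by (auto simp: tens_def carrier_direct_sum R.carrier_free_module)
qed

lemma tens_add_right:
  assumes "m \<in> carrier M" "f \<in> carrier (free_module R B)" "g \<in> carrier (free_module R B)"
  shows "tens m (f \<oplus>\<^bsub>free_module R B\<^esub> g) = tens m f \<oplus>\<^bsub>copower B U\<^esub> tens m g"
proof
  show "tens m (f \<oplus>\<^bsub>free_module R B\<^esub> g) b = (tens m f \<oplus>\<^bsub>copower B U\<^esub> tens m g) b" for b
    using copower_add_apply[OF underlying_abelian_group tens_closed[OF assms(1,2)] tens_closed[OF assms(1,3)]]
      assms R.free_add_apply[OF assms(2,3)] R.free_mem[OF assms(2)] R.free_mem[OF assms(3)]
    by (simp add: tens_def rsmult_add_right)
qed

lemma tens_add_left:
  assumes "m \<in> carrier M" "m' \<in> carrier M" "f \<in> carrier (free_module R B)"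
  shows "tens (m \<oplus> m') f = tens m f \<oplus>\<^bsub>copower B U\<^esub> tens m' f"
proof
  show "tens (m \<oplus> m') f b = (tens m f \<oplus>\<^bsub>copower B U\<^esub> tens m' f) b" for b
    using copower_add_apply[OF underlying_abelian_group tens_closed[OF assms(1,3)] tens_closed[OF assms(2,3)]]
      assms R.free_mem[OF assms(3)]
    by (simp add: tens_def rsmult_add_left)
qed

lemma additive_tens_right: "m \<in> carrier M \<Longrightarrow> additive_map (free_module R B) (copower B U) (tens m)"
  by (intro additive_mapI tens_closed tens_add_right)

lemma additive_tens_left:
  "f \<in> carrier (free_module R B) \<Longrightarrow> additive_map U (copower B U) (\<lambda>m. tens m f)"
  by (intro additive_mapI) (simp_all add: tens_closed tens_add_left)

lemma tens_smult:
  assumes "c \<in> carrier K" "m \<in> carrier M" "f \<in> carrier (free_module R B)"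
  shows "tens (c \<odot> m) f = c \<odot>\<^bsub>copower B U\<^esub> tens m f"
proof
  show "tens (c \<odot> m) f b = (c \<odot>\<^bsub>copower B U\<^esub> tens m f) b" for b
    using copower_smult_apply[OF assms(1) tens_closed[OF assms(2,3)]] assms R.free_mem[OF assms(3)]
    by (simp add: tens_def rsmult_smult)
qed

lemma tens_rsmult:
  assumes "m \<in> carrier M" "r \<in> carrier R" "f \<in> carrier (free_module R B)"
  shows "tens (rsmult M m r) f = tens m (r \<odot>\<^bsub>free_module R B\<^esub> f)"
  using assms R.free_mem[OF assms(3)] by (auto simp: tens_def R.free_smult_apply rsmult_assoc)

lemma tens_balanced: "balanced K R M (free_module R B) (copower B U) tens"
  by (intro balancedI tens_closed tens_add_left tens_add_right tens_smult tens_rsmult)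

lemma tens_basis: "m \<in> carrier M \<Longrightarrow> tens m (basis_vector R b) = single \<zero>\<^bsub>U\<^esub> b m"
  by (auto simp: tens_def basis_vector_def single_def)

lemma additive_copower_tens_eq:
  assumes "abelian_group N"
    and "additive_map (copower B U) N h" "additive_map (copower B U) N h'"
    and "\<And>b m. b \<in> B \<Longrightarrow> m \<in> carrier M \<Longrightarrow> h (tens m (basis_vector R b)) = h' (tens m (basis_vector R b))"
    and "y \<in> carrier (copower B U)"
  shows "h y = h' y"
  by (rule additive_copower_eq[OF underlying_abelian_group assms(1-3) _ assms(5)])
    (use assms(4) in \<open>simp add: tens_basis\<close>)

text \<open>The map \<open>M \<otimes> h\<close> under the identification of \<open>M \<otimes> R\<^sup>B\<close> with a direct sum of copies of \<open>M\<close>.\<close>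

definition tensor_map :: "'b set \<Rightarrow> (('c \<Rightarrow> 'r) \<Rightarrow> ('b \<Rightarrow> 'r)) \<Rightarrow> ('c \<Rightarrow> 'm) \<Rightarrow> 'b \<Rightarrow> 'm" where
  "tensor_map B' h = copower_ext U (copower B' U) (\<lambda>b m. tens m (h (basis_vector R b)))"

context
  fixes B :: "'c set" and B' :: "'b set" and h :: "('c \<Rightarrow> 'r) \<Rightarrow> ('b \<Rightarrow> 'r)"
  assumes h: "linear_map R (free_module R B) (free_module R B') h"
begin

lemma tensor_map_step:
  "b \<in> B \<Longrightarrow> additive_map U (copower B' U) (\<lambda>m. tens m (h (basis_vector R b)))"
  by (intro additive_tens_left linear_map_closed[OF h] R.basis_closed)

lemma tensor_map_additive: "additive_map (copower B U) (copower B' U) (tensor_map B' h)"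
  unfolding tensor_map_def
  by (rule copower_ext_additive[OF underlying_abelian_group
        copower_abelian_group[OF underlying_abelian_group] tensor_map_step])

lemma tensor_map_basis:
  "b \<in> B \<Longrightarrow> m \<in> carrier M \<Longrightarrow>
    tensor_map B' h (tens m (basis_vector R b)) = tens m (h (basis_vector R b))"
  unfolding tensor_map_def tens_basis
  using copower_ext_single[OF underlying_abelian_group
        copower_abelian_group[OF underlying_abelian_group] tensor_map_step, where b=b and m=m]
  by simp

text \<open>\<open>tensor_map\<close> is specified on basis vectors only. The formula extends to all
  \<open>f\<close> because a coefficient of \<open>f\<close> can be moved to \<open>m\<close> and
  \<open>h\<close> is linear.\<close>

lemma tensor_map_tens:
  assumes m: "m \<in> carrier M" and f: "f \<in> carrier (free_module R B)"
  shows "tensor_map B' h (tens m f) = tens m (h f)"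
proof (rule R.additive_free_eq[OF copower_abelian_group[OF underlying_abelian_group] _ _ _ f])
  show "additive_map (free_module R B) (copower B' U) (\<lambda>f. tensor_map B' h (tens m f))"
    by (rule additive_map_comp[OF additive_tens_right[OF m] tensor_map_additive])
  show "additive_map (free_module R B) (copower B' U) (\<lambda>f. tens m (h f))"
    by (rule additive_map_comp[OF linear_map_additive[OF h] additive_tens_right[OF m]])
  fix b r assume br: "b \<in> B" "r \<in> carrier R"
  then show "tensor_map B' h (tens m (r \<odot>\<^bsub>free_module R B\<^esub> basis_vector R b))
      = tens m (h (r \<odot>\<^bsub>free_module R B\<^esub> basis_vector R b))"
    using m linear_map_closed[OF h]
    by (simp add: tens_rsmult[symmetric] R.basis_closed tensor_map_basis linear_map_smult[OF h])
qed

lemma tensor_map_linear: "linear_map K (copower B U) (copower B' U) (tensor_map B' h)"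
  unfolding linear_map_def
proof (intro conjI ballI)
  show "additive_map (copower B U) (copower B' U) (tensor_map B' h)"
    by (rule tensor_map_additive)
  fix c y assume c: "c \<in> carrier K" and y: "y \<in> carrier (copower B U)"
  show "tensor_map B' h (c \<odot>\<^bsub>copower B U\<^esub> y) = c \<odot>\<^bsub>copower B' U\<^esub> tensor_map B' h y"
  proof (rule additive_copower_tens_eq[OF copower_abelian_group[OF underlying_abelian_group] _ _ _ y])
    show "additive_map (copower B U) (copower B' U) (\<lambda>y. tensor_map B' h (c \<odot>\<^bsub>copower B U\<^esub> y))"
      by (rule additive_map_comp[OF left_module.additive_smult_right[OF copower_left_module c]
            tensor_map_additive])
    show "additive_map (copower B U) (copower B' U) (\<lambda>y. c \<odot>\<^bsub>copower B' U\<^esub> tensor_map B' h y)"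
      by (rule additive_map_comp[OF tensor_map_additive
            left_module.additive_smult_right[OF copower_left_module c]])
    fix b m assume bm: "b \<in> B" "m \<in> carrier M"
    then show "tensor_map B' h (c \<odot>\<^bsub>copower B U\<^esub> tens m (basis_vector R b))
        = c \<odot>\<^bsub>copower B' U\<^esub> tensor_map B' h (tens m (basis_vector R b))"
      using c
      by (simp add: tens_smult[symmetric] tensor_map_basis R.basis_closed linear_map_closed[OF h])
  qed
qed

end

lemma tensor_map_comp_zero:
  assumes h: "linear_map R (free_module R B) (free_module R B') h"
    and h': "linear_map R (free_module R B') (free_module R B'') h'"
    and zero: "\<And>f. f \<in> carrier (free_module R B) \<Longrightarrow> h' (h f) = \<zero>\<^bsub>free_module R B''\<^esub>"
    and y: "y \<in> carrier (copower B U)"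
  shows "tensor_map B'' h' (tensor_map B' h y) = \<zero>\<^bsub>copower B'' U\<^esub>"
proof (rule additive_copower_tens_eq[OF copower_abelian_group[OF underlying_abelian_group] _ _ _ y])
  interpret abelian_group "copower B'' U" by (rule copower_abelian_group[OF underlying_abelian_group])
  show "additive_map (copower B U) (copower B'' U) (\<lambda>y. tensor_map B'' h' (tensor_map B' h y))"
    by (rule additive_map_comp[OF tensor_map_additive[OF h] tensor_map_additive[OF h']])
  show "additive_map (copower B U) (copower B'' U) (\<lambda>y. \<zero>\<^bsub>copower B'' U\<^esub>)"
    by (rule additive_mapI) auto
  fix b m assume bm: "b \<in> B" "m \<in> carrier M"
  have bc: "basis_vector R b \<in> carrier (free_module R B)" by (rule R.basis_closed[OF bm(1)])
  show "tensor_map B'' h' (tensor_map B' h (tens m (basis_vector R b))) = \<zero>\<^bsub>copower B'' U\<^esub>"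
    using bm bc linear_map_closed[OF h bc]
    by (simp add: tensor_map_tens[OF h] tensor_map_tens[OF h'] zero)
      (simp add: tens_def R.zero_free zero_direct_sum)
qed

section \<open>The tensor product with a free module in coordinates\<close>

definition free_tensor_map :: "'b set \<Rightarrow> ('m \<times> ('b \<Rightarrow> 'r) \<Rightarrow> 'k) set \<Rightarrow> 'b \<Rightarrow> 'm" where
  "free_tensor_map B = tensor_lift K (copower B U) (\<lambda>(m, f). tens m f)"

context
  fixes B :: "'b set"
begin

interpretation T: tensor_product K R M "free_module R B"
  by (intro tensor_product.intro right_module_over_axioms R.free_left_module)

lemma free_tensor_map_pure:
  "m \<in> carrier M \<Longrightarrow> f \<in> carrier (free_module R B) \<Longrightarrow>
    free_tensor_map B (pure_tensor K R M (free_module R B) m f) = tens m f"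
  unfolding free_tensor_map_def
  by (rule T.tensor_lift_pure[OF copower_left_module tens_balanced])

lemma free_tensor_map_linear:
  "linear_map K (tensor K R M (free_module R B)) (copower B U) (free_tensor_map B)"
  unfolding free_tensor_map_def
  by (rule T.tensor_lift_linear[OF copower_left_module tens_balanced])

lemma free_tensor_map_bij:
  "bij_betw (free_tensor_map B) (carrier (tensor K R M (free_module R B))) (carrier (copower B U))"
proof -
  let ?T = "tensor K R M (free_module R B)"
  \<comment> \<open>The candidate inverse. \<open>\<psi>_tens\<close> extends its formula from basis
    vectors to arbitrary \<open>f\<close>, after which both composites can be checked on
    generators.\<close>
  define \<psi> where "\<psi> = copower_ext U ?T (\<lambda>b m. T.pure m (basis_vector R b))"
  note T_ab = T.T.M.abelian_group_axioms
  have step: "additive_map U ?T (\<lambda>m. T.pure m (basis_vector R b))" if "b \<in> B" for b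
    using that by (intro additive_mapI) (simp_all add: T.pure_closed R.basis_closed T.pure_add_left)
  have \<psi>: "additive_map (copower B U) ?T \<psi>"
    unfolding \<psi>_def by (rule copower_ext_additive[OF underlying_abelian_group T_ab step])
  have \<psi>_single: "\<psi> (single \<zero>\<^bsub>U\<^esub> b m) = T.pure m (basis_vector R b)" if "b \<in> B" "m \<in> carrier M" for b m
    unfolding \<psi>_def
    using copower_ext_single[OF underlying_abelian_group T_ab step, where b=b and m=m] that by simp
  note th = linear_map_additive[OF free_tensor_map_linear]
  have \<psi>_tens: "\<psi> (tens m f) = T.pure m f" if m: "m \<in> carrier M" and f: "f \<in> carrier (free_module R B)" for m f
  proof (rule R.additive_free_eq[OF T_ab _ _ _ f])
    show "additive_map (free_module R B) ?T (\<lambda>f. \<psi> (tens m f))"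
      by (rule additive_map_comp[OF additive_tens_right[OF m] \<psi>])
    show "additive_map (free_module R B) ?T (T.pure m)"
      using m by (intro additive_mapI) (simp_all add: T.pure_closed T.pure_add_right)
    fix b r assume "b \<in> B" "r \<in> carrier R"
    then show "\<psi> (tens m (r \<odot>\<^bsub>free_module R B\<^esub> basis_vector R b))
        = T.pure m (r \<odot>\<^bsub>free_module R B\<^esub> basis_vector R b)"
      using m by (simp add: tens_rsmult[symmetric] T.pure_rsmult[symmetric] R.basis_closed tens_basis \<psi>_single del: underlying_module_simps)
  qed
  have inv1: "\<psi> (free_tensor_map B X) = X" if X: "X \<in> carrier ?T" for X
  proof (rule T.additive_tensor_eq[OF T_ab _ _ _ X])
    show "additive_map ?T ?T (\<lambda>X. \<psi> (free_tensor_map B X))"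
      by (rule additive_map_comp[OF th \<psi>])
    show "additive_map ?T ?T (\<lambda>X. X)" by (rule additive_mapI) simp_all
  qed (simp add: free_tensor_map_pure \<psi>_tens)
  have inv2: "free_tensor_map B (\<psi> y) = y" if y: "y \<in> carrier (copower B U)" for y
  proof (rule additive_copower_tens_eq[OF copower_abelian_group[OF underlying_abelian_group] _ _ _ y])
    show "additive_map (copower B U) (copower B U) (\<lambda>y. free_tensor_map B (\<psi> y))"
      by (rule additive_map_comp[OF \<psi> th])
    show "additive_map (copower B U) (copower B U) (\<lambda>y. y)" by (rule additive_mapI) simp_all
  qed (simp add: free_tensor_map_pure \<psi>_tens R.basis_closed)
  show ?thesis
    using inv1 inv2 additive_map_closed[OF th] additive_map_closed[OF \<psi>]
    by (intro bij_betwI[of _ _ _ \<psi>]) auto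
qed

end

end

section \<open>The canonical resolution\<close>

text \<open>The graph over the support determines the function. Finiteness enters because
  \<open>Abs_fset\<close> is injective only on finite sets.\<close>

lemma chain_cell_inj:
  assumes "finite {b. f b \<noteq> \<zero>\<^bsub>R\<^esub>}" "finite {b. g b \<noteq> \<zero>\<^bsub>R\<^esub>}" "chain_cell R f = chain_cell R g"
  shows "f = g"
proof -
  have fin: "finite {(b, h b) | b. h b \<noteq> \<zero>\<^bsub>R\<^esub>}" if "finite {b. h b \<noteq> \<zero>\<^bsub>R\<^esub>}" for h
  proof -
    have "{(b, h b) | b. h b \<noteq> \<zero>\<^bsub>R\<^esub>} = (\<lambda>b. (b, h b)) ` {b. h b \<noteq> \<zero>\<^bsub>R\<^esub>}" by auto
    then show ?thesis using that by simp
  qed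
  have "{(b, f b) | b. f b \<noteq> \<zero>\<^bsub>R\<^esub>} = {(b, g b) | b. g b \<noteq> \<zero>\<^bsub>R\<^esub>}"
    using assms(3) fin[OF assms(1)] fin[OF assms(2)] by (simp add: chain_cell_def Abs_fset_inject)
  then have *: "f b \<noteq> \<zero>\<^bsub>R\<^esub> \<and> y = f b \<longleftrightarrow> g b \<noteq> \<zero>\<^bsub>R\<^esub> \<and> y = g b" for b y
    by (auto simp: set_eq_iff)
  show ?thesis
  proof
    show "f b = g b" for b using *[of b "f b"] *[of b "g b"] by metis
  qed
qed

lemma kernel_module_simps [simp]:
  "carrier (kernel_module M N h) = a_kernel M N h" "zero (kernel_module M N h) = zero M"
  "add (kernel_module M N h) = add M" "smult (kernel_module M N h) = smult M"
  by (simp_all add: kernel_module_def)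

lemma
  fixes M :: "('r, 'm) module"
  assumes "left_module R M" and \<iota>: "inj_on \<iota> (carrier M)"
  shows cover_map_linear: "linear_map R (cover_module R \<iota> M) M (cover_map R \<iota> M)"
    and cover_map_basis: "x \<in> carrier M \<Longrightarrow> cover_map R \<iota> M (basis_vector R (\<iota> x)) = x"
proof -
  interpret left_module R M by fact
  have c: "the_inv_into (carrier M) \<iota> b \<in> carrier M" if "b \<in> \<iota> ` carrier M" for b
    using the_inv_into_into[OF \<iota> that] by simp
  show "linear_map R (cover_module R \<iota> M) M (cover_map R \<iota> M)"
    unfolding cover_module_def cover_map_def by (rule lin_ext_linear[OF c])
  show "cover_map R \<iota> M (basis_vector R (\<iota> x)) = x" if "x \<in> carrier M"
    unfolding cover_map_def
    using lin_ext_basis[OF c, where b = "\<iota> x"] that by (simp add: the_inv_into_f_f[OF \<iota>])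
qed

text \<open>Gives every term of the resolution the same shape \<open>free_module R (B n)\<close>,
  including degree 0, whose cells are of the other kind.\<close>

primrec resolution_basis ::
    "('r, 'x) ring_scheme \<Rightarrow> ('r, 'm) module \<Rightarrow> nat \<Rightarrow> ('r, 'm) cell set" where
  "resolution_basis R N 0 = Elt ` carrier N"
| "resolution_basis R N (Suc n) = chain_cell R ` carrier (syzygy R N n)"

lemma resolution_eq: "resolution R N n = free_module R (resolution_basis R N n)"
  by (cases n) (simp_all add: cover_module_def)

declare resolution_basis.simps [simp del]

locale module_resolution = left_module R N
  for R :: "('r, 'x) ring_scheme" and N :: "('r, 'n) module"
begin

abbreviation "Z \<equiv> syzygy R N"
abbreviation "F \<equiv> resolution R N"
abbreviation "d \<equiv> resolution_diff R N"
abbreviation "aug \<equiv> cover_map R Elt N"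

lemma resolution_left_module: "left_module R (F n)"
  unfolding resolution_eq by (rule R.free_left_module)

lemma inj_Elt: "inj_on Elt (carrier N)"
  by (simp add: inj_on_def)

lemma aug_linear: "linear_map R (F 0) N aug"
  using cover_map_linear[OF left_module inj_Elt] by simp

lemma aug_basis: "x \<in> carrier N \<Longrightarrow> aug (basis_vector R (Elt x)) = x"
  by (rule cover_map_basis[OF left_module inj_Elt])

lemma chain_cell_inj_on:
  assumes "S \<subseteq> carrier (free_module R B)"
  shows "inj_on (chain_cell R) S"
  using assms by (auto intro!: inj_onI elim!: chain_cell_inj[rotated 2] simp: R.carrier_free_module)

text \<open>The two claims support each other: the inclusion gives finite supports, so distinct
  elements have distinct cells and the next differential is linear; its kernel is then again a
  module.\<close>

lemma syzygy_facts: "left_module R (Z n) \<and> carrier (Z n) \<subseteq> carrier (F n)"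
proof (induction n)
  case 0
  have "submodule (a_kernel (F 0) N aug) R (F 0)"
    by (rule a_kernel_submodule[OF resolution_left_module left_module aug_linear])
  then show ?case
    using submodule_left_module[OF _ resolution_left_module[of 0]]
    by (auto simp: kernel_module_def mem_a_kernel)
next
  case (Suc n)
  interpret Zn: left_module R "Z n" using Suc by blast
  have "inj_on (chain_cell R) (carrier (Z n))"
    using Suc unfolding resolution_eq by (intro chain_cell_inj_on) auto
  then have "linear_map R (F (Suc n)) (Z n) (d n)"
    using cover_map_linear[OF Zn.left_module] by (simp add: resolution_diff_def)
  then have "submodule (a_kernel (F (Suc n)) (Z n) (d n)) R (F (Suc n))"
    by (rule a_kernel_submodule[OF resolution_left_module Zn.left_module])
  then show ?case
    using submodule_left_module[OF _ resolution_left_module[of "Suc n"]]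
    by (auto simp: kernel_module_def mem_a_kernel resolution_diff_def)
qed

lemma syzygy_left_module: "left_module R (Z n)"
  and syzygy_subset: "v \<in> carrier (Z n) \<Longrightarrow> v \<in> carrier (F n)"
  using syzygy_facts by blast+

lemma syzygy_simps: "zero (Z n) = zero (F n)" "add (Z n) = add (F n)" "smult (Z n) = smult (F n)"
  by (cases n; simp)+

lemma inj_chain_cell: "inj_on (chain_cell R) (carrier (Z n))"
  using syzygy_subset unfolding resolution_eq by (intro chain_cell_inj_on) auto

lemma diff_linear': "linear_map R (F (Suc n)) (Z n) (d n)"
  using cover_map_linear[OF syzygy_left_module inj_chain_cell]
  by (simp add: resolution_diff_def)

lemma diff_syzygy: "f \<in> carrier (F (Suc n)) \<Longrightarrow> d n f \<in> carrier (Z n)"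
  by (rule linear_map_closed[OF diff_linear'])

lemma diff_linear: "linear_map R (F (Suc n)) (F n) (d n)"
  using diff_linear'[of n] syzygy_subset by (simp add: linear_map_def additive_map_def syzygy_simps)

text \<open>Exactness is built into the construction: a syzygy is the boundary of the basis vector
  of its own cell.\<close>

lemma diff_basis: "v \<in> carrier (Z n) \<Longrightarrow> d n (basis_vector R (chain_cell R v)) = v"
  unfolding resolution_diff_def
  by (rule cover_map_basis[OF syzygy_left_module inj_chain_cell])

lemma mem_syzygy_0: "v \<in> carrier (Z 0) \<longleftrightarrow> v \<in> carrier (F 0) \<and> aug v = \<zero>\<^bsub>N\<^esub>"
  by (simp add: mem_a_kernel)

lemma mem_syzygy_Suc:
  "v \<in> carrier (Z (Suc n)) \<longleftrightarrow> v \<in> carrier (F (Suc n)) \<and> d n v = \<zero>\<^bsub>F n\<^esub>"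
  by (simp add: mem_a_kernel resolution_diff_def syzygy_simps)

lemma basis_closed_Suc: "v \<in> carrier (Z n) \<Longrightarrow> basis_vector R (chain_cell R v) \<in> carrier (F (Suc n))"
  unfolding resolution_eq by (intro R.basis_closed) (simp add: resolution_basis.simps)

lemma basis_closed_0: "x \<in> carrier N \<Longrightarrow> basis_vector R (Elt x) \<in> carrier (F 0)"
  unfolding resolution_eq by (intro R.basis_closed) (simp add: resolution_basis.simps)

lemma diff_diff: "f \<in> carrier (F (Suc (Suc n))) \<Longrightarrow> d n (d (Suc n) f) = \<zero>\<^bsub>F n\<^esub>"
  using diff_syzygy[of f "Suc n"] by (simp only: mem_syzygy_Suc)

end

declare resolution.simps [simp del] syzygy.simps [simp del]

section \<open>Comparison of a free resolution with a projective subcomplex\<close>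

lemma linear_map_diff:
  assumes "left_module R M" "left_module R N" "linear_map R M N f" "linear_map R M N g"
  shows "linear_map R M N (\<lambda>x. f x \<ominus>\<^bsub>N\<^esub> g x)"
proof -
  interpret N: left_module R N by fact
  show ?thesis
    using additive_map_diff[OF N.M.abelian_group_axioms assms(3,4)[THEN linear_map_additive]]
      linear_map_closed[OF assms(3)] linear_map_closed[OF assms(4)]
    by (simp add: linear_map_def linear_map_smult[OF assms(3)] linear_map_smult[OF assms(4)]
        N.smult_r_minus)
qed

text \<open>The direct sum of the left ideals \<open>R e\<^sub>b\<close>, inside the free module.\<close>

definition subfree :: "('r, 'x) ring_scheme \<Rightarrow> 'b set \<Rightarrow> ('b \<Rightarrow> 'r) \<Rightarrow> ('b \<Rightarrow> 'r) set" where
  "subfree R B e = {f \<in> carrier (free_module R B). \<forall>b\<in>B. f b \<otimes>\<^bsub>R\<^esub> e b = f b}"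

lemma subfree_closed: "f \<in> subfree R B e \<Longrightarrow> f \<in> carrier (free_module R B)"
  by (simp add: subfree_def)

context ring
begin

lemma subfree_submodule:
  assumes e: "\<And>b. b \<in> B \<Longrightarrow> e b \<in> carrier R"
  shows "submodule (subfree R B e) R (free_module R B)"
proof -
  interpret F: left_module R "free_module R B" by (rule free_left_module)
  show ?thesis
  proof (rule F.submoduleI)
    show "\<zero>\<^bsub>free_module R B\<^esub> \<in> subfree R B e"
      using e F.M.zero_closed by (simp add: subfree_def zero_free)
  qed (auto simp: subfree_def free_add_apply free_smult_apply free_mem e l_distr m_assoc)
qed

lemma smult_basis_subfree:
  assumes "\<And>b. b \<in> B \<Longrightarrow> e b \<in> carrier R" "b \<in> B" "r \<in> carrier R" "r \<otimes> e b = r"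
  shows "r \<odot>\<^bsub>free_module R B\<^esub> basis_vector R b \<in> subfree R B e"
proof -
  interpret F: left_module R "free_module R B" by (rule free_left_module)
  show ?thesis
    using assms F.smult_closed[OF assms(3) basis_closed[OF assms(2)]]
    by (auto simp: subfree_def basis_smult_eq_single single_def)
qed

text \<open>Right multiplication of each coordinate by \<open>e b\<close> projects the free module
  onto \<open>subfree R B e\<close>. Induction over the free module, applied to the projected
  element, gives the principle.\<close>

lemma subfree_induct:
  fixes B :: "'i set"
  assumes e: "\<And>b. b \<in> B \<Longrightarrow> e b \<in> carrier R" "\<And>b. b \<in> B \<Longrightarrow> e b \<otimes> e b = e b"
    and p: "p \<in> subfree R B e"
    and zero: "P \<zero>\<^bsub>free_module R B\<^esub>"
    and single: "\<And>b r. b \<in> B \<Longrightarrow> r \<in> carrier R \<Longrightarrow> r \<otimes> e b = r \<Longrightarrow>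
      P (r \<odot>\<^bsub>free_module R B\<^esub> basis_vector R b)"
    and add: "\<And>f g. f \<in> carrier (free_module R B) \<Longrightarrow> g \<in> carrier (free_module R B) \<Longrightarrow> P f \<Longrightarrow> P g \<Longrightarrow>
      P (f \<oplus>\<^bsub>free_module R B\<^esub> g)"
  shows "P p"
proof -
  let ?F = "free_module R B"
  define \<pi> where "\<pi> f = (\<lambda>b. if b \<in> B then f b \<otimes> e b else \<zero>)" for f
  have \<pi>_closed: "\<pi> f \<in> carrier ?F" if "f \<in> carrier ?F" for f
  proof -
    have "{b. \<pi> f b \<noteq> \<zero>} \<subseteq> {b. f b \<noteq> \<zero>}" using e by (auto simp: \<pi>_def)
    then have "finite {b. \<pi> f b \<noteq> \<zero>}"
      using that by (simp add: carrier_free_module finite_subset)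
    then show ?thesis using that e by (simp add: carrier_free_module \<pi>_def)
  qed
  have "P (\<pi> f)" if "f \<in> carrier ?F" for f
    using that
  proof (induction rule: free_induct)
    case zero
    have "\<pi> \<zero>\<^bsub>?F\<^esub> = \<zero>\<^bsub>?F\<^esub>" using e by (auto simp: \<pi>_def zero_free)
    then show ?case using assms(4) by simp
  next
    case (single b r)
    then have "\<pi> (r \<odot>\<^bsub>?F\<^esub> basis_vector R b) = (r \<otimes> e b) \<odot>\<^bsub>?F\<^esub> basis_vector R b"
      using e by (auto simp: basis_smult_eq_single single_def \<pi>_def)
    then show ?case using assms(5)[of b "r \<otimes> e b"] single e by (simp add: m_assoc)
  next
    case (add f g)
    have "\<pi> (f \<oplus>\<^bsub>?F\<^esub> g) = \<pi> f \<oplus>\<^bsub>?F\<^esub> \<pi> g"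
    proof
      show "\<pi> (f \<oplus>\<^bsub>?F\<^esub> g) b = (\<pi> f \<oplus>\<^bsub>?F\<^esub> \<pi> g) b" for b
        unfolding free_add_apply[OF \<pi>_closed[OF add.hyps(1)] \<pi>_closed[OF add.hyps(2)]]
        using add.hyps e by (simp add: \<pi>_def free_add_apply free_mem l_distr)
    qed
    then show ?case using assms(6) \<pi>_closed add by simp
  qed
  moreover have "\<pi> p = p" using p by (auto simp: \<pi>_def subfree_def free_outside)
  ultimately show ?thesis using subfree_closed[OF p] by metis
qed

text \<open>One step of contracting \<open>F / P\<close>, carried out on representatives. A
  complement of \<open>P\<close> is the direct sum of the left ideals of
  \<open>\<one> \<ominus> e b\<close>, generated by the elements \<open>u b\<close>. Modulo
  \<open>P\<close>, \<open>k (u b)\<close> is a boundary of some \<open>w b\<close>, and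
  projectivity of the complement turns these choices into a linear map.\<close>

lemma contracting_step:
  fixes B :: "'i set" and B' :: "'j set"
  assumes e: "\<And>b. b \<in> B \<Longrightarrow> e b \<in> carrier R" "\<And>b. b \<in> B \<Longrightarrow> e b \<otimes> e b = e b"
    and d: "linear_map R (free_module R B') (free_module R B) d"
    and k: "linear_map R (free_module R B) (free_module R B) k"
    and kP: "\<And>p. p \<in> subfree R B e \<Longrightarrow> k p \<in> subfree R B e"
    and ex: "\<And>y. y \<in> carrier (free_module R B) \<Longrightarrow>
      \<exists>p\<in>subfree R B e. \<exists>w\<in>carrier (free_module R B'). k y \<ominus>\<^bsub>free_module R B\<^esub> p = d w"
  shows "\<exists>h. linear_map R (free_module R B) (free_module R B') h \<and>
    (\<forall>p\<in>subfree R B e. h p = \<zero>\<^bsub>free_module R B'\<^esub>) \<and>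
    (\<forall>y\<in>carrier (free_module R B). k y \<ominus>\<^bsub>free_module R B\<^esub> d (h y) \<in> subfree R B e)"
proof -
  let ?F = "free_module R B" and ?F' = "free_module R B'" and ?P = "subfree R B e"
  interpret F: left_module R ?F by (rule free_left_module)
  interpret F': left_module R ?F' by (rule free_left_module)
  note P = subfree_submodule[OF e(1)]
  define u where "u b = (\<one> \<ominus> e b) \<odot>\<^bsub>?F\<^esub> basis_vector R b" for b
  have c: "\<one> \<ominus> e b \<in> carrier R" if "b \<in> B" for b
    using e that by simp
  have c_idem: "(\<one> \<ominus> e b) \<otimes> (\<one> \<ominus> e b) = \<one> \<ominus> e b" if "b \<in> B" for b
    using e[OF that] by (simp add: a_minus_def l_distr r_distr l_minus r_minus r_neg a_ac)
  have e_c: "e b \<otimes> (\<one> \<ominus> e b) = \<zero>" if "b \<in> B" for b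
    using e[OF that] by (simp add: a_minus_def r_distr r_minus r_neg)
  have u: "u b \<in> carrier ?F" if "b \<in> B" for b
    using c that by (simp add: u_def basis_closed)
  have "\<exists>w\<in>carrier ?F'. \<exists>p\<in>?P. k (u b) \<ominus>\<^bsub>?F\<^esub> d w = p" if b: "b \<in> B" for b
  proof -
    obtain p w where pw: "p \<in> ?P" "w \<in> carrier ?F'" "k (u b) \<ominus>\<^bsub>?F\<^esub> p = d w"
      using ex[OF u[OF b]] by blast
    have p: "p \<in> carrier ?F" and ku: "k (u b) \<in> carrier ?F"
      using pw subfree_closed linear_map_closed[OF k u[OF b]] by auto
    have "k (u b) \<ominus>\<^bsub>?F\<^esub> d w = p"
      using p ku unfolding pw(3)[symmetric]
      by (simp add: a_minus_def F.M.minus_add F.M.a_assoc[symmetric] F.M.r_neg)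
    with pw show ?thesis by blast
  qed
  then obtain w where w: "\<And>b. b \<in> B \<Longrightarrow> w b \<in> carrier ?F'"
    and wP: "\<And>b. b \<in> B \<Longrightarrow> k (u b) \<ominus>\<^bsub>?F\<^esub> d (w b) \<in> ?P"
    by metis
  \<comment> \<open>The factor \<open>\<one> \<ominus> e b\<close> makes \<open>h\<close> kill
    \<open>e b\<close> times the basis vector, hence all of \<open>P\<close>. It does no harm to the
    defect at \<open>u b\<close>, because it fixes \<open>u b\<close> and \<open>P\<close> is a left
    submodule.\<close>
  define \<eta> where "\<eta> b = (\<one> \<ominus> e b) \<odot>\<^bsub>?F'\<^esub> w b" for b
  have \<eta>: "\<eta> b \<in> carrier ?F'" if "b \<in> B" for b
    using that c w by (simp add: \<eta>_def)
  define h where "h = lin_ext R ?F' \<eta>"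
  have h: "linear_map R ?F ?F' h"
    unfolding h_def by (rule F'.lin_ext_linear[OF \<eta>])
  have h_sm: "h (r \<odot>\<^bsub>?F\<^esub> basis_vector R b) = r \<odot>\<^bsub>?F'\<^esub> \<eta> b" if "b \<in> B" "r \<in> carrier R" for r b
    unfolding h_def by (rule F'.lin_ext_smult_basis[OF \<eta> that])
  have hP: "h p = \<zero>\<^bsub>?F'\<^esub>" if "p \<in> ?P" for p
  proof (rule subfree_induct[where P = "\<lambda>p. h p = \<zero>\<^bsub>?F'\<^esub>", OF e that])
    show "h \<zero>\<^bsub>?F\<^esub> = \<zero>\<^bsub>?F'\<^esub>"
      by (rule additive_map_zero[OF F.M.abelian_group_axioms F'.M.abelian_group_axioms linear_map_additive[OF h]])
    show "h (r \<odot>\<^bsub>?F\<^esub> basis_vector R b) = \<zero>\<^bsub>?F'\<^esub>"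
      if br: "b \<in> B" "r \<in> carrier R" "r \<otimes> e b = r" for b r
    proof -
      have "r \<otimes> (\<one> \<ominus> e b) = (r \<otimes> e b) \<otimes> (\<one> \<ominus> e b)"
        by (simp only: br(3))
      also have "\<dots> = r \<otimes> (e b \<otimes> (\<one> \<ominus> e b))"
        by (rule m_assoc[OF br(2) e(1)[OF br(1)] c[OF br(1)]])
      also have "\<dots> = \<zero>"
        using br by (simp add: e_c)
      finally have "r \<otimes> (\<one> \<ominus> e b) = \<zero>" .
      then show ?thesis
        using br c w by (simp add: h_sm \<eta>_def F'.smult_assoc[symmetric])
    qed
  qed (simp_all add: linear_map_add[OF h])
  define G where "G y = k y \<ominus>\<^bsub>?F\<^esub> d (h y)" for y
  have G: "linear_map R ?F ?F G"
    unfolding G_def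
    by (rule linear_map_diff[OF F.left_module F.left_module k linear_map_comp[OF h d]])
  have d0: "d \<zero>\<^bsub>?F'\<^esub> = \<zero>\<^bsub>?F\<^esub>"
    by (rule additive_map_zero[OF F'.M.abelian_group_axioms F.M.abelian_group_axioms linear_map_additive[OF d]])
  have GP: "G p \<in> ?P" if "p \<in> ?P" for p
    using kP[OF that] subfree_closed[OF kP[OF that]] by (simp add: G_def hP that d0)
  have Gb: "G (basis_vector R b) \<in> ?P" if b: "b \<in> B" for b
  proof -
    have bc: "basis_vector R b \<in> carrier ?F" by (rule basis_closed[OF b])
    have eb: "e b \<odot>\<^bsub>?F\<^esub> basis_vector R b \<in> ?P"
      using b e by (intro smult_basis_subfree)
    \<comment> \<open>Split the basis vector along \<open>P\<close> and its complement:
      \<open>G\<close> preserves \<open>P\<close>, and the choice of \<open>w b\<close> takes care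
      of \<open>u b\<close>.\<close>
    have "basis_vector R b = (e b \<oplus> (\<one> \<ominus> e b)) \<odot>\<^bsub>?F\<^esub> basis_vector R b"
      using e[OF b] bc by (simp add: a_minus_def a_lcomm r_neg)
    also have "\<dots> = e b \<odot>\<^bsub>?F\<^esub> basis_vector R b \<oplus>\<^bsub>?F\<^esub> u b"
      unfolding u_def by (rule F.smult_l_distr[OF e(1)[OF b] c[OF b] bc])
    finally have "G (basis_vector R b) = G (e b \<odot>\<^bsub>?F\<^esub> basis_vector R b) \<oplus>\<^bsub>?F\<^esub> G (u b)"
      using linear_map_add[OF G subfree_closed[OF eb] u[OF b]] by simp
    moreover have "G (u b) \<in> ?P"
    proof -
      have "u b = (\<one> \<ominus> e b) \<odot>\<^bsub>?F\<^esub> u b"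
        unfolding u_def F.smult_assoc[OF c[OF b] c[OF b] bc, symmetric] c_idem[OF b] ..
      then have ku: "k (u b) = (\<one> \<ominus> e b) \<odot>\<^bsub>?F\<^esub> k (u b)"
        using linear_map_smult[OF k c[OF b] u[OF b]] by simp
      have "h (u b) = (\<one> \<ominus> e b) \<odot>\<^bsub>?F'\<^esub> w b"
        unfolding u_def h_sm[OF b c[OF b]] \<eta>_def
          F'.smult_assoc[OF c[OF b] c[OF b] w[OF b], symmetric] c_idem[OF b] ..
      then have "d (h (u b)) = (\<one> \<ominus> e b) \<odot>\<^bsub>?F\<^esub> d (w b)"
        using linear_map_smult[OF d c[OF b] w[OF b]] by simp
      then have "G (u b) = (\<one> \<ominus> e b) \<odot>\<^bsub>?F\<^esub> (k (u b) \<ominus>\<^bsub>?F\<^esub> d (w b))"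
        unfolding G_def
        using F.smult_r_minus[OF c[OF b] linear_map_closed[OF k u[OF b]] linear_map_closed[OF d w[OF b]]] ku
        by simp
      then show ?thesis using submodule_smult[OF P c[OF b] wP[OF b]] by simp
    qed
    ultimately show ?thesis using submodule_add[OF P GP[OF eb]] by simp
  qed
  have "G y \<in> ?P" if "y \<in> carrier ?F" for y
    using that
  proof (induction rule: free_induct)
    case zero
    then show ?case using GP[OF submodule_zero[OF P]] .
  next
    case (single b r)
    then show ?case
      using submodule_smult[OF P _ Gb] by (simp add: linear_map_smult[OF G] basis_closed)
  next
    case (add f g)
    then show ?case using submodule_add[OF P] by (simp add: linear_map_add[OF G])
  qed
  then show ?thesis
    using h hP by (auto simp: G_def)
qed

end

text \<open>The last two assumptions express exactness of \<open>F / P\<close> through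
  representatives: an element whose differential lies in \<open>P\<close> is a boundary modulo
  \<open>P\<close>, and in degree 0 every element is.\<close>

locale projective_subcomplex = right_module_over K R M
  for K :: "('k, 'x) ring_scheme" and R :: "('r, 'y) ring_scheme" and M :: "('k, 'r, 'm) right_module" +
  fixes B :: "nat \<Rightarrow> 'b set" and d :: "nat \<Rightarrow> ('b \<Rightarrow> 'r) \<Rightarrow> ('b \<Rightarrow> 'r)" and e :: "nat \<Rightarrow> 'b \<Rightarrow> 'r"
  assumes d: "\<And>n. linear_map R (free_module R (B (Suc n))) (free_module R (B n)) (d n)"
    and dd: "\<And>n f. f \<in> carrier (free_module R (B (Suc (Suc n)))) \<Longrightarrow>
      d n (d (Suc n) f) = \<zero>\<^bsub>free_module R (B n)\<^esub>"
    and e: "\<And>n b. b \<in> B n \<Longrightarrow> e n b \<in> carrier R"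
    and e_idem: "\<And>n b. b \<in> B n \<Longrightarrow> e n b \<otimes>\<^bsub>R\<^esub> e n b = e n b"
    and dP: "\<And>n p. p \<in> subfree R (B (Suc n)) (e (Suc n)) \<Longrightarrow> d n p \<in> subfree R (B n) (e n)"
    and exact_0: "\<And>y. y \<in> carrier (free_module R (B 0)) \<Longrightarrow>
      \<exists>p\<in>subfree R (B 0) (e 0). \<exists>w\<in>carrier (free_module R (B 1)).
        y \<ominus>\<^bsub>free_module R (B 0)\<^esub> p = d 0 w"
    and exact_Suc: "\<And>n y. y \<in> carrier (free_module R (B (Suc n))) \<Longrightarrow> d n y \<in> subfree R (B n) (e n) \<Longrightarrow>
      \<exists>p\<in>subfree R (B (Suc n)) (e (Suc n)). \<exists>w\<in>carrier (free_module R (B (Suc (Suc n)))).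
        y \<ominus>\<^bsub>free_module R (B (Suc n))\<^esub> p = d (Suc n) w"
begin

abbreviation "F n \<equiv> free_module R (B n)"
abbreviation "P n \<equiv> subfree R (B n) (e n)"

lemma P_submodule: "submodule (P n) R (F n)"
  by (rule R.subfree_submodule[OF e])

text \<open>
  The quotient \<open>F / P\<close> is an exact complex of projective modules, hence contractible.  The maps
  \<open>h n\<close> lift a contraction to \<open>F\<close>, and the defect of \<open>h d + d h = 1\<close> lies in \<open>P\<close>.
\<close>

lemma ex_contraction:
  "\<exists>h. \<forall>n. linear_map R (F n) (F (Suc n)) (h n) \<and> (\<forall>p\<in>P n. h n p = \<zero>\<^bsub>F (Suc n)\<^esub>) \<and>
    (\<forall>y\<in>carrier (F n).
      (case n of 0 \<Rightarrow> y | Suc j \<Rightarrow> y \<ominus>\<^bsub>F n\<^esub> h j (d j y)) \<ominus>\<^bsub>F n\<^esub> d n (h n y) \<in> P n)"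
proof -
  \<comment> \<open>The state in degree \<open>n\<close> is a pair \<open>(k, h)\<close>:
    \<open>h\<close> is the homotopy, and \<open>k\<close> is the identity minus the previous
    homotopy applied after the differential, or just the identity in degree 0. The last clause, that
    \<open>k\<close> fixes cycles, is the invariant that lets the choice continue.\<close>
  define A where "A n kh \<longleftrightarrow>
      linear_map R (F n) (F (Suc n)) (snd kh) \<and> (\<forall>p\<in>P n. snd kh p = \<zero>\<^bsub>F (Suc n)\<^esub>) \<and>
      (\<forall>y\<in>carrier (F n). fst kh y \<ominus>\<^bsub>F n\<^esub> d n (snd kh y) \<in> P n) \<and>
      (\<forall>y\<in>carrier (F n). (case n of 0 \<Rightarrow> True | Suc j \<Rightarrow> d j y = \<zero>\<^bsub>F j\<^esub>) \<longrightarrow> fst kh y = y)"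
    for n :: nat and kh :: "(('b \<Rightarrow> 'r) \<Rightarrow> ('b \<Rightarrow> 'r)) \<times> (('b \<Rightarrow> 'r) \<Rightarrow> ('b \<Rightarrow> 'r))"
  define Q where "Q n kh kh' \<longleftrightarrow> fst kh' = (\<lambda>y. y \<ominus>\<^bsub>F (Suc n)\<^esub> snd kh (d n y))"
    for n :: nat and kh kh' :: "(('b \<Rightarrow> 'r) \<Rightarrow> ('b \<Rightarrow> 'r)) \<times> (('b \<Rightarrow> 'r) \<Rightarrow> ('b \<Rightarrow> 'r))"
  have idl: "linear_map R (F n) (F n) (\<lambda>y. y)" for n
    by (rule linear_mapI) simp_all
  have lm: "left_module R (F n)" for n
    by (rule R.free_left_module)
  have "\<exists>f. \<forall>n. A n (f n) \<and> Q n (f n) (f (Suc n))"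
  proof (rule dependent_nat_choice)
    have "\<exists>h. linear_map R (F 0) (F 1) h \<and> (\<forall>p\<in>P 0. h p = \<zero>\<^bsub>F 1\<^esub>) \<and>
      (\<forall>y\<in>carrier (F 0). y \<ominus>\<^bsub>F 0\<^esub> d 0 (h y) \<in> P 0)"
      by (rule R.contracting_step[where k = "\<lambda>y. y" and d = "d 0"])
        (use d[of 0] exact_0 idl in \<open>simp_all add: e e_idem\<close>)
    then obtain h where "linear_map R (F 0) (F 1) h" "\<forall>p\<in>P 0. h p = \<zero>\<^bsub>F 1\<^esub>"
      "\<forall>y\<in>carrier (F 0). y \<ominus>\<^bsub>F 0\<^esub> d 0 (h y) \<in> P 0" by blast
    then have "A 0 (\<lambda>y. y, h)" by (simp add: A_def)
    then show "\<exists>x. A 0 x" ..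
  next
    fix kh n assume A: "A n kh"
    define h where "h = snd kh"
    define k where "k y = y \<ominus>\<^bsub>F (Suc n)\<^esub> h (d n y)" for y
    interpret Fn: left_module R "F n" by (rule lm)
    interpret Fs: left_module R "F (Suc n)" by (rule lm)
    have h: "linear_map R (F n) (F (Suc n)) h" and hP: "\<And>p. p \<in> P n \<Longrightarrow> h p = \<zero>\<^bsub>F (Suc n)\<^esub>"
      using A by (auto simp: A_def h_def)
    have h0: "h \<zero>\<^bsub>F n\<^esub> = \<zero>\<^bsub>F (Suc n)\<^esub>"
      by (rule hP[OF submodule_zero[OF P_submodule]])
    have k: "linear_map R (F (Suc n)) (F (Suc n)) k"
      unfolding k_def by (rule linear_map_diff[OF lm lm idl linear_map_comp[OF d h]])
    have kP: "k p \<in> P (Suc n)" if "p \<in> P (Suc n)" for p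
      using that subfree_closed[OF that] by (simp add: k_def hP dP)
    \<comment> \<open>\<open>d n y\<close> is a cycle, so the previous \<open>k\<close> fixes it.
      Hence \<open>d n (k y)\<close> equals the defect of the previous step at \<open>d n y\<close>,
      which lies in \<open>P n\<close>; this is the premise of \<open>exact_Suc\<close>.\<close>
    have dk: "d n (k y) \<in> P n" if y: "y \<in> carrier (F (Suc n))" for y
    proof -
      have dy: "d n y \<in> carrier (F n)" by (rule linear_map_closed[OF d y])
      have hdy: "h (d n y) \<in> carrier (F (Suc n))" by (rule linear_map_closed[OF h dy])
      have "d n (k y) = d n y \<ominus>\<^bsub>F n\<^esub> d n (h (d n y))"
        unfolding k_def
        by (rule additive_map_minus[OF Fs.M.abelian_group_axioms Fn.M.abelian_group_axioms
              linear_map_additive[OF d] y hdy])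
      moreover have "fst kh (d n y) = d n y"
        using A dy y dd by (cases n) (auto simp: A_def)
      ultimately show ?thesis using A dy by (auto simp: A_def h_def)
    qed
    have "\<exists>h'. linear_map R (F (Suc n)) (F (Suc (Suc n))) h' \<and> (\<forall>p\<in>P (Suc n). h' p = \<zero>\<^bsub>F (Suc (Suc n))\<^esub>) \<and>
      (\<forall>y\<in>carrier (F (Suc n)). k y \<ominus>\<^bsub>F (Suc n)\<^esub> d (Suc n) (h' y) \<in> P (Suc n))"
      by (rule R.contracting_step[OF _ _ d k kP exact_Suc])
        (simp_all add: e e_idem dk linear_map_closed[OF k])
    then obtain h' where "linear_map R (F (Suc n)) (F (Suc (Suc n))) h'"
      "\<forall>p\<in>P (Suc n). h' p = \<zero>\<^bsub>F (Suc (Suc n))\<^esub>"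
      "\<forall>y\<in>carrier (F (Suc n)). k y \<ominus>\<^bsub>F (Suc n)\<^esub> d (Suc n) (h' y) \<in> P (Suc n)" by blast
    then have "A (Suc n) (k, h')"
      by (simp add: A_def k_def h0)
    moreover have "Q n kh (k, h')"
      unfolding Q_def by (simp add: k_def[abs_def] h_def)
    ultimately show "\<exists>kh'. A (Suc n) kh' \<and> Q n kh kh'" by blast
  qed
  then obtain f where A: "\<And>n. A n (f n)" and Q: "\<And>n. Q n (f n) (f (Suc n))" by blast
  show ?thesis
  proof (intro exI[of _ "\<lambda>n. snd (f n)"] allI conjI ballI)
    fix n y assume y: "y \<in> carrier (F n)"
    show "(case n of 0 \<Rightarrow> y | Suc j \<Rightarrow> y \<ominus>\<^bsub>F n\<^esub> snd (f j) (d j y)) \<ominus>\<^bsub>F n\<^esub> d n (snd (f n) y) \<in> P n"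
    proof (cases n)
      case 0
      then show ?thesis using A[of n] y by (auto simp: A_def)
    next
      case (Suc j)
      then show ?thesis using A[of n] Q[of j] y by (auto simp: A_def Q_def)
    qed
  qed (use A in \<open>auto simp: A_def\<close>)
qed

section \<open>Transfer of the contraction to the tensor product with \<open>M\<close>\<close>

abbreviation "C n \<equiv> copower (B n) U"
abbreviation "D n \<equiv> tensor_map (B n) (d n)"

text \<open>The summand \<open>M \<otimes> P\<close> of \<open>M \<otimes> F\<close> in coordinates:
  the value at \<open>b\<close> lies in \<open>M\<close> times \<open>e n b\<close>.\<close>

definition tensor_P :: "nat \<Rightarrow> ('b \<Rightarrow> 'm) set" where
  "tensor_P n = {y \<in> carrier (C n). \<forall>b\<in>B n. rsmult M (y b) (e n b) = y b}"

lemma C_abelian: "abelian_group (C n)"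
  by (rule copower_abelian_group[OF underlying_abelian_group])

lemma D_linear: "linear_map K (C (Suc n)) (C n) (D n)"
  by (rule tensor_map_linear[OF d])

lemma DD: "y \<in> carrier (C (Suc (Suc n))) \<Longrightarrow> D n (D (Suc n) y) = \<zero>\<^bsub>C n\<^esub>"
  by (rule tensor_map_comp_zero[OF d d dd])

lemma tensor_P_submodule: "submodule (tensor_P n) K (C n)"
proof -
  interpret C: left_module K "C n" by (rule copower_left_module)
  have add: "(x \<oplus>\<^bsub>C n\<^esub> y) b = x b \<oplus>\<^bsub>M\<^esub> y b" if "x \<in> carrier (C n)" "y \<in> carrier (C n)" for x y b
    using copower_add_apply[OF underlying_abelian_group that] by simp
  show ?thesis
  proof (rule C.submoduleI)
    show "\<zero>\<^bsub>C n\<^esub> \<in> tensor_P n"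
      using C.M.zero_closed by (simp add: tensor_P_def e) (simp add: zero_direct_sum e)
  next
    fix x y assume "x \<in> tensor_P n" "y \<in> tensor_P n"
    then show "x \<oplus>\<^bsub>C n\<^esub> y \<in> tensor_P n"
      by (auto simp: tensor_P_def add rsmult_add_left copower_mem' e)
  next
    fix a x assume "a \<in> carrier K" "x \<in> tensor_P n"
    then show "a \<odot>\<^bsub>C n\<^esub> x \<in> tensor_P n"
      by (auto simp: tensor_P_def copower_smult_apply rsmult_smult copower_mem' e)
  qed (simp add: tensor_P_def subset_iff)
qed

lemma tensor_P_closed: "p \<in> tensor_P n \<Longrightarrow> p \<in> carrier (C n)"
  by (simp add: tensor_P_def)

lemma tens_P:
  assumes "m \<in> carrier M" "p \<in> P n"
  shows "tens m p \<in> tensor_P n"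
proof -
  have "p b \<in> carrier R" for b
    by (rule R.free_mem[OF subfree_closed[OF assms(2)]])
  then show ?thesis
    using assms(2) tens_closed[OF assms(1) subfree_closed[OF assms(2)]]
    by (auto simp: tensor_P_def subfree_def tens_def rsmult_assoc[OF assms(1), symmetric] e)
qed

text \<open>The contraction is given by linear maps, so tensoring with \<open>M\<close> is possible
  and its properties can be tested on elements \<open>tens m (basis_vector R b)\<close>.\<close>

lemma ex_tensor_contraction:
  "\<exists>H. \<forall>n. additive_map (C n) (C (Suc n)) (H n) \<and> (\<forall>p\<in>tensor_P n. H n p = \<zero>\<^bsub>C (Suc n)\<^esub>) \<and>
    (\<forall>y\<in>carrier (C n).
      (case n of 0 \<Rightarrow> y | Suc j \<Rightarrow> y \<ominus>\<^bsub>C n\<^esub> H j (D j y)) \<ominus>\<^bsub>C n\<^esub> D n (H n y) \<in> tensor_P n)"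
proof -
  obtain h where h: "\<And>n. linear_map R (F n) (F (Suc n)) (h n)"
    and hP: "\<And>n p. p \<in> P n \<Longrightarrow> h n p = \<zero>\<^bsub>F (Suc n)\<^esub>"
    and hG: "\<And>n y. y \<in> carrier (F n) \<Longrightarrow>
      (case n of 0 \<Rightarrow> y | Suc j \<Rightarrow> y \<ominus>\<^bsub>F n\<^esub> h j (d j y)) \<ominus>\<^bsub>F n\<^esub> d n (h n y) \<in> P n"
    using ex_contraction by - (erule exE, rule that, blast+)
  define H where "H n = tensor_map (B (Suc n)) (h n)" for n
  have H: "additive_map (C n) (C (Suc n)) (H n)" for n
    unfolding H_def by (rule tensor_map_additive[OF h])
  have H_tens: "H n (tens m f) = tens m (h n f)" if "m \<in> carrier M" "f \<in> carrier (F n)" for m f n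
    unfolding H_def by (rule tensor_map_tens[OF h that])
  have D_tens: "D n (tens m f) = tens m (d n f)" if "m \<in> carrier M" "f \<in> carrier (F (Suc n))" for m f n
    by (rule tensor_map_tens[OF d that])
  have D: "additive_map (C (Suc n)) (C n) (D n)" for n
    by (rule linear_map_additive[OF D_linear])
  have HP: "H n p = \<zero>\<^bsub>C (Suc n)\<^esub>" if p: "p \<in> tensor_P n" for n p
  proof -
    \<comment> \<open>The projection of \<open>M \<otimes> F\<close> onto
      \<open>M \<otimes> P\<close>. It turns \<open>m \<otimes> b\<close> into
      \<open>m \<otimes> e b b\<close>, whose second factor lies in \<open>P\<close>, so
      \<open>H\<close> vanishes after it.\<close>
    define \<pi> where "\<pi> y = (\<lambda>b. if b \<in> B n then rsmult M (y b) (e n b) else \<zero>\<^bsub>M\<^esub>)" for y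
    have \<pi>_closed: "\<pi> y \<in> carrier (C n)" if "y \<in> carrier (C n)" for y
    proof -
      have "{b. \<pi> y b \<noteq> \<zero>\<^bsub>M\<^esub>} \<subseteq> {b. y b \<noteq> \<zero>\<^bsub>M\<^esub>}" using e by (auto simp: \<pi>_def)
      then have "finite {b. \<pi> y b \<noteq> \<zero>\<^bsub>M\<^esub>}"
        using that by (simp add: carrier_direct_sum finite_subset)
      then show ?thesis using that e by (simp add: carrier_direct_sum \<pi>_def)
    qed
    have add: "(x \<oplus>\<^bsub>C n\<^esub> y) b = x b \<oplus>\<^bsub>M\<^esub> y b" if "x \<in> carrier (C n)" "y \<in> carrier (C n)" for x y b
      using copower_add_apply[OF underlying_abelian_group that] by simp
    have \<pi>: "additive_map (C n) (C n) \<pi>"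
    proof (rule additive_mapI)
      fix f g assume fg: "f \<in> carrier (C n)" "g \<in> carrier (C n)"
      show "\<pi> (f \<oplus>\<^bsub>C n\<^esub> g) = \<pi> f \<oplus>\<^bsub>C n\<^esub> \<pi> g"
      proof
        show "\<pi> (f \<oplus>\<^bsub>C n\<^esub> g) b = (\<pi> f \<oplus>\<^bsub>C n\<^esub> \<pi> g) b" for b
          unfolding add[OF \<pi>_closed[OF fg(1)] \<pi>_closed[OF fg(2)]]
          using fg e by (simp add: \<pi>_def add copower_mem' rsmult_add_left)
      qed
    qed (rule \<pi>_closed)
    have "H n (\<pi> y) = \<zero>\<^bsub>C (Suc n)\<^esub>" if y: "y \<in> carrier (C n)" for y
    proof (rule additive_copower_tens_eq[OF C_abelian _ _ _ y])
      interpret abelian_group "C (Suc n)" by (rule C_abelian)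
      show "additive_map (C n) (C (Suc n)) (\<lambda>y. H n (\<pi> y))"
        by (rule additive_map_comp[OF \<pi> H])
      show "additive_map (C n) (C (Suc n)) (\<lambda>y. \<zero>\<^bsub>C (Suc n)\<^esub>)"
        by (rule additive_mapI) auto
      fix b m assume bm: "b \<in> B n" "m \<in> carrier M"
      have eb: "e n b \<odot>\<^bsub>F n\<^esub> basis_vector R b \<in> P n"
        using bm e by (intro R.smult_basis_subfree) (auto simp: e_idem)
      have "\<pi> (tens m (basis_vector R b)) = tens (rsmult M m (e n b)) (basis_vector R b)"
        using bm e by (auto simp: \<pi>_def tens_basis single_def)
      also have "\<dots> = tens m (e n b \<odot>\<^bsub>F n\<^esub> basis_vector R b)"
        using bm e by (simp add: tens_rsmult R.basis_closed)
      finally have "H n (\<pi> (tens m (basis_vector R b))) = tens m \<zero>\<^bsub>F (Suc n)\<^esub>"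
        using H_tens[OF bm(2) subfree_closed[OF eb]] hP[OF eb] by simp
      then show "H n (\<pi> (tens m (basis_vector R b))) = \<zero>\<^bsub>C (Suc n)\<^esub>"
        using bm by (simp add: tens_def R.zero_free zero_direct_sum)
    qed
    moreover have "\<pi> p = p"
      using p by (auto simp: \<pi>_def tensor_P_def carrier_direct_sum)
    ultimately show ?thesis using tensor_P_closed[OF p] by metis
  qed
  have HG: "(case n of 0 \<Rightarrow> y | Suc j \<Rightarrow> y \<ominus>\<^bsub>C n\<^esub> H j (D j y)) \<ominus>\<^bsub>C n\<^esub> D n (H n y) \<in> tensor_P n"
    if y: "y \<in> carrier (C n)" for y n
  proof -
    define G where "G y = (case n of 0 \<Rightarrow> y | Suc j \<Rightarrow> y \<ominus>\<^bsub>C n\<^esub> H j (D j y)) \<ominus>\<^bsub>C n\<^esub> D n (H n y)" for y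
    have idm: "additive_map (C n) (C n) (\<lambda>y. y)" by (rule additive_mapI) auto
    have "additive_map (C n) (C n) (\<lambda>y. case n of 0 \<Rightarrow> y | Suc j \<Rightarrow> y \<ominus>\<^bsub>C n\<^esub> H j (D j y))"
    proof (cases n)
      case 0
      then show ?thesis using idm by simp
    next
      case (Suc j)
      then show ?thesis
        using additive_map_diff[OF C_abelian idm[unfolded Suc] additive_map_comp[OF D H]] by simp
    qed
    then have G: "additive_map (C n) (C n) G"
      unfolding G_def by (rule additive_map_diff[OF C_abelian _ additive_map_comp[OF H D]])
    have G_tens: "G (tens m (basis_vector R b)) \<in> tensor_P n" if bm: "b \<in> B n" "m \<in> carrier M" for b m
    proof -
      let ?b = "basis_vector R b"
      have bc: "?b \<in> carrier (F n)" by (rule R.basis_closed[OF bm(1)])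
      have tm: "tens m (x \<ominus>\<^bsub>F i\<^esub> y) = tens m x \<ominus>\<^bsub>C i\<^esub> tens m y" if "x \<in> carrier (F i)" "y \<in> carrier (F i)" for x y i
        by (rule additive_map_minus[OF R.free_abelian_group C_abelian additive_tens_right[OF bm(2)] that])
      have "G (tens m ?b) = tens m ((case n of 0 \<Rightarrow> ?b | Suc j \<Rightarrow> ?b \<ominus>\<^bsub>F n\<^esub> h j (d j ?b)) \<ominus>\<^bsub>F n\<^esub> d n (h n ?b))"
      proof (cases n)
        case 0
        then show ?thesis
          using bc bm by (simp add: G_def H_tens D_tens tm linear_map_closed[OF h] linear_map_closed[OF d])
      next
        case (Suc j)
        interpret abelian_group "F n" by (rule R.free_abelian_group)
        have "d j ?b \<in> carrier (F j)" using bc Suc linear_map_closed[OF d] by simp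
        moreover have "h j (d j ?b) \<in> carrier (F n)" using calculation Suc linear_map_closed[OF h] by simp
        moreover have "d n (h n ?b) \<in> carrier (F n)" using bc linear_map_closed[OF h] linear_map_closed[OF d] by simp
        moreover have "?b \<ominus>\<^bsub>F n\<^esub> h j (d j ?b) \<in> carrier (F n)" using calculation bc by simp
        ultimately show ?thesis
          using bc bm Suc by (simp add: G_def H_tens D_tens tm linear_map_closed[OF h])
      qed
      then show ?thesis using tens_P[OF bm(2) hG[OF bc]] by simp
    qed
    have "G y \<in> tensor_P n"
    proof (rule copower_induct[OF underlying_abelian_group y, where P = "\<lambda>y. G y \<in> tensor_P n"])
      have "G \<zero>\<^bsub>C n\<^esub> = \<zero>\<^bsub>C n\<^esub>" by (rule additive_map_zero[OF C_abelian C_abelian G])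
      then show "G (\<lambda>_. \<zero>\<^bsub>U\<^esub>) \<in> tensor_P n"
        using submodule_zero[OF tensor_P_submodule] by (simp add: zero_direct_sum)
      show "G (single \<zero>\<^bsub>U\<^esub> b m) \<in> tensor_P n" if "b \<in> B n" "m \<in> carrier U" for b m
        using G_tens[of b m] that by (simp add: tens_basis)
      show "G (f \<oplus>\<^bsub>C n\<^esub> g) \<in> tensor_P n"
        if "f \<in> carrier (C n)" "g \<in> carrier (C n)" "G f \<in> tensor_P n" "G g \<in> tensor_P n" for f g
        using submodule_add[OF tensor_P_submodule] that by (simp add: additive_map_add[OF G])
    qed
    then show ?thesis by (simp add: G_def)
  qed
  show ?thesis using H HP HG by blast
qed

text \<open>Injectivity in homology: what bounds in \<open>M \<otimes> F\<close> and lies in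
  \<open>M \<otimes> P\<close> bounds already there. As \<open>H\<close> kills \<open>D n y\<close>,
  the homotopy formula puts \<open>y\<close> minus \<open>D (Suc n) (H (Suc n) y)\<close> into
  \<open>tensor_P\<close>, and this has the same differential as \<open>y\<close>.\<close>

theorem tensor_P_injective:
  assumes y: "y \<in> carrier (C (Suc n))" and Dy: "D n y \<in> tensor_P n"
  shows "\<exists>p\<in>tensor_P (Suc n). D n p = D n y"
proof -
  obtain H where H: "\<And>n. additive_map (C n) (C (Suc n)) (H n)"
    and HP: "\<And>n p. p \<in> tensor_P n \<Longrightarrow> H n p = \<zero>\<^bsub>C (Suc n)\<^esub>"
    and HG: "\<And>n y. y \<in> carrier (C n) \<Longrightarrow>
      (case n of 0 \<Rightarrow> y | Suc j \<Rightarrow> y \<ominus>\<^bsub>C n\<^esub> H j (D j y)) \<ominus>\<^bsub>C n\<^esub> D n (H n y) \<in> tensor_P n"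
    using ex_tensor_contraction by - (erule exE, rule that, blast+)
  interpret C: abelian_group "C (Suc n)" by (rule C_abelian)
  interpret C': abelian_group "C n" by (rule C_abelian)
  let ?w = "H (Suc n) y"
  have w: "?w \<in> carrier (C (Suc (Suc n)))" by (rule additive_map_closed[OF H y])
  have Dw: "D (Suc n) ?w \<in> carrier (C (Suc n))" by (rule linear_map_closed[OF D_linear w])
  have "y \<ominus>\<^bsub>C (Suc n)\<^esub> D (Suc n) ?w \<in> tensor_P (Suc n)"
    using HG[OF y] y by (simp add: HP[OF Dy])
  moreover have "D n (y \<ominus>\<^bsub>C (Suc n)\<^esub> D (Suc n) ?w) = D n y"
    using additive_map_minus[OF C_abelian C_abelian linear_map_additive[OF D_linear] y Dw]
      tensor_P_closed[OF Dy] by (simp add: DD[OF w])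
  ultimately show ?thesis by blast
qed

text \<open>Surjectivity in homology: for a cycle \<open>z\<close> the homotopy formula loses its
  term with \<open>D z\<close>, so \<open>z\<close> minus \<open>D n (H n z)\<close> is the
  homologous element of \<open>tensor_P\<close>. In degree 0 the premise on \<open>D j z\<close> is
  void, as every chain is a cycle.\<close>

theorem tensor_P_surjective:
  assumes z: "z \<in> carrier (C n)" and Dz: "\<And>j. n = Suc j \<Longrightarrow> D j z = \<zero>\<^bsub>C j\<^esub>"
  shows "\<exists>p\<in>tensor_P n. \<exists>w\<in>carrier (C (Suc n)). z \<ominus>\<^bsub>C n\<^esub> p = D n w"
proof -
  obtain H where H: "\<And>n. additive_map (C n) (C (Suc n)) (H n)"
    and HG: "\<And>n y. y \<in> carrier (C n) \<Longrightarrow>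
      (case n of 0 \<Rightarrow> y | Suc j \<Rightarrow> y \<ominus>\<^bsub>C n\<^esub> H j (D j y)) \<ominus>\<^bsub>C n\<^esub> D n (H n y) \<in> tensor_P n"
    using ex_tensor_contraction by - (erule exE, rule that, blast+)
  interpret C: abelian_group "C n" by (rule C_abelian)
  let ?w = "H n z"
  have w: "?w \<in> carrier (C (Suc n))" by (rule additive_map_closed[OF H z])
  have Dw: "D n ?w \<in> carrier (C n)" by (rule linear_map_closed[OF D_linear w])
  have "(case n of 0 \<Rightarrow> z | Suc j \<Rightarrow> z \<ominus>\<^bsub>C n\<^esub> H j (D j z)) = z"
  proof (cases n)
    case (Suc j)
    then show ?thesis
      using Dz[OF Suc] additive_map_zero[OF C_abelian C_abelian H] C.minus_zero_right[OF z] by simp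
  qed simp
  then have "z \<ominus>\<^bsub>C n\<^esub> D n ?w \<in> tensor_P n"
    using HG[OF z] by simp
  moreover have "z \<ominus>\<^bsub>C n\<^esub> (z \<ominus>\<^bsub>C n\<^esub> D n ?w) = D n ?w"
    using z Dw by (simp add: a_minus_def C.minus_add C.a_assoc[symmetric] C.r_neg)
  ultimately show ?thesis using w by blast
qed

end

section \<open>Isomorphisms onto direct sums of quotients\<close>

text \<open>The sum of the maps \<open>g x\<close> induces an isomorphism from the direct sum of the
  quotients onto \<open>Z / H\<close>; the map constructed is its inverse, in the direction that
  \<open>module_isomorphic\<close> asks for. Injectivity is assumed for whole families, since
  injectivity of each \<open>g x\<close> modulo \<open>H\<close> would not make the sum
  direct.\<close>

lemma quotient_isomorphic_direct_sum:
  fixes Z :: "('k, 'm) module" and Zx :: "'e \<Rightarrow> ('k, 'n) module"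
  assumes E: "finite E"
    and Z: "module_quotient K Z H"
    and Zx: "\<And>x. x \<in> E \<Longrightarrow> module_quotient K (Zx x) (Hx x)"
    and g: "\<And>x. x \<in> E \<Longrightarrow> linear_map K (Zx x) Z (g x)"
    and inj: "\<And>y x. (\<And>x. x \<in> E \<Longrightarrow> y x \<in> carrier (Zx x)) \<Longrightarrow> (\<Oplus>\<^bsub>Z\<^esub>x\<in>E. g x (y x)) \<in> H \<Longrightarrow>
      x \<in> E \<Longrightarrow> y x \<in> Hx x"
    and gH: "\<And>x y. x \<in> E \<Longrightarrow> y \<in> Hx x \<Longrightarrow> g x y \<in> H"
    and surj: "\<And>z. z \<in> carrier Z \<Longrightarrow>
      \<exists>y. (\<forall>x\<in>E. y x \<in> carrier (Zx x)) \<and> z \<ominus>\<^bsub>Z\<^esub> (\<Oplus>\<^bsub>Z\<^esub>x\<in>E. g x (y x)) \<in> H"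
  shows "module_isomorphic K (quotient_module Z H) (direct_sum E (\<lambda>x. quotient_module (Zx x) (Hx x)))"
proof -
  interpret Z: module_quotient K Z H by (rule Z)
  let ?S = "direct_sum E (\<lambda>x. quotient_module (Zx x) (Hx x))"
  define s where "s y = (\<Oplus>\<^bsub>Z\<^esub>x\<in>E. g x (y x))" for y
  define fam where "fam y \<longleftrightarrow> (\<forall>x\<in>E. y x \<in> carrier (Zx x))" for y
  \<comment> \<open>Outside \<open>E\<close> the value is \<open>Hx x\<close>, the zero of the
    quotient, as \<open>direct_sum\<close> requires.\<close>
  define \<Phi> where "\<Phi> y = (\<lambda>x. if x \<in> E then Hx x +>\<^bsub>Zx x\<^esub> y x else Hx x)" for y
  have gc: "g x (y x) \<in> carrier Z" if "fam y" "x \<in> E" for x y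
    using that linear_map_closed[OF g] by (simp add: fam_def)
  have s_closed: "s y \<in> carrier Z" if "fam y" for y
    unfolding s_def using gc[OF that] by (intro Z.M.finsum_closed) auto
  have ab: "abelian_group (Zx x)" if "x \<in> E" for x
    by (rule left_module.axioms(2)[OF module_quotient.axioms(1)[OF Zx[OF that]]])
  have fam_add: "fam (\<lambda>x. y x \<oplus>\<^bsub>Zx x\<^esub> y' x)" if "fam y" "fam y'" for y y'
    using that abelian_groupE(1)[OF ab] by (simp add: fam_def)
  have fam_smult: "fam (\<lambda>x. c \<odot>\<^bsub>Zx x\<^esub> y x)" if "fam y" "c \<in> carrier K" for y c
    using that left_module.smult_closed[OF module_quotient.axioms(1)[OF Zx]] by (simp add: fam_def)
  have s_add: "s (\<lambda>x. y x \<oplus>\<^bsub>Zx x\<^esub> y' x) = s y \<oplus>\<^bsub>Z\<^esub> s y'" if y: "fam y" "fam y'" for y y'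
  proof -
    have "s (\<lambda>x. y x \<oplus>\<^bsub>Zx x\<^esub> y' x) = (\<Oplus>\<^bsub>Z\<^esub>x\<in>E. g x (y x) \<oplus>\<^bsub>Z\<^esub> g x (y' x))"
      unfolding s_def using y gc[OF y(1)] gc[OF y(2)] linear_map_add[OF g]
      by (intro Z.M.finsum_cong') (auto simp: fam_def)
    then show ?thesis
      unfolding s_def using gc[OF y(1)] gc[OF y(2)] by (simp add: Z.M.finsum_addf Pi_def)
  qed
  have s_smult: "s (\<lambda>x. c \<odot>\<^bsub>Zx x\<^esub> y x) = c \<odot>\<^bsub>Z\<^esub> s y" if y: "fam y" "c \<in> carrier K" for y c
  proof -
    have "s (\<lambda>x. c \<odot>\<^bsub>Zx x\<^esub> y x) = (\<Oplus>\<^bsub>Z\<^esub>x\<in>E. c \<odot>\<^bsub>Z\<^esub> g x (y x))"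
      unfolding s_def using y gc[OF y(1)] linear_map_smult[OF g]
      by (intro Z.M.finsum_cong') (auto simp: fam_def)
    then show ?thesis
      unfolding s_def
      using additive_map_finsum[OF Z.M.abelian_group_axioms Z.M.abelian_group_axioms
          Z.additive_smult_right[OF y(2)] E, of "\<lambda>x. g x (y x)"] gc[OF y(1)] by simp
  qed
  have fam_minus: "fam (\<lambda>x. y x \<ominus>\<^bsub>Zx x\<^esub> y' x)" if "fam y" "fam y'" for y y'
    using that abelian_group.minus_closed[OF ab] by (simp add: fam_def)
  have s_minus: "s (\<lambda>x. y x \<ominus>\<^bsub>Zx x\<^esub> y' x) = s y \<ominus>\<^bsub>Z\<^esub> s y'" if y: "fam y" "fam y'" for y y'
  proof -
    have "s (\<lambda>x. y x \<ominus>\<^bsub>Zx x\<^esub> y' x) = (\<Oplus>\<^bsub>Z\<^esub>x\<in>E. g x (y x) \<ominus>\<^bsub>Z\<^esub> g x (y' x))"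
      unfolding s_def
      using y gc[OF y(1)] gc[OF y(2)] additive_map_minus[OF ab Z.M.abelian_group_axioms linear_map_additive[OF g]]
      by (intro Z.M.finsum_cong') (auto simp: fam_def)
    then show ?thesis
      unfolding s_def using Z.M.finsum_minus[OF E gc[OF y(1)] gc[OF y(2)]] by simp
  qed
  have s_H: "s y \<in> H" if "\<And>x. x \<in> E \<Longrightarrow> y x \<in> Hx x" for y
    unfolding s_def
    by (rule submodule_finsum[OF Z.submodule Z.M.abelian_group_axioms E gH[OF _ that]])
  have Hx_sub: "v \<in> carrier (Zx x)" if "x \<in> E" "v \<in> Hx x" for v x
    using submodule_subset[OF module_quotient.submodule[OF Zx[OF that(1)]]] that by blast
  \<comment> \<open>One direction makes \<open>h\<close> independent of the chosen family, the other
    makes it injective.\<close>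
  have coset_iff: "H +>\<^bsub>Z\<^esub> s y = H +>\<^bsub>Z\<^esub> s y' \<longleftrightarrow> \<Phi> y = \<Phi> y'" if y: "fam y" "fam y'" for y y'
  proof -
    have "H +>\<^bsub>Z\<^esub> s y = H +>\<^bsub>Z\<^esub> s y' \<longleftrightarrow> s (\<lambda>x. y x \<ominus>\<^bsub>Zx x\<^esub> y' x) \<in> H"
      using Z.coset_eq_iff[OF s_closed[OF y(1)] s_closed[OF y(2)]] s_minus[OF y] by simp
    also have "\<dots> \<longleftrightarrow> (\<forall>x\<in>E. y x \<ominus>\<^bsub>Zx x\<^esub> y' x \<in> Hx x)"
      using inj[of "\<lambda>x. y x \<ominus>\<^bsub>Zx x\<^esub> y' x"] s_H fam_minus[OF y] by (auto simp: fam_def s_def)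
    also have "\<dots> \<longleftrightarrow> \<Phi> y = \<Phi> y'"
      using y module_quotient.coset_eq_iff[OF Zx] by (auto simp: \<Phi>_def fun_eq_iff fam_def)
    finally show ?thesis .
  qed
  have rep: "\<exists>y. fam y \<and> X = H +>\<^bsub>Z\<^esub> s y" if X: "X \<in> carrier (quotient_module Z H)" for X
  proof -
    obtain z where z: "z \<in> carrier Z" "X = H +>\<^bsub>Z\<^esub> z" using X by (auto simp: carrier_quotient)
    obtain y where "fam y" "z \<ominus>\<^bsub>Z\<^esub> s y \<in> H" using surj[OF z(1)] by (auto simp: fam_def s_def)
    then show ?thesis using z s_closed Z.coset_eq_iff by blast
  qed
  define h where "h X = \<Phi> (SOME y. fam y \<and> X = H +>\<^bsub>Z\<^esub> s y)" for X
  have h: "h (H +>\<^bsub>Z\<^esub> s y) = \<Phi> y" if "fam y" for y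
  proof -
    have "fam (SOME y'. fam y' \<and> H +>\<^bsub>Z\<^esub> s y = H +>\<^bsub>Z\<^esub> s y') \<and>
        H +>\<^bsub>Z\<^esub> s y = H +>\<^bsub>Z\<^esub> s (SOME y'. fam y' \<and> H +>\<^bsub>Z\<^esub> s y = H +>\<^bsub>Z\<^esub> s y')"
      by (rule someI[of _ y]) (simp add: that)
    then show ?thesis using coset_iff[OF that] by (metis h_def)
  qed
  have \<Phi>_closed: "\<Phi> y \<in> carrier ?S" if "fam y" for y
  proof -
    have "finite {x. \<Phi> y x \<noteq> Hx x}"
      by (rule finite_subset[OF _ E]) (auto simp: \<Phi>_def)
    moreover have "\<forall>x\<in>E. \<Phi> y x \<in> carrier (quotient_module (Zx x) (Hx x))"
      using that module_quotient.coset_closed[OF Zx] by (simp add: \<Phi>_def fam_def)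
    moreover have "\<forall>x. x \<notin> E \<longrightarrow> \<Phi> y x = Hx x" by (simp add: \<Phi>_def)
    ultimately show ?thesis unfolding carrier_direct_sum zero_quotient by blast
  qed
  have \<Phi>_surj: "\<exists>y. fam y \<and> f = \<Phi> y" if f: "f \<in> carrier ?S" for f
  proof -
    have "\<forall>x\<in>E. \<exists>z\<in>carrier (Zx x). f x = Hx x +>\<^bsub>Zx x\<^esub> z"
      using f by (auto simp: carrier_direct_sum carrier_quotient)
    then obtain y where "\<forall>x\<in>E. y x \<in> carrier (Zx x) \<and> f x = Hx x +>\<^bsub>Zx x\<^esub> y x"
      by metis
    then show ?thesis
      using f by (intro exI[of _ y] conjI ext)
        (auto simp: fam_def \<Phi>_def carrier_direct_sum zero_quotient)
  qed
  have "bij_betw h (carrier (quotient_module Z H)) (carrier ?S)"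
  proof (rule bij_betw_imageI)
    show "inj_on h (carrier (quotient_module Z H))"
    proof (rule inj_onI)
      fix X Y assume "X \<in> carrier (quotient_module Z H)" "Y \<in> carrier (quotient_module Z H)" "h X = h Y"
      then show "X = Y" using rep[of X] rep[of Y] h coset_iff by metis
    qed
    show "h ` carrier (quotient_module Z H) = carrier ?S"
    proof (intro equalityI subsetI)
      fix f assume "f \<in> h ` carrier (quotient_module Z H)"
      then obtain X where X: "X \<in> carrier (quotient_module Z H)" "f = h X" by blast
      obtain y where "fam y" "X = H +>\<^bsub>Z\<^esub> s y" using rep[OF X(1)] by blast
      then show "f \<in> carrier ?S" using X(2) h \<Phi>_closed by simp
    next
      fix f assume "f \<in> carrier ?S"
      then obtain y where "fam y" "f = \<Phi> y" using \<Phi>_surj by blast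
      then show "f \<in> h ` carrier (quotient_module Z H)"
        using h[of y] Z.coset_closed[OF s_closed] by (intro image_eqI[of _ _ "H +>\<^bsub>Z\<^esub> s y"]) auto
    qed
  qed
  moreover have "h (X \<oplus>\<^bsub>quotient_module Z H\<^esub> Y) = h X \<oplus>\<^bsub>?S\<^esub> h Y"
    if XY: "X \<in> carrier (quotient_module Z H)" "Y \<in> carrier (quotient_module Z H)" for X Y
  proof -
    obtain x y where xy: "fam x" "X = H +>\<^bsub>Z\<^esub> s x" "fam y" "Y = H +>\<^bsub>Z\<^esub> s y"
      using rep[OF XY(1)] rep[OF XY(2)] by blast
    have "h (X \<oplus>\<^bsub>quotient_module Z H\<^esub> Y) = \<Phi> (\<lambda>e. x e \<oplus>\<^bsub>Zx e\<^esub> y e)"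
      using xy h[OF fam_add[OF xy(1,3)]] by (simp add: Z.coset_add s_closed s_add)
    also have "\<dots> = \<Phi> x \<oplus>\<^bsub>?S\<^esub> \<Phi> y"
      using xy module_quotient.coset_add[OF Zx]
      by (intro ext) (simp add: add_direct_sum \<Phi>_def fam_def zero_quotient)
    finally show ?thesis using xy h by simp
  qed
  moreover have "h (c \<odot>\<^bsub>quotient_module Z H\<^esub> X) = c \<odot>\<^bsub>?S\<^esub> h X"
    if X: "X \<in> carrier (quotient_module Z H)" and c: "c \<in> carrier K" for X c
  proof -
    obtain x where x: "fam x" "X = H +>\<^bsub>Z\<^esub> s x"
      using rep[OF X] by blast
    have "h (c \<odot>\<^bsub>quotient_module Z H\<^esub> X) = \<Phi> (\<lambda>e. c \<odot>\<^bsub>Zx e\<^esub> x e)"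
      using x c h[OF fam_smult[OF x(1) c]] by (simp add: Z.coset_smult s_closed s_smult)
    also have "\<dots> = c \<odot>\<^bsub>?S\<^esub> \<Phi> x"
      using x c module_quotient.coset_smult[OF Zx]
      by (intro ext) (simp add: smult_direct_sum \<Phi>_def fam_def zero_quotient)
    finally show ?thesis using x h by simp
  qed
  ultimately show ?thesis
    unfolding module_isomorphic_def by blast
qed

section \<open>Tor as the homology of a complex of direct sums\<close>

locale tor_setup = right_module_over K R M + module_resolution R N
  for K :: "('k, 'x) ring_scheme" and R :: "('r, 'y) ring_scheme"
    and M :: "('k, 'r, 'm) right_module" and N :: "('r, 'n) module"
begin

abbreviation "B \<equiv> resolution_basis R N"
abbreviation "TC n \<equiv> Tor_complex K R M N n"
abbreviation "TD n \<equiv> Tor_diff K R M N n"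
abbreviation "CC n \<equiv> copower (B n) U"
abbreviation "DD n \<equiv> tensor_map (B n) (d n)"
abbreviation "\<theta> n \<equiv> free_tensor_map (B n)"

lemma TC_eq: "TC n = tensor K R M (free_module R (B n))"
  by (simp add: Tor_complex_def resolution_eq)

lemma diff_free: "linear_map R (free_module R (B (Suc n))) (free_module R (B n)) (d n)"
  using diff_linear by (simp only: resolution_eq)

lemma DD_linear: "linear_map K (CC (Suc n)) (CC n) (DD n)"
  by (rule tensor_map_linear[OF diff_free])

lemma \<theta>_linear: "linear_map K (TC n) (CC n) (\<theta> n)"
  unfolding TC_eq by (rule free_tensor_map_linear)

lemma \<theta>_bij: "bij_betw (\<theta> n) (carrier (TC n)) (carrier (CC n))"
  unfolding TC_eq by (rule free_tensor_map_bij)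

lemma CC_abelian: "abelian_group (CC n)"
  by (rule copower_abelian_group[OF underlying_abelian_group])

lemma tensor_free: "tensor_product K R M (free_module R B')"
  by (intro tensor_product.intro right_module_over_axioms R.free_left_module)

lemma TC_left_module: "left_module K (TC n)"
proof -
  interpret T: tensor_product K R M "free_module R (B n)" by (rule tensor_free)
  show ?thesis unfolding TC_eq by (rule T.T.left_module)
qed

text \<open>Both differentials send \<open>m \<otimes> f\<close> to \<open>m \<otimes> d f\<close>,
  so they correspond under the coordinate isomorphisms.\<close>

lemma
  shows TD_linear: "linear_map K (TC (Suc n)) (TC n) (TD n)"
    and \<theta>_TD: "X \<in> carrier (TC (Suc n)) \<Longrightarrow> \<theta> n (TD n X) = DD n (\<theta> (Suc n) X)"
proof -
  interpret T: tensor_product K R M "free_module R (B (Suc n))" by (rule tensor_free)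
  interpret T': tensor_product K R M "free_module R (B n)" by (rule tensor_free)
  let ?\<phi> = "\<lambda>m f. T'.pure m (d n f)"
  have TD: "TD n = tensor_lift K T'.T (\<lambda>(m, f). ?\<phi> m f)"
    by (simp add: Tor_diff_def TC_eq resolution_eq)
  have bal: "balanced K R M (free_module R (B (Suc n))) T'.T ?\<phi>"
    by (rule balancedI)
      (simp_all add: T'.pure_closed T'.pure_add_left T'.pure_add_right T'.pure_smult T'.pure_rsmult
        linear_map_closed[OF diff_free] linear_map_add[OF diff_free] linear_map_smult[OF diff_free])
  show lin: "linear_map K (TC (Suc n)) (TC n) (TD n)"
    unfolding TD TC_eq by (rule T.tensor_lift_linear[OF T'.T.left_module bal])
  show "\<theta> n (TD n X) = DD n (\<theta> (Suc n) X)" if X: "X \<in> carrier (TC (Suc n))"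
  proof (rule T.additive_tensor_eq[OF CC_abelian])
    show "additive_map T.T (CC n) (\<lambda>X. \<theta> n (TD n X))"
      using additive_map_comp[OF linear_map_additive[OF lin] linear_map_additive[OF \<theta>_linear]]
      by (simp add: TC_eq)
    show "additive_map T.T (CC n) (\<lambda>X. DD n (\<theta> (Suc n) X))"
      using additive_map_comp[OF linear_map_additive[OF \<theta>_linear] linear_map_additive[OF DD_linear]]
      by (simp add: TC_eq)
    show "\<theta> n (TD n (T.pure m f)) = DD n (\<theta> (Suc n) (T.pure m f))"
      if "m \<in> carrier M" "f \<in> carrier (free_module R (B (Suc n)))" for m f
      unfolding TD T.tensor_lift_pure[OF T'.T.left_module bal that]
      using that linear_map_closed[OF diff_free]
      by (simp add: free_tensor_map_pure tensor_map_tens[OF diff_free])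
  qed (use X in \<open>simp add: TC_eq\<close>)
qed

lemma \<theta>_zero_iff: "X \<in> carrier (TC n) \<Longrightarrow> \<theta> n X = \<zero>\<^bsub>CC n\<^esub> \<longleftrightarrow> X = \<zero>\<^bsub>TC n\<^esub>"
proof -
  assume X: "X \<in> carrier (TC n)"
  have z: "\<theta> n \<zero>\<^bsub>TC n\<^esub> = \<zero>\<^bsub>CC n\<^esub>"
    using additive_map_zero[OF left_module.axioms(2)[OF TC_left_module] CC_abelian
        linear_map_additive[OF \<theta>_linear]] .
  have "\<zero>\<^bsub>TC n\<^esub> \<in> carrier (TC n)"
    using abelian_groupE(2)[OF left_module.axioms(2)[OF TC_left_module]] .
  then show ?thesis
    using \<theta>_bij[of n] X z by (metis bij_betw_imp_inj_on inj_on_eq_iff)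
qed

text \<open>The equation \<open>n = Suc j\<close> leaves degree 0 without a condition, in accordance
  with \<open>Tor_cycles\<close>.\<close>

definition cycle :: "nat \<Rightarrow> (('r, 'n) cell \<Rightarrow> 'm) \<Rightarrow> bool" where
  "cycle n z \<longleftrightarrow> z \<in> carrier (CC n) \<and> (\<forall>j. n = Suc j \<longrightarrow> DD j z = \<zero>\<^bsub>CC j\<^esub>)"

lemma mem_Tor_cycles: "X \<in> carrier (Tor_cycles K R M N n) \<longleftrightarrow> X \<in> carrier (TC n) \<and> cycle n (\<theta> n X)"
proof (cases n)
  case 0
  then show ?thesis using linear_map_closed[OF \<theta>_linear] by (auto simp: Tor_cycles_def cycle_def)
next
  case (Suc j)
  have "TD j X = \<zero>\<^bsub>TC j\<^esub> \<longleftrightarrow> DD j (\<theta> (Suc j) X) = \<zero>\<^bsub>CC j\<^esub>" if "X \<in> carrier (TC (Suc j))"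
    using \<theta>_zero_iff[OF linear_map_closed[OF TD_linear that]] \<theta>_TD[OF that] by simp
  then show ?thesis
    using linear_map_closed[OF \<theta>_linear, of X "Suc j"]
    unfolding Suc cycle_def Tor_cycles_def by (simp add: mem_a_kernel) blast
qed

lemma Tor_cycles_eq:
  "Tor_cycles K R M N n = (TC n)\<lparr>carrier := carrier (Tor_cycles K R M N n)\<rparr>"
  by (cases n) (simp_all add: Tor_cycles_def kernel_module_def)

lemma Tor_cycles_simps:
  "zero (Tor_cycles K R M N n) = zero (TC n)" "add (Tor_cycles K R M N n) = add (TC n)"
  "smult (Tor_cycles K R M N n) = smult (TC n)"
  by (cases n; simp add: Tor_cycles_def)+

lemma Tor_cycles_submodule: "submodule (carrier (Tor_cycles K R M N n)) K (TC n)"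
proof (cases n)
  case 0
  interpret left_module K "TC 0" by (rule TC_left_module)
  show ?thesis unfolding 0 by (intro submoduleI) (auto simp: Tor_cycles_def)
next
  case (Suc j)
  then show ?thesis
    using a_kernel_submodule[OF TC_left_module TC_left_module TD_linear] by (simp add: Tor_cycles_def)
qed

lemma Tor_cycles_left_module: "left_module K (Tor_cycles K R M N n)"
  by (subst Tor_cycles_eq) (rule submodule_left_module[OF Tor_cycles_submodule TC_left_module])

lemma \<theta>_cycles_linear: "linear_map K (Tor_cycles K R M N n) (CC n) (\<theta> n)"
  using \<theta>_linear[of n] mem_Tor_cycles
  by (simp add: linear_map_def additive_map_def Tor_cycles_simps)

lemma mem_boundaries:
  "X \<in> TD n ` carrier (TC (Suc n)) \<longleftrightarrow> X \<in> carrier (TC n) \<and> (\<exists>w\<in>carrier (CC (Suc n)). \<theta> n X = DD n w)"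
proof
  assume "X \<in> TD n ` carrier (TC (Suc n))"
  then show "X \<in> carrier (TC n) \<and> (\<exists>w\<in>carrier (CC (Suc n)). \<theta> n X = DD n w)"
    using linear_map_closed[OF TD_linear] linear_map_closed[OF \<theta>_linear] \<theta>_TD by blast
next
  assume "X \<in> carrier (TC n) \<and> (\<exists>w\<in>carrier (CC (Suc n)). \<theta> n X = DD n w)"
  then obtain w where X: "X \<in> carrier (TC n)" and w: "w \<in> carrier (CC (Suc n))" "\<theta> n X = DD n w"
    by blast
  obtain W where W: "W \<in> carrier (TC (Suc n))" "w = \<theta> (Suc n) W"
    using w(1) \<theta>_bij[of "Suc n"] by (auto simp: bij_betw_def)
  have "\<theta> n (TD n W) = \<theta> n X" using \<theta>_TD[OF W(1)] W w by simp
  then have "TD n W = X"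
    using \<theta>_bij[of n] X linear_map_closed[OF TD_linear W(1)] by (auto simp: bij_betw_def inj_on_def)
  then show "X \<in> TD n ` carrier (TC (Suc n))" using W by blast
qed

lemma DD_DD: "y \<in> carrier (CC (Suc (Suc n))) \<Longrightarrow> DD n (DD (Suc n) y) = \<zero>\<^bsub>CC n\<^esub>"
  by (rule tensor_map_comp_zero[OF diff_free diff_free]) (use diff_diff in \<open>simp_all only: resolution_eq\<close>)

lemma boundary_cycle: "w \<in> carrier (CC (Suc n)) \<Longrightarrow> cycle n (DD n w)"
  using linear_map_closed[OF DD_linear] DD_DD by (auto simp: cycle_def)

lemma Tor_quotient: "module_quotient K (Tor_cycles K R M N n) (TD n ` carrier (TC (Suc n)))"
proof (intro module_quotient.intro module_quotient_axioms.intro Tor_cycles_left_module)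
  interpret Z: left_module K "Tor_cycles K R M N n" by (rule Tor_cycles_left_module)
  have sub: "submodule (TD n ` carrier (TC (Suc n))) K (TC n)"
    by (rule image_submodule[OF TC_left_module TC_left_module TD_linear])
  show "submodule (TD n ` carrier (TC (Suc n))) K (Tor_cycles K R M N n)"
  proof (rule Z.submoduleI)
    show "TD n ` carrier (TC (Suc n)) \<subseteq> carrier (Tor_cycles K R M N n)"
    proof
      fix X assume "X \<in> TD n ` carrier (TC (Suc n))"
      then have "X \<in> carrier (TC n)" "\<exists>w\<in>carrier (CC (Suc n)). \<theta> n X = DD n w"
        unfolding mem_boundaries by auto
      then show "X \<in> carrier (Tor_cycles K R M N n)"
        unfolding mem_Tor_cycles using boundary_cycle by auto
    qed
  qed (simp_all only: Tor_cycles_simps submodule_zero[OF sub] submodule_add[OF sub] submodule_smult[OF sub])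
qed

end

section \<open>Idempotents and the triangular part of the canonical resolution\<close>

locale orthogonal_idempotents = ring R for R (structure) +
  fixes I :: "'i set" and \<epsilon> :: "'i \<Rightarrow> 'a"
  assumes finite_I: "finite I"
    and \<epsilon>_closed [simp]: "c \<in> I \<Longrightarrow> \<epsilon> c \<in> carrier R"
    and \<epsilon>_idem [simp]: "c \<in> I \<Longrightarrow> \<epsilon> c \<otimes> \<epsilon> c = \<epsilon> c"
    and \<epsilon>_orth: "c \<in> I \<Longrightarrow> c' \<in> I \<Longrightarrow> c \<noteq> c' \<Longrightarrow> \<epsilon> c \<otimes> \<epsilon> c' = \<zero>"
    and \<epsilon>_sum: "(\<Oplus>c\<in>I. \<epsilon> c) = \<one>"
begin

definition esum :: "'i set \<Rightarrow> 'a" where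
  "esum S = (\<Oplus>c\<in>S. \<epsilon> c)"

lemma esum_closed: "S \<subseteq> I \<Longrightarrow> esum S \<in> carrier R"
  unfolding esum_def by (intro finsum_closed) auto

lemma \<epsilon>_esum:
  assumes "S \<subseteq> I" "c \<in> I"
  shows "\<epsilon> c \<otimes> esum S = (if c \<in> S then \<epsilon> c else \<zero>)"
proof -
  have fin: "finite S" using assms(1) finite_I finite_subset by blast
  have "\<epsilon> c \<otimes> esum S = (\<Oplus>c'\<in>S. \<epsilon> c \<otimes> \<epsilon> c')"
    unfolding esum_def using assms fin by (intro finsum_rdistr) auto
  also have "\<dots> = (\<Oplus>c'\<in>S. if c = c' then \<epsilon> c' else \<zero>)"
    using assms \<epsilon>_orth by (intro finsum_cong') auto
  also have "\<dots> = (if c \<in> S then \<epsilon> c else \<zero>)"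
  proof (cases "c \<in> S")
    case True
    then show ?thesis using assms fin by (simp add: finsum_singleton Pi_def subset_iff)
  next
    case False
    then have "(\<Oplus>c'\<in>S. if c = c' then \<epsilon> c' else \<zero>) = (\<Oplus>c'\<in>S. \<zero>)"
      by (intro finsum_cong') auto
    then show ?thesis using False by simp
  qed
  finally show ?thesis .
qed

lemma esum_mult_left:
  assumes "S \<subseteq> I" "r \<in> carrier R"
  shows "esum S \<otimes> r = (\<Oplus>c\<in>S. \<epsilon> c \<otimes> r)"
  unfolding esum_def using assms finite_subset[OF assms(1) finite_I] by (intro finsum_ldistr) auto

lemma esum_mult_right:
  assumes "S \<subseteq> I" "r \<in> carrier R"
  shows "r \<otimes> esum S = (\<Oplus>c\<in>S. r \<otimes> \<epsilon> c)"
  unfolding esum_def using assms finite_subset[OF assms(1) finite_I] by (intro finsum_rdistr) auto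

lemma esum_idem: "S \<subseteq> I \<Longrightarrow> esum S \<otimes> esum S = esum S"
proof -
  assume S: "S \<subseteq> I"
  have "esum S \<otimes> esum S = (\<Oplus>c\<in>S. \<epsilon> c \<otimes> esum S)"
    by (rule esum_mult_left[OF S esum_closed[OF S]])
  also have "\<dots> = (\<Oplus>c\<in>S. \<epsilon> c)"
    using S by (intro finsum_cong') (auto simp: \<epsilon>_esum subset_iff)
  finally show ?thesis by (simp add: esum_def)
qed

lemma smult_decomposition:
  assumes X: "left_module R X" and v: "v \<in> carrier X" and T: "T \<subseteq> I"
    and zero: "\<And>c. c \<in> I - T \<Longrightarrow> \<epsilon> c \<odot>\<^bsub>X\<^esub> v = \<zero>\<^bsub>X\<^esub>"
  shows "v = (\<Oplus>\<^bsub>X\<^esub>c\<in>T. \<epsilon> c \<odot>\<^bsub>X\<^esub> v)"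
proof -
  interpret X: left_module R X by fact
  have "v = (\<Oplus>c\<in>I. \<epsilon> c) \<odot>\<^bsub>X\<^esub> v" using v by (simp add: \<epsilon>_sum)
  also have "\<dots> = (\<Oplus>\<^bsub>X\<^esub>c\<in>I. \<epsilon> c \<odot>\<^bsub>X\<^esub> v)"
    using v finite_I by (intro X.smult_finsum_left) auto
  also have "\<dots> = (\<Oplus>\<^bsub>X\<^esub>c\<in>T. \<epsilon> c \<odot>\<^bsub>X\<^esub> v)"
    using v T zero finite_I by (intro X.M.add.finprod_mono_neutral_cong_right) auto
  finally show ?thesis .
qed

text \<open>The preimage is the sum over \<open>T\<close> of \<open>\<epsilon> c\<close> times the
  basis vector at \<open>b c\<close>. The condition on \<open>e (b c)\<close> places each term in
  \<open>subfree R B e\<close>, and the images add up to the components of \<open>v\<close>. In the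
  applications \<open>b c\<close> is the cell that codes
  \<open>\<epsilon> c \<odot> v\<close>.\<close>

lemma ex_subfree_preimage:
  fixes B :: "'j set"
  assumes X: "left_module R X" and v: "v \<in> carrier X" and T: "T \<subseteq> I"
    and zero: "\<And>c. c \<in> I - T \<Longrightarrow> \<epsilon> c \<odot>\<^bsub>X\<^esub> v = \<zero>\<^bsub>X\<^esub>"
    and q: "linear_map R (free_module R B) X q"
    and e: "\<And>b. b \<in> B \<Longrightarrow> e b \<in> carrier R"
    and b: "\<And>c. c \<in> T \<Longrightarrow> b c \<in> B" "\<And>c. c \<in> T \<Longrightarrow> q (basis_vector R (b c)) = \<epsilon> c \<odot>\<^bsub>X\<^esub> v"
      "\<And>c. c \<in> T \<Longrightarrow> \<epsilon> c \<otimes> e (b c) = \<epsilon> c"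
  shows "\<exists>p\<in>subfree R B e. q p = v"
proof -
  interpret X: left_module R X by fact
  let ?F = "free_module R B"
  let ?t = "\<lambda>c. \<epsilon> c \<odot>\<^bsub>?F\<^esub> basis_vector R (b c)"
  have fin: "finite T" using T finite_I finite_subset by blast
  have t: "?t c \<in> subfree R B e" if "c \<in> T" for c
    using that T b by (intro smult_basis_subfree e) auto
  have p: "(\<Oplus>\<^bsub>?F\<^esub>c\<in>T. ?t c) \<in> subfree R B e"
    by (rule submodule_finsum[OF subfree_submodule[OF e] free_abelian_group fin t])
  have "q (\<Oplus>\<^bsub>?F\<^esub>c\<in>T. ?t c) = (\<Oplus>\<^bsub>X\<^esub>c\<in>T. q (?t c))"
    using t subfree_closed
    by (intro additive_map_finsum[OF free_abelian_group X.M.abelian_group_axioms linear_map_additive[OF q] fin])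
      blast
  also have "\<dots> = (\<Oplus>\<^bsub>X\<^esub>c\<in>T. \<epsilon> c \<odot>\<^bsub>X\<^esub> v)"
  proof (rule X.M.finsum_cong')
    show "(\<lambda>c. \<epsilon> c \<odot>\<^bsub>X\<^esub> v) \<in> T \<rightarrow> carrier X" using v T by auto
    fix c assume c: "c \<in> T"
    then have cI: "c \<in> I" using T by blast
    show "q (?t c) = \<epsilon> c \<odot>\<^bsub>X\<^esub> v"
      using linear_map_smult[OF q \<epsilon>_closed[OF cI] basis_closed[OF b(1)[OF c]]] b(2)[OF c]
        X.smult_assoc[OF \<epsilon>_closed[OF cI] \<epsilon>_closed[OF cI] v] cI by simp
  qed simp
  also have "\<dots> = v"
    by (rule smult_decomposition[OF X v T zero, symmetric])
  finally show ?thesis using p by blast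
qed

end

text \<open>\<open>T\<close> indexes the components that may be non zero. \<open>N_vanish\<close>
  says that \<open>N\<close> is triangular and \<open>R_vanish\<close> that the left ideal of each
  \<open>\<epsilon> c'\<close> with \<open>c' \<in> T\<close> is, which lets the property pass to
  all terms of \<open>P\<close>.\<close>

locale peirce_pair = tor_setup K R M N + orthogonal_idempotents R I \<epsilon>
  for K :: "('k, 'x) ring_scheme" and R :: "('r, 'y) ring_scheme"
    and M :: "('k, 'r, 'm) right_module" and N :: "('r, 'n) module"
    and I :: "'i set" and \<epsilon> :: "'i \<Rightarrow> 'r" +
  fixes T :: "'i set"
  assumes T_subset: "T \<subseteq> I"
    and N_vanish: "\<And>c n. c \<in> I - T \<Longrightarrow> n \<in> carrier N \<Longrightarrow> \<epsilon> c \<odot>\<^bsub>N\<^esub> n = \<zero>\<^bsub>N\<^esub>"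
    and R_vanish: "\<And>c c' r. c \<in> I - T \<Longrightarrow> c' \<in> T \<Longrightarrow> r \<in> carrier R \<Longrightarrow>
      \<epsilon> c \<otimes>\<^bsub>R\<^esub> r \<otimes>\<^bsub>R\<^esub> \<epsilon> c' = \<zero>\<^bsub>R\<^esub>"
begin

text \<open>
  A basis element coding an element \<open>v\<close> of the triangular part is multiplied by the sum of those
  \<open>\<epsilon>\<^sub>c\<close> with \<open>\<epsilon>\<^sub>c v = v\<close>.  By orthogonality there is at most one such \<open>c\<close> unless \<open>v = 0\<close>, and non
  homogeneous \<open>v\<close> do not contribute.
\<close>

primrec triangular_idem :: "nat \<Rightarrow> ('r, 'n) cell \<Rightarrow> 'r" where
  "triangular_idem 0 =
    (\<lambda>b. esum {c \<in> T. \<exists>v\<in>carrier N. b = Elt v \<and> \<epsilon> c \<odot>\<^bsub>N\<^esub> v = v})"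
| "triangular_idem (Suc n) =
    (\<lambda>b. esum {c \<in> T. \<exists>v\<in>carrier (Z n).
      v \<in> subfree R (B n) (triangular_idem n) \<and> b = chain_cell R v \<and> \<epsilon> c \<odot>\<^bsub>F n\<^esub> v = v})"

abbreviation "P n \<equiv> subfree R (B n) (triangular_idem n)"

text \<open>The index sets in the recursion of \<open>triangular_idem\<close>, extracted so that
  both cases become the single formula \<open>esum (idx n b)\<close>.\<close>

definition idx :: "nat \<Rightarrow> ('r, 'n) cell \<Rightarrow> 'i set" where
  "idx n b = (case n of
      0 \<Rightarrow> {c \<in> T. \<exists>v\<in>carrier N. b = Elt v \<and> \<epsilon> c \<odot>\<^bsub>N\<^esub> v = v}
    | Suc n \<Rightarrow> {c \<in> T. \<exists>v\<in>carrier (Z n). v \<in> P n \<and> b = chain_cell R v \<and> \<epsilon> c \<odot>\<^bsub>F n\<^esub> v = v})"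

lemma triangular_idem_eq: "triangular_idem n b = esum (idx n b)"
  by (cases n) (simp_all add: idx_def)

declare triangular_idem.simps [simp del]

lemma idx_T: "idx n b \<subseteq> T"
  by (auto simp: idx_def split: nat.splits)

lemma idx_I: "idx n b \<subseteq> I"
  using idx_T T_subset by blast

lemma idx_0: "v \<in> carrier N \<Longrightarrow> idx 0 (Elt v) = {c \<in> T. \<epsilon> c \<odot>\<^bsub>N\<^esub> v = v}"
  by (auto simp: idx_def)

lemma idx_Suc:
  assumes "v \<in> carrier (Z n)"
  shows "idx (Suc n) (chain_cell R v) = {c \<in> T. v \<in> P n \<and> \<epsilon> c \<odot>\<^bsub>F n\<^esub> v = v}"
  using inj_onD[OF inj_chain_cell _ assms] assms by (auto simp: idx_def)

lemma triangular_idem_closed: "triangular_idem n b \<in> carrier R"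
  by (simp add: triangular_idem_eq esum_closed idx_I)

lemma triangular_idem_idem: "triangular_idem n b \<otimes>\<^bsub>R\<^esub> triangular_idem n b = triangular_idem n b"
  by (simp add: triangular_idem_eq esum_idem idx_I)

lemma \<epsilon>_triangular_idem:
  "c \<in> I \<Longrightarrow> \<epsilon> c \<otimes>\<^bsub>R\<^esub> triangular_idem n b = (if c \<in> idx n b then \<epsilon> c else \<zero>\<^bsub>R\<^esub>)"
  by (simp add: triangular_idem_eq \<epsilon>_esum idx_I)

lemma P_submodule: "submodule (P n) R (F n)"
  unfolding resolution_eq by (rule R.subfree_submodule[OF triangular_idem_closed])

text \<open>A coefficient of \<open>v\<close> is a sum of ring elements ending in some
  \<open>\<epsilon> c'\<close> with \<open>c' \<in> T\<close>, and these are annihilated from the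
  left by \<open>R_vanish\<close>.\<close>

lemma P_vanish:
  assumes c: "c \<in> I - T" and v: "v \<in> P n"
  shows "\<epsilon> c \<odot>\<^bsub>F n\<^esub> v = \<zero>\<^bsub>F n\<^esub>"
proof
  fix b
  have vF: "v \<in> carrier (free_module R (B n))" using v by (rule subfree_closed)
  have vb: "v b \<in> carrier R" by (rule R.free_mem[OF vF])
  have "v b \<otimes>\<^bsub>R\<^esub> triangular_idem n b = v b"
    using v R.free_outside[OF vF] triangular_idem_closed by (cases "b \<in> B n") (auto simp: subfree_def)
  then have "\<epsilon> c \<otimes>\<^bsub>R\<^esub> v b = \<epsilon> c \<otimes>\<^bsub>R\<^esub> (v b \<otimes>\<^bsub>R\<^esub> triangular_idem n b)" by simp
  also have "\<dots> = (\<epsilon> c \<otimes>\<^bsub>R\<^esub> v b) \<otimes>\<^bsub>R\<^esub> esum (idx n b)"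
    using c vb esum_closed[OF idx_I] by (simp add: triangular_idem_eq R.m_assoc)
  also have "\<dots> = (\<Oplus>\<^bsub>R\<^esub>c'\<in>idx n b. \<epsilon> c \<otimes>\<^bsub>R\<^esub> v b \<otimes>\<^bsub>R\<^esub> \<epsilon> c')"
    using c vb by (intro esum_mult_right idx_I) auto
  also have "\<dots> = (\<Oplus>\<^bsub>R\<^esub>c'\<in>idx n b. \<zero>\<^bsub>R\<^esub>)"
    using c vb idx_T[of n b] by (intro R.finsum_cong') (auto simp: R_vanish)
  finally show "(\<epsilon> c \<odot>\<^bsub>F n\<^esub> v) b = \<zero>\<^bsub>F n\<^esub> b"
    using c vF by (simp add: resolution_eq R.free_smult_apply R.zero_free)
qed

lemma diff_P:
  assumes p: "p \<in> P (Suc n)"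
  shows "d n p \<in> P n"
proof (rule R.subfree_induct[where P = "\<lambda>p. d n p \<in> P n", OF triangular_idem_closed triangular_idem_idem p])
  interpret Fn: left_module R "F n" by (rule resolution_left_module)
  note P = P_submodule[of n]
  show "d n \<zero>\<^bsub>free_module R (B (Suc n))\<^esub> \<in> P n"
    using additive_map_zero[OF R.free_abelian_group Fn.M.abelian_group_axioms]
      linear_map_additive[OF diff_linear[of n]] submodule_zero[OF P] by (metis resolution_eq)
  show "d n (f \<oplus>\<^bsub>free_module R (B (Suc n))\<^esub> g) \<in> P n"
    if "f \<in> carrier (free_module R (B (Suc n)))" "g \<in> carrier (free_module R (B (Suc n)))"
      "d n f \<in> P n" "d n g \<in> P n" for f g
    using linear_map_add[OF diff_linear, of f n g] that submodule_add[OF P] by (simp add: resolution_eq)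
  fix b r assume b: "b \<in> B (Suc n)" and r: "r \<in> carrier R" and re: "r \<otimes>\<^bsub>R\<^esub> triangular_idem (Suc n) b = r"
  obtain v where v: "v \<in> carrier (Z n)" "b = chain_cell R v"
    using b by (auto simp: resolution_basis.simps)
  have eq: "d n (r \<odot>\<^bsub>free_module R (B (Suc n))\<^esub> basis_vector R b) = r \<odot>\<^bsub>F n\<^esub> v"
    using linear_map_smult[OF diff_linear r basis_closed_Suc[OF v(1)]] v
    by (simp add: diff_basis resolution_eq)
  show "d n (r \<odot>\<^bsub>free_module R (B (Suc n))\<^esub> basis_vector R b) \<in> P n"
  proof (cases "v \<in> P n")
    case True
    then show ?thesis unfolding eq by (rule submodule_smult[OF P r])
  next
    case False
    \<comment> \<open>A cell coding a syzygy outside \<open>P n\<close> carries the idempotent zero,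
      so only the zero coefficient is allowed there.\<close>
    then have "idx (Suc n) b = {}" using idx_Suc[OF v(1)] v(2) by simp
    then have "r = \<zero>\<^bsub>R\<^esub>" using re r by (simp add: triangular_idem_eq esum_def)
    then show ?thesis
      unfolding eq using syzygy_subset[OF v(1)] submodule_zero[OF P] by simp
  qed
qed

text \<open>The components of \<open>aug y\<close> with index in \<open>T\<close> have their own
  cells, which produces \<open>p\<close> in \<open>P 0\<close> with the same augmentation. The
  difference is a syzygy, hence a boundary.\<close>

lemma P_exact_0:
  assumes y: "y \<in> carrier (F 0)"
  shows "\<exists>p\<in>P 0. \<exists>w\<in>carrier (F 1). y \<ominus>\<^bsub>F 0\<^esub> p = d 0 w"
proof -
  interpret F0: left_module R "F 0" by (rule resolution_left_module)
  have v: "aug y \<in> carrier N" by (rule linear_map_closed[OF aug_linear y])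
  have ev: "\<epsilon> c \<odot>\<^bsub>N\<^esub> aug y \<in> carrier N" if "c \<in> T" for c
    using that T_subset v by auto
  have "\<exists>p\<in>P 0. aug p = aug y"
  proof (rule ex_subfree_preimage[OF left_module v T_subset, where b = "\<lambda>c. Elt (\<epsilon> c \<odot>\<^bsub>N\<^esub> aug y)"])
    show "linear_map R (free_module R (B 0)) N aug"
      using aug_linear unfolding resolution_eq .
    fix c assume c: "c \<in> T"
    show "Elt (\<epsilon> c \<odot>\<^bsub>N\<^esub> aug y) \<in> B 0" using ev[OF c] by (simp add: resolution_basis.simps)
    show "aug (basis_vector R (Elt (\<epsilon> c \<odot>\<^bsub>N\<^esub> aug y))) = \<epsilon> c \<odot>\<^bsub>N\<^esub> aug y"
      by (rule aug_basis[OF ev[OF c]])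
    show "\<epsilon> c \<otimes>\<^bsub>R\<^esub> triangular_idem 0 (Elt (\<epsilon> c \<odot>\<^bsub>N\<^esub> aug y)) = \<epsilon> c"
      using c T_subset v by (auto simp: \<epsilon>_triangular_idem idx_0 ev smult_assoc[symmetric])
  qed (use v in \<open>auto simp: N_vanish triangular_idem_closed\<close>)
  then obtain p where p: "p \<in> P 0" "aug p = aug y" by blast
  have pF: "p \<in> carrier (F 0)" using subfree_closed[OF p(1)] by (simp add: resolution_eq)
  have "y \<ominus>\<^bsub>F 0\<^esub> p \<in> carrier (Z 0)"
    unfolding mem_syzygy_0
    using additive_map_minus[OF F0.M.abelian_group_axioms M.abelian_group_axioms linear_map_additive[OF aug_linear] y pF]
      y pF p(2) v by simp
  then show ?thesis
    using p(1) diff_basis[of _ 0] basis_closed_Suc[of _ 0] by (metis One_nat_def)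
qed

text \<open>Since \<open>d n y\<close> lies in \<open>P n\<close>, its components outside
  \<open>T\<close> vanish, and the remaining ones are homogeneous syzygies in \<open>P n\<close>.
  Their cells therefore admit the coefficients \<open>\<epsilon> c\<close> and lift
  \<open>d n y\<close> to \<open>P (Suc n)\<close>.\<close>

lemma P_exact_Suc:
  assumes y: "y \<in> carrier (F (Suc n))" and dy: "d n y \<in> P n"
  shows "\<exists>p\<in>P (Suc n). \<exists>w\<in>carrier (F (Suc (Suc n))). y \<ominus>\<^bsub>F (Suc n)\<^esub> p = d (Suc n) w"
proof -
  interpret Fn: left_module R "F n" by (rule resolution_left_module)
  interpret Fs: left_module R "F (Suc n)" by (rule resolution_left_module)
  interpret Zn: left_module R "Z n" by (rule syzygy_left_module)
  have v: "d n y \<in> carrier (Z n)" by (rule diff_syzygy[OF y])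
  have ev: "\<epsilon> c \<odot>\<^bsub>F n\<^esub> d n y \<in> carrier (Z n)" "\<epsilon> c \<odot>\<^bsub>F n\<^esub> d n y \<in> P n" if "c \<in> T" for c
    using that T_subset Zn.smult_closed[of "\<epsilon> c", OF _ v] submodule_smult[OF P_submodule _ dy]
    by (auto simp: syzygy_simps)
  have "\<exists>p\<in>P (Suc n). d n p = d n y"
  proof (rule ex_subfree_preimage[OF resolution_left_module _ T_subset, where b = "\<lambda>c. chain_cell R (\<epsilon> c \<odot>\<^bsub>F n\<^esub> d n y)"])
    show "linear_map R (free_module R (B (Suc n))) (F n) (d n)"
      using diff_linear[of n] unfolding resolution_eq .
    fix c assume c: "c \<in> T"
    show "chain_cell R (\<epsilon> c \<odot>\<^bsub>F n\<^esub> d n y) \<in> B (Suc n)" using ev[OF c] by (simp add: resolution_basis.simps)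
    show "d n (basis_vector R (chain_cell R (\<epsilon> c \<odot>\<^bsub>F n\<^esub> d n y))) = \<epsilon> c \<odot>\<^bsub>F n\<^esub> d n y"
      by (rule diff_basis[OF ev(1)[OF c]])
    have "\<epsilon> c \<odot>\<^bsub>F n\<^esub> (\<epsilon> c \<odot>\<^bsub>F n\<^esub> d n y) = \<epsilon> c \<odot>\<^bsub>F n\<^esub> d n y"
      using c T_subset syzygy_subset[OF v] by (auto simp: Fn.smult_assoc[symmetric])
    then show "\<epsilon> c \<otimes>\<^bsub>R\<^esub> triangular_idem (Suc n) (chain_cell R (\<epsilon> c \<odot>\<^bsub>F n\<^esub> d n y)) = \<epsilon> c"
      using c T_subset by (auto simp: \<epsilon>_triangular_idem idx_Suc ev)
  qed (use syzygy_subset[OF v] in \<open>auto simp: P_vanish[OF _ dy] triangular_idem_closed\<close>)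
  then obtain p where p: "p \<in> P (Suc n)" "d n p = d n y" by blast
  have pF: "p \<in> carrier (F (Suc n))" using subfree_closed[OF p(1)] by (simp add: resolution_eq)
  have "y \<ominus>\<^bsub>F (Suc n)\<^esub> p \<in> carrier (Z (Suc n))"
    unfolding mem_syzygy_Suc
    using additive_map_minus[OF Fs.M.abelian_group_axioms Fn.M.abelian_group_axioms linear_map_additive[OF diff_linear] y pF]
      y pF p(2) syzygy_subset[OF v] by simp
  then show ?thesis
    using p(1) diff_basis[of _ "Suc n"] basis_closed_Suc[of _ "Suc n"] by metis
qed

sublocale PS: projective_subcomplex K R M B d triangular_idem
proof (intro projective_subcomplex.intro projective_subcomplex_axioms.intro)
  show "right_module_over K R M" by (rule right_module_over_axioms)
  show "linear_map R (free_module R (B (Suc n))) (free_module R (B n)) (d n)" for n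
    by (rule diff_free)
  show "d n (d (Suc n) f) = \<zero>\<^bsub>free_module R (B n)\<^esub>" if "f \<in> carrier (free_module R (B (Suc (Suc n))))" for n f
    using diff_diff[of f n] that by (simp only: resolution_eq)
  show "\<exists>p\<in>P 0. \<exists>w\<in>carrier (free_module R (B 1)). y \<ominus>\<^bsub>free_module R (B 0)\<^esub> p = d 0 w"
    if "y \<in> carrier (free_module R (B 0))" for y
    using P_exact_0[of y] that by (simp only: resolution_eq)
  show "\<exists>p\<in>P (Suc n). \<exists>w\<in>carrier (free_module R (B (Suc (Suc n)))). y \<ominus>\<^bsub>free_module R (B (Suc n))\<^esub> p = d (Suc n) w"
    if "y \<in> carrier (free_module R (B (Suc n)))" "d n y \<in> P n" for y n
    using P_exact_Suc[of y n] that by (simp only: resolution_eq)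
qed (simp_all add: triangular_idem_closed triangular_idem_idem diff_P)

end

section \<open>Corners\<close>

text \<open>A family relabelled along an injection \<open>\<beta>\<close>, with values mapped by
  \<open>g\<close> and extended by \<open>z\<close>. It serves twice: with \<open>\<rho>\<close> on
  ring coefficients, and with the identity on coefficients in the right module.\<close>

definition transport :: "'w \<Rightarrow> 'b set \<Rightarrow> ('b \<Rightarrow> 'c) \<Rightarrow> ('v \<Rightarrow> 'w) \<Rightarrow> ('b \<Rightarrow> 'v) \<Rightarrow> 'c \<Rightarrow> 'w" where
  "transport z B \<beta> g f = (\<lambda>c. if c \<in> \<beta> ` B then g (f (the_inv_into B \<beta> c)) else z)"

lemma transport_image:
  "inj_on \<beta> B \<Longrightarrow> b \<in> B \<Longrightarrow> transport z B \<beta> g f (\<beta> b) = g (f b)"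
  by (simp add: transport_def the_inv_into_f_f)

lemma transport_outside: "c \<notin> \<beta> ` B \<Longrightarrow> transport z B \<beta> g f c = z"
  by (simp add: transport_def)

lemma transport_eqI:
  assumes "inj_on \<beta> B" "\<And>b. b \<in> B \<Longrightarrow> g (f b) = h (\<beta> b)" "\<And>c. c \<notin> \<beta> ` B \<Longrightarrow> h c = z"
  shows "transport z B \<beta> g f = h"
proof
  fix c show "transport z B \<beta> g f c = h c"
    using assms by (cases "c \<in> \<beta> ` B") (auto simp: transport_image transport_outside)
qed

lemma transport_support:
  assumes "inj_on \<beta> B" "g z' = z" "finite {b. f b \<noteq> z'}"
  shows "finite {c. transport z B \<beta> g f c \<noteq> z}"
proof (rule finite_subset)
  show "{c. transport z B \<beta> g f c \<noteq> z} \<subseteq> \<beta> ` {b. f b \<noteq> z'}"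
  proof
    fix c assume c: "c \<in> {c. transport z B \<beta> g f c \<noteq> z}"
    then obtain b where "b \<in> B" "c = \<beta> b" using transport_outside[of c \<beta> B z g f] by blast
    then show "c \<in> \<beta> ` {b. f b \<noteq> z'}" using c assms(1,2) by (auto simp: transport_image)
  qed
qed (simp add: assms(3))

text \<open>\<open>\<rho>\<close> identifies \<open>R'\<close> with
  \<open>\<epsilon> \<delta> R \<epsilon> \<delta>\<close>, while \<open>N'\<close> is
  \<open>\<epsilon> \<delta> N\<close> and \<open>M'\<close> is
  \<open>M \<epsilon> \<delta>\<close>. By \<open>\<delta>_vanish\<close>, among the pieces
  \<open>\<epsilon> \<delta> R \<epsilon> c\<close> with \<open>c \<in> T\<close> only the one for
  \<open>c = \<delta>\<close> survives; this makes \<open>\<epsilon> \<delta> P\<close> free over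
  \<open>R'\<close>.\<close>

locale peirce_corner = peirce_pair K R M N I \<epsilon> T + X: tor_setup K R' M' N'
  for K :: "('k, 'x) ring_scheme" and R :: "('r, 'y) ring_scheme"
    and M :: "('k, 'r, 'm) right_module" and N :: "('r, 'n) module"
    and I :: "'i set" and \<epsilon> :: "'i \<Rightarrow> 'r" and T :: "'i set"
    and R' :: "('s, 'z) ring_scheme" and M' :: "('k, 's, 'm) right_module" and N' :: "('s, 'n) module" +
  fixes \<delta> :: 'i and \<rho> :: "'s \<Rightarrow> 'r"
  assumes \<delta>: "\<delta> \<in> T"
    and \<delta>_vanish: "\<And>c r. c \<in> T \<Longrightarrow> c \<noteq> \<delta> \<Longrightarrow> r \<in> carrier R \<Longrightarrow> \<epsilon> \<delta> \<otimes>\<^bsub>R\<^esub> r \<otimes>\<^bsub>R\<^esub> \<epsilon> c = \<zero>\<^bsub>R\<^esub>"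
    and \<rho>_additive: "additive_map R' R \<rho>"
    and \<rho>_mult: "\<And>r s. r \<in> carrier R' \<Longrightarrow> s \<in> carrier R' \<Longrightarrow> \<rho> (r \<otimes>\<^bsub>R'\<^esub> s) = \<rho> r \<otimes>\<^bsub>R\<^esub> \<rho> s"
    and \<rho>_one: "\<rho> \<one>\<^bsub>R'\<^esub> = \<epsilon> \<delta>"
    and \<rho>_inj: "inj_on \<rho> (carrier R')"
    and \<rho>_surj: "\<And>r. r \<in> carrier R \<Longrightarrow> \<epsilon> \<delta> \<otimes>\<^bsub>R\<^esub> r = r \<Longrightarrow> r \<otimes>\<^bsub>R\<^esub> \<epsilon> \<delta> = r \<Longrightarrow> r \<in> \<rho> ` carrier R'"
    and carrier_N': "\<And>v. v \<in> carrier N' \<longleftrightarrow> v \<in> carrier N \<and> \<epsilon> \<delta> \<odot>\<^bsub>N\<^esub> v = v"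
    and zero_N': "\<zero>\<^bsub>N'\<^esub> = \<zero>\<^bsub>N\<^esub>" and add_N': "add N' = add N"
    and smult_N': "\<And>r v. r \<in> carrier R' \<Longrightarrow> v \<in> carrier N' \<Longrightarrow> r \<odot>\<^bsub>N'\<^esub> v = \<rho> r \<odot>\<^bsub>N\<^esub> v"
    and carrier_M': "\<And>m. m \<in> carrier M' \<longleftrightarrow> m \<in> carrier M \<and> rsmult M m (\<epsilon> \<delta>) = m"
    and zero_M': "\<zero>\<^bsub>M'\<^esub> = \<zero>\<^bsub>M\<^esub>" and add_M': "add M' = add M"
    and smult_M': "smult M' = smult M"
    and rsmult_M': "\<And>m r. m \<in> carrier M' \<Longrightarrow> r \<in> carrier R' \<Longrightarrow> rsmult M' m r = rsmult M m (\<rho> r)"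
begin

lemma \<delta>_I: "\<delta> \<in> I"
  using \<delta> T_subset by blast

lemma \<rho>_closed: "r \<in> carrier R' \<Longrightarrow> \<rho> r \<in> carrier R"
  by (rule additive_map_closed[OF \<rho>_additive])

lemma \<rho>_zero: "\<rho> \<zero>\<^bsub>R'\<^esub> = \<zero>\<^bsub>R\<^esub>"
  by (rule additive_map_zero[OF X.R.is_abelian_group R.is_abelian_group \<rho>_additive])

lemma \<epsilon>_\<rho>: "r \<in> carrier R' \<Longrightarrow> \<epsilon> \<delta> \<otimes>\<^bsub>R\<^esub> \<rho> r = \<rho> r"
  using \<rho>_mult[of "\<one>\<^bsub>R'\<^esub>" r] by (simp add: \<rho>_one)

lemma \<rho>_\<epsilon>: "r \<in> carrier R' \<Longrightarrow> \<rho> r \<otimes>\<^bsub>R\<^esub> \<epsilon> \<delta> = \<rho> r"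
  using \<rho>_mult[of r "\<one>\<^bsub>R'\<^esub>"] by (simp add: \<rho>_one)

text \<open>
  The canonical resolution over the corner is carried to that over \<open>R\<close> by recoding cells; the
  image of \<open>chain_map\<close> will be the part \<open>\<epsilon>\<^sub>\<delta> P\<close> of the triangular subcomplex \<open>P\<close>.
\<close>

primrec cell_map :: "nat \<Rightarrow> ('s, 'n) cell \<Rightarrow> ('r, 'n) cell" where
  "cell_map 0 = (\<lambda>b. Elt (the_inv_into (carrier N') Elt b))"
| "cell_map (Suc n) = (\<lambda>b. chain_cell R
    (transport \<zero>\<^bsub>R\<^esub> (X.B n) (cell_map n) \<rho> (the_inv_into (carrier (X.Z n)) (chain_cell R') b)))"

definition chain_map :: "nat \<Rightarrow> (('s, 'n) cell \<Rightarrow> 's) \<Rightarrow> ('r, 'n) cell \<Rightarrow> 'r" where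
  "chain_map n = transport \<zero>\<^bsub>R\<^esub> (X.B n) (cell_map n) \<rho>"

lemma cell_map_0: "v \<in> carrier N' \<Longrightarrow> cell_map 0 (Elt v) = Elt v"
  by (simp add: the_inv_into_f_f[OF X.inj_Elt])

lemma cell_map_Suc: "w \<in> carrier (X.Z n) \<Longrightarrow> cell_map (Suc n) (chain_cell R' w) = chain_cell R (chain_map n w)"
  by (simp add: the_inv_into_f_f[OF X.inj_chain_cell] chain_map_def)

declare cell_map.simps [simp del]

text \<open>The cells at which an element of \<open>\<epsilon> \<delta> P\<close> can have a non
  zero coefficient; they index a basis of this part over \<open>R'\<close>.\<close>

definition diagonal_basis :: "nat \<Rightarrow> ('r, 'n) cell set" where
  "diagonal_basis n = {b \<in> B n. \<delta> \<in> idx n b}"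

text \<open>\<open>r\<close> is the sum of the \<open>r \<otimes> \<epsilon> c\<close> over
  \<open>idx n b\<close>, and each of these equals
  \<open>\<epsilon> \<delta> \<otimes> r \<otimes> \<epsilon> c\<close>, which is zero unless
  \<open>c = \<delta>\<close>. So coefficients of \<open>\<epsilon> \<delta> P\<close> vanish off
  the diagonal cells and lie in the corner ring on them.\<close>

lemma triangular_idem_absorb:
  assumes r: "r \<in> carrier R" "\<epsilon> \<delta> \<otimes>\<^bsub>R\<^esub> r = r" "r \<otimes>\<^bsub>R\<^esub> triangular_idem n b = r"
  shows "(if \<delta> \<in> idx n b then r \<otimes>\<^bsub>R\<^esub> \<epsilon> \<delta> else \<zero>\<^bsub>R\<^esub>) = r"
proof -
  have fin: "finite (idx n b)" using idx_I finite_I finite_subset by blast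
  have z: "r \<otimes>\<^bsub>R\<^esub> \<epsilon> c = \<zero>\<^bsub>R\<^esub>" if "c \<in> idx n b" "c \<noteq> \<delta>" for c
    using \<delta>_vanish[of c r] r(1,2) that idx_T[of n b] by auto
  have c: "r \<otimes>\<^bsub>R\<^esub> \<epsilon> c \<in> carrier R" if "c \<in> idx n b" for c
    using that idx_I[of n b] r(1) by auto
  have "r = (\<Oplus>\<^bsub>R\<^esub>c\<in>idx n b. r \<otimes>\<^bsub>R\<^esub> \<epsilon> c)"
    using r(1,3) esum_mult_right[OF idx_I[of n b] r(1)] by (simp add: triangular_idem_eq)
  also have "\<dots> = (\<Oplus>\<^bsub>R\<^esub>c\<in>idx n b. if \<delta> = c then r \<otimes>\<^bsub>R\<^esub> \<epsilon> c else \<zero>\<^bsub>R\<^esub>)"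
    using z c by (intro R.finsum_cong') auto
  also have "\<dots> = (if \<delta> \<in> idx n b then r \<otimes>\<^bsub>R\<^esub> \<epsilon> \<delta> else \<zero>\<^bsub>R\<^esub>)"
  proof (cases "\<delta> \<in> idx n b")
    case True
    then show ?thesis using fin c by (simp add: R.finsum_singleton Pi_def)
  next
    case False
    then have "(\<Oplus>\<^bsub>R\<^esub>c\<in>idx n b. if \<delta> = c then r \<otimes>\<^bsub>R\<^esub> \<epsilon> c else \<zero>\<^bsub>R\<^esub>) = (\<Oplus>\<^bsub>R\<^esub>c\<in>idx n b. \<zero>\<^bsub>R\<^esub>)"
      by (intro R.finsum_cong') auto
    then show ?thesis using False by simp
  qed
  finally show ?thesis by simp
qed

definition diagonal_part :: "nat \<Rightarrow> (('r, 'n) cell \<Rightarrow> 'r) set" where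
  "diagonal_part n = {f \<in> P n. \<epsilon> \<delta> \<odot>\<^bsub>F n\<^esub> f = f}"

text \<open>The bijection of cells is a premise here because it is obtained degree by degree: cells
  of degree \<open>Suc n\<close> code syzygies of degree \<open>n\<close>, so it needs
  \<open>chain_map n\<close> first.\<close>

context
  fixes n
  assumes \<beta>: "bij_betw (cell_map n) (X.B n) (diagonal_basis n)"
begin

lemma cell_map_inj: "inj_on (cell_map n) (X.B n)"
  and cell_map_image: "cell_map n ` X.B n = diagonal_basis n"
  using \<beta> by (simp_all add: bij_betw_def)

lemma cell_map_B: "b \<in> X.B n \<Longrightarrow> cell_map n b \<in> B n"
  and cell_map_idx: "b \<in> X.B n \<Longrightarrow> \<delta> \<in> idx n (cell_map n b)"
  using cell_map_image by (auto simp: diagonal_basis_def)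

lemma chain_map_image: "b \<in> X.B n \<Longrightarrow> chain_map n f (cell_map n b) = \<rho> (f b)"
  unfolding chain_map_def by (rule transport_image[OF cell_map_inj])

lemma chain_map_outside: "c \<notin> diagonal_basis n \<Longrightarrow> chain_map n f c = \<zero>\<^bsub>R\<^esub>"
  unfolding chain_map_def by (rule transport_outside) (simp add: cell_map_image)

lemma diagonal_cases:
  assumes "\<And>b. b \<in> X.B n \<Longrightarrow> c = cell_map n b \<Longrightarrow> Q" "c \<notin> diagonal_basis n \<Longrightarrow> Q"
  shows Q
  using assms cell_map_image by blast

lemma chain_map_carrier:
  assumes f: "f \<in> carrier (X.F n)"
  shows "chain_map n f \<in> carrier (F n)"
proof -
  have f': "f \<in> carrier (free_module R' (X.B n))" using f by (simp add: resolution_eq)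
  have "chain_map n f c \<in> carrier R" for c
    by (rule diagonal_cases[of c])
      (simp_all add: chain_map_image chain_map_outside \<rho>_closed X.R.free_mem[OF f'])
  moreover have "chain_map n f c = \<zero>\<^bsub>R\<^esub>" if "c \<notin> B n" for c
    using that by (intro chain_map_outside) (simp add: diagonal_basis_def)
  moreover have "finite {c. chain_map n f c \<noteq> \<zero>\<^bsub>R\<^esub>}"
    unfolding chain_map_def using f'
    by (intro transport_support[where g = \<rho> and z' = "\<zero>\<^bsub>R'\<^esub>", OF cell_map_inj \<rho>_zero]) (simp add: X.R.carrier_free_module)
  ultimately show ?thesis by (simp add: resolution_eq R.carrier_free_module)
qed

lemma chain_map_closed:
  assumes f: "f \<in> carrier (X.F n)"
  shows "chain_map n f \<in> diagonal_part n"
proof -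
  have f': "f \<in> carrier (free_module R' (X.B n))" using f by (simp add: resolution_eq)
  have kf: "chain_map n f \<in> carrier (free_module R (B n))"
    using chain_map_carrier[OF f] by (simp add: resolution_eq)
  have "chain_map n f c \<otimes>\<^bsub>R\<^esub> triangular_idem n c = chain_map n f c" for c
  proof (rule diagonal_cases[of c])
    fix b assume b: "b \<in> X.B n" "c = cell_map n b"
    have r: "f b \<in> carrier R'" by (rule X.R.free_mem[OF f'])
    have "\<rho> (f b) \<otimes>\<^bsub>R\<^esub> triangular_idem n c = \<rho> (f b) \<otimes>\<^bsub>R\<^esub> \<epsilon> \<delta> \<otimes>\<^bsub>R\<^esub> triangular_idem n c"
      by (simp add: \<rho>_\<epsilon>[OF r])
    also have "\<dots> = \<rho> (f b) \<otimes>\<^bsub>R\<^esub> (\<epsilon> \<delta> \<otimes>\<^bsub>R\<^esub> triangular_idem n c)"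
      by (rule R.m_assoc[OF \<rho>_closed[OF r] \<epsilon>_closed[OF \<delta>_I] triangular_idem_closed])
    also have "\<dots> = \<rho> (f b)"
      using b cell_map_idx[OF b(1)] \<delta>_I r by (simp add: \<epsilon>_triangular_idem \<rho>_\<epsilon>)
    finally show ?thesis using b by (simp add: chain_map_image)
  qed (simp add: chain_map_outside triangular_idem_closed)
  moreover have "\<epsilon> \<delta> \<odot>\<^bsub>F n\<^esub> chain_map n f = chain_map n f"
  proof
    fix c
    have "\<epsilon> \<delta> \<otimes>\<^bsub>R\<^esub> chain_map n f c = chain_map n f c"
      by (rule diagonal_cases[of c])
        (simp_all add: chain_map_image chain_map_outside \<epsilon>_\<rho> X.R.free_mem[OF f'] \<delta>_I)
    then show "(\<epsilon> \<delta> \<odot>\<^bsub>F n\<^esub> chain_map n f) c = chain_map n f c"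
      using R.free_smult_apply[OF \<epsilon>_closed[OF \<delta>_I] kf] by (simp add: resolution_eq)
  qed
  ultimately show ?thesis using kf by (simp add: diagonal_part_def subfree_def)
qed

lemma chain_map_add:
  assumes "f \<in> carrier (X.F n)" "g \<in> carrier (X.F n)"
  shows "chain_map n (f \<oplus>\<^bsub>X.F n\<^esub> g) = chain_map n f \<oplus>\<^bsub>F n\<^esub> chain_map n g"
proof
  fix c
  note fg = assms[unfolded resolution_eq]
  have 1: "(chain_map n f \<oplus>\<^bsub>F n\<^esub> chain_map n g) c = chain_map n f c \<oplus>\<^bsub>R\<^esub> chain_map n g c"
    using R.free_add_apply[OF chain_map_carrier[OF assms(1), unfolded resolution_eq]
        chain_map_carrier[OF assms(2), unfolded resolution_eq]] by (simp only: resolution_eq)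
  have 2: "(f \<oplus>\<^bsub>X.F n\<^esub> g) b = f b \<oplus>\<^bsub>R'\<^esub> g b" for b
    using X.R.free_add_apply[OF fg] by (simp only: resolution_eq)
  show "chain_map n (f \<oplus>\<^bsub>X.F n\<^esub> g) c = (chain_map n f \<oplus>\<^bsub>F n\<^esub> chain_map n g) c"
    unfolding 1
    by (rule diagonal_cases[of c])
      (simp_all add: chain_map_image chain_map_outside 2 X.R.free_mem[OF fg(1)] X.R.free_mem[OF fg(2)]
        additive_map_add[OF \<rho>_additive])
qed

lemma chain_map_smult:
  assumes "r \<in> carrier R'" "f \<in> carrier (X.F n)"
  shows "chain_map n (r \<odot>\<^bsub>X.F n\<^esub> f) = \<rho> r \<odot>\<^bsub>F n\<^esub> chain_map n f"
proof
  fix c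
  note f = assms(2)[unfolded resolution_eq]
  have 1: "(\<rho> r \<odot>\<^bsub>F n\<^esub> chain_map n f) c = \<rho> r \<otimes>\<^bsub>R\<^esub> chain_map n f c"
    using R.free_smult_apply[OF \<rho>_closed[OF assms(1)] chain_map_carrier[OF assms(2), unfolded resolution_eq]]
    by (simp only: resolution_eq)
  have 2: "(r \<odot>\<^bsub>X.F n\<^esub> f) b = r \<otimes>\<^bsub>R'\<^esub> f b" for b
    using X.R.free_smult_apply[OF assms(1) f] by (simp only: resolution_eq)
  show "chain_map n (r \<odot>\<^bsub>X.F n\<^esub> f) c = (\<rho> r \<odot>\<^bsub>F n\<^esub> chain_map n f) c"
    unfolding 1
    by (rule diagonal_cases[of c])
      (simp_all add: chain_map_image chain_map_outside 2 X.R.free_mem[OF f] \<rho>_mult \<rho>_closed assms(1))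
qed

lemma chain_map_additive: "additive_map (X.F n) (F n) (chain_map n)"
  by (intro additive_mapI chain_map_carrier chain_map_add)

lemma chain_map_inj: "inj_on (chain_map n) (carrier (X.F n))"
proof (rule inj_onI, rule ext)
  fix f g b assume fg: "f \<in> carrier (X.F n)" "g \<in> carrier (X.F n)" "chain_map n f = chain_map n g"
  note fg' = fg(1,2)[unfolded resolution_eq]
  show "f b = g b"
  proof (cases "b \<in> X.B n")
    case True
    then have "\<rho> (f b) = \<rho> (g b)" using fg(3) chain_map_image[OF True] by metis
    then show ?thesis using inj_onD[OF \<rho>_inj] X.R.free_mem[OF fg'(1)] X.R.free_mem[OF fg'(2)] by blast
  next
    case False
    then show ?thesis using X.R.free_outside[OF fg'(1)] X.R.free_outside[OF fg'(2)] by simp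
  qed
qed

text \<open>By \<open>triangular_idem_absorb\<close> the coefficients of \<open>g\<close> at
  diagonal cells lie in the range of \<open>\<rho>\<close> and all others are zero, so they can be
  pulled back one at a time.\<close>

lemma chain_map_surj:
  assumes g: "g \<in> diagonal_part n"
  shows "\<exists>f\<in>carrier (X.F n). chain_map n f = g"
proof -
  have gF: "g \<in> carrier (free_module R (B n))" using g subfree_closed by (auto simp: diagonal_part_def)
  have gc: "g c \<in> carrier R" for c by (rule R.free_mem[OF gF])
  have \<epsilon>g: "\<epsilon> \<delta> \<otimes>\<^bsub>R\<^esub> g c = g c" for c
    using R.free_smult_apply[OF \<epsilon>_closed[OF \<delta>_I] gF, of c] g by (simp add: diagonal_part_def resolution_eq)
  have ge: "g c \<otimes>\<^bsub>R\<^esub> triangular_idem n c = g c" if "c \<in> B n" for c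
    using g that by (simp add: diagonal_part_def subfree_def)
  have out: "g c = \<zero>\<^bsub>R\<^esub>" if "c \<notin> diagonal_basis n" for c
  proof (cases "c \<in> B n")
    case True
    have "g c = (if \<delta> \<in> idx n c then g c \<otimes>\<^bsub>R\<^esub> \<epsilon> \<delta> else \<zero>\<^bsub>R\<^esub>)"
      by (rule triangular_idem_absorb[OF gc \<epsilon>g ge[OF True], symmetric])
    then show ?thesis using that True by (simp add: diagonal_basis_def)
  next
    case False
    then show ?thesis by (rule R.free_outside[OF gF])
  qed
  have img: "g c \<in> \<rho> ` carrier R'" if "c \<in> diagonal_basis n" for c
    using that triangular_idem_absorb[OF gc \<epsilon>g ge, of c]
    by (intro \<rho>_surj gc \<epsilon>g) (simp add: diagonal_basis_def)
  define f where "f b = (if b \<in> X.B n then the_inv_into (carrier R') \<rho> (g (cell_map n b)) else \<zero>\<^bsub>R'\<^esub>)" for b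
  have \<rho>f: "\<rho> (f b) = g (cell_map n b)" and fc: "f b \<in> carrier R'" if "b \<in> X.B n" for b
    using that img[of "cell_map n b"] cell_map_image f_the_inv_into_f[OF \<rho>_inj]
      the_inv_into_into[OF \<rho>_inj _ subset_refl] by (auto simp: f_def)
  have "finite (cell_map n ` {b \<in> X.B n. g (cell_map n b) \<noteq> \<zero>\<^bsub>R\<^esub>})"
    by (rule finite_subset[of _ "{c. g c \<noteq> \<zero>\<^bsub>R\<^esub>}"]) (use gF in \<open>auto simp: R.carrier_free_module\<close>)
  then have "finite {b \<in> X.B n. g (cell_map n b) \<noteq> \<zero>\<^bsub>R\<^esub>}"
    by (rule finite_imageD) (rule inj_on_subset[OF cell_map_inj], auto)
  moreover have "{b. f b \<noteq> \<zero>\<^bsub>R'\<^esub>} \<subseteq> {b \<in> X.B n. g (cell_map n b) \<noteq> \<zero>\<^bsub>R\<^esub>}"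
    using the_inv_into_f_f[OF \<rho>_inj, of "\<zero>\<^bsub>R'\<^esub>"] \<rho>_zero by (auto simp: f_def)
  ultimately have "finite {b. f b \<noteq> \<zero>\<^bsub>R'\<^esub>}" using finite_subset by blast
  then have "f \<in> carrier (X.F n)"
    using fc by (simp add: resolution_eq X.R.carrier_free_module f_def)
  moreover have "chain_map n f = g"
    unfolding chain_map_def
    by (rule transport_eqI[OF cell_map_inj]) (simp_all add: \<rho>f out cell_map_image)
  ultimately show ?thesis by blast
qed

end

lemma chain_map_basis:
  assumes "bij_betw (cell_map n) (X.B n) (diagonal_basis n)" "b \<in> X.B n" "r \<in> carrier R'"
  shows "chain_map n (r \<odot>\<^bsub>X.F n\<^esub> basis_vector R' b) = \<rho> r \<odot>\<^bsub>F n\<^esub> basis_vector R (cell_map n b)"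
  unfolding chain_map_def resolution_eq X.R.basis_smult_eq_single[OF assms(2,3)]
    R.basis_smult_eq_single[OF cell_map_B[OF assms(1,2)] \<rho>_closed[OF assms(3)]]
  using assms(2) cell_map_inj[OF assms(1)]
  by (intro transport_eqI) (auto simp: single_def \<rho>_zero inj_on_def)

text \<open>The induction hypothesis. Its second half, that syzygies are preserved and reflected, is
  what carries the bijection of cells one degree up.\<close>

definition compatible :: "nat \<Rightarrow> bool" where
  "compatible n \<longleftrightarrow> bij_betw (cell_map n) (X.B n) (diagonal_basis n) \<and>
    (\<forall>f\<in>carrier (X.F n). f \<in> carrier (X.Z n) \<longleftrightarrow> chain_map n f \<in> carrier (Z n))"

lemma compatible_0: "compatible 0"
proof -
  have "cell_map 0 ` X.B 0 = Elt ` carrier N'"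
    by (auto simp: resolution_basis.simps cell_map_0 image_iff)
  moreover have "diagonal_basis 0 = Elt ` carrier N'"
    using \<delta> by (auto simp: diagonal_basis_def resolution_basis.simps idx_0 carrier_N')
  moreover have "inj_on (cell_map 0) (X.B 0)"
    by (rule inj_onI) (auto simp: resolution_basis.simps cell_map_0)
  ultimately have \<beta>: "bij_betw (cell_map 0) (X.B 0) (diagonal_basis 0)"
    by (simp add: bij_betw_def)
  interpret F0: left_module R "F 0" by (rule resolution_left_module)
  have N'N: "additive_map N' N (\<lambda>v. v)"
    by (rule additive_mapI) (auto simp: carrier_N' add_N')
  \<comment> \<open>Both values are read in \<open>N\<close>, which contains \<open>N'\<close> with
    the same zero; hence the two kernels correspond.\<close>
  have "aug (chain_map 0 f) = X.aug f" if f: "f \<in> carrier (free_module R' (X.B 0))" for f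
  proof (rule X.R.additive_free_eq[OF M.abelian_group_axioms _ _ _ f])
    show "additive_map (free_module R' (X.B 0)) N (\<lambda>f. aug (chain_map 0 f))"
      using additive_map_comp[OF chain_map_additive[OF \<beta>] linear_map_additive[OF aug_linear]]
      by (simp add: resolution_eq)
    show "additive_map (free_module R' (X.B 0)) N X.aug"
      using additive_map_comp[OF linear_map_additive[OF X.aug_linear] N'N]
      by (simp add: resolution_eq)
    fix b r assume b: "b \<in> X.B 0" and r: "r \<in> carrier R'"
    obtain v where v: "v \<in> carrier N'" "b = Elt v" using b by (auto simp: resolution_basis.simps)
    have vN: "v \<in> carrier N" using v(1) by (simp add: carrier_N')
    have "aug (chain_map 0 (r \<odot>\<^bsub>X.F 0\<^esub> basis_vector R' b)) = \<rho> r \<odot>\<^bsub>N\<^esub> v"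
      using chain_map_basis[OF \<beta> b r] linear_map_smult[OF aug_linear \<rho>_closed[OF r] basis_closed_0[OF vN]]
      by (simp add: v(2) cell_map_0[OF v(1)] aug_basis[OF vN])
    moreover have "X.aug (r \<odot>\<^bsub>X.F 0\<^esub> basis_vector R' b) = \<rho> r \<odot>\<^bsub>N\<^esub> v"
      unfolding v(2)
      using linear_map_smult[OF X.aug_linear r X.basis_closed_0[OF v(1)]]
      by (simp add: X.aug_basis[OF v(1)] smult_N'[OF r v(1)])
    ultimately show "aug (chain_map 0 (r \<odot>\<^bsub>free_module R' (X.B 0)\<^esub> basis_vector R' b))
        = X.aug (r \<odot>\<^bsub>free_module R' (X.B 0)\<^esub> basis_vector R' b)"
      by (simp add: resolution_eq)
  qed
  then have "aug (chain_map 0 f) = X.aug f" if "f \<in> carrier (X.F 0)" for f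
    using that by (simp add: resolution_eq)
  then show ?thesis
    using \<beta> chain_map_carrier[OF \<beta>]
    by (simp add: compatible_def mem_syzygy_0 X.mem_syzygy_0 zero_N')
qed

text \<open>The target consists of exactly those syzygies whose cells make up
  \<open>diagonal_basis (Suc n)\<close>.\<close>

lemma chain_map_syzygy_bij:
  assumes "compatible n"
  shows "bij_betw (chain_map n) (carrier (X.Z n)) {v \<in> carrier (Z n). v \<in> P n \<and> \<epsilon> \<delta> \<odot>\<^bsub>F n\<^esub> v = v}"
proof (rule bij_betw_imageI)
  have \<beta>: "bij_betw (cell_map n) (X.B n) (diagonal_basis n)"
    and Z: "\<And>f. f \<in> carrier (X.F n) \<Longrightarrow> f \<in> carrier (X.Z n) \<longleftrightarrow> chain_map n f \<in> carrier (Z n)"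
    using assms by (auto simp: compatible_def)
  show "inj_on (chain_map n) (carrier (X.Z n))"
    by (rule inj_on_subset[OF chain_map_inj[OF \<beta>]]) (auto simp: X.syzygy_subset)
  show "chain_map n ` carrier (X.Z n) = {v \<in> carrier (Z n). v \<in> P n \<and> \<epsilon> \<delta> \<odot>\<^bsub>F n\<^esub> v = v}"
  proof (intro equalityI subsetI)
    fix v assume "v \<in> chain_map n ` carrier (X.Z n)"
    then obtain f where f: "f \<in> carrier (X.Z n)" "v = chain_map n f" by blast
    then show "v \<in> {v \<in> carrier (Z n). v \<in> P n \<and> \<epsilon> \<delta> \<odot>\<^bsub>F n\<^esub> v = v}"
      using chain_map_closed[OF \<beta> X.syzygy_subset[OF f(1)]] Z[OF X.syzygy_subset[OF f(1)]]
      by (simp add: diagonal_part_def)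
  next
    fix v assume v: "v \<in> {v \<in> carrier (Z n). v \<in> P n \<and> \<epsilon> \<delta> \<odot>\<^bsub>F n\<^esub> v = v}"
    then obtain f where f: "f \<in> carrier (X.F n)" "chain_map n f = v"
      using chain_map_surj[OF \<beta>, of v] by (auto simp: diagonal_part_def)
    then show "v \<in> chain_map n ` carrier (X.Z n)" using Z[OF f(1)] v by auto
  qed
qed

lemma cell_map_bij_Suc:
  assumes "compatible n"
  shows "bij_betw (cell_map (Suc n)) (X.B (Suc n)) (diagonal_basis (Suc n))"
proof (rule bij_betw_imageI)
  note \<kappa> = chain_map_syzygy_bij[OF assms]
  have \<kappa>Z: "chain_map n w \<in> carrier (Z n)" if "w \<in> carrier (X.Z n)" for w
    using bij_betwE[OF \<kappa>] that by blast
  show "inj_on (cell_map (Suc n)) (X.B (Suc n))"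
  proof (rule inj_onI)
    fix b b' assume "b \<in> X.B (Suc n)" "b' \<in> X.B (Suc n)" and eq: "cell_map (Suc n) b = cell_map (Suc n) b'"
    then obtain w w' where w: "w \<in> carrier (X.Z n)" "b = chain_cell R' w"
      "w' \<in> carrier (X.Z n)" "b' = chain_cell R' w'" by (auto simp: resolution_basis.simps)
    have "chain_map n w = chain_map n w'"
      using eq w inj_onD[OF inj_chain_cell _ \<kappa>Z[OF w(1)] \<kappa>Z[OF w(3)]] by (simp add: cell_map_Suc)
    then have "w = w'"
      using \<kappa> w by (auto simp: bij_betw_def inj_on_def)
    then show "b = b'" using w by simp
  qed
  have "cell_map (Suc n) ` X.B (Suc n) = chain_cell R ` (chain_map n ` carrier (X.Z n))"
    by (auto simp: resolution_basis.simps cell_map_Suc image_iff)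
  also have "\<dots> = chain_cell R ` {v \<in> carrier (Z n). v \<in> P n \<and> \<epsilon> \<delta> \<odot>\<^bsub>F n\<^esub> v = v}"
    using \<kappa> by (simp add: bij_betw_def)
  also have "\<dots> = diagonal_basis (Suc n)"
    using \<delta> by (auto simp: diagonal_basis_def resolution_basis.simps idx_Suc)
  finally show "cell_map (Suc n) ` X.B (Suc n) = diagonal_basis (Suc n)" .
qed

text \<open>On the basis vector that codes \<open>w\<close> both sides give
  \<open>chain_map n w\<close>, because \<open>cell_map\<close> recodes \<open>w\<close> as its own
  image. Additivity and compatibility with \<open>\<rho>\<close> do the rest.\<close>

lemma diff_chain_map_compatible:
  assumes c: "compatible n" and f: "f \<in> carrier (X.F (Suc n))"
  shows "d n (chain_map (Suc n) f) = chain_map n (X.d n f)"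
proof -
  have \<beta>: "bij_betw (cell_map n) (X.B n) (diagonal_basis n)"
    using c by (auto simp: compatible_def)
  note \<beta>' = cell_map_bij_Suc[OF c]
  interpret Fn: left_module R "F n" by (rule resolution_left_module)
  have f': "f \<in> carrier (free_module R' (X.B (Suc n)))" using f by (simp add: resolution_eq)
  show ?thesis
  proof (rule X.R.additive_free_eq[OF Fn.M.abelian_group_axioms _ _ _ f'])
    show "additive_map (free_module R' (X.B (Suc n))) (F n) (\<lambda>f. d n (chain_map (Suc n) f))"
      using additive_map_comp[OF chain_map_additive[OF \<beta>'] linear_map_additive[OF diff_linear]]
      by (simp add: resolution_eq)
    show "additive_map (free_module R' (X.B (Suc n))) (F n) (\<lambda>f. chain_map n (X.d n f))"
      using additive_map_comp[OF linear_map_additive[OF X.diff_linear] chain_map_additive[OF \<beta>]]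
      by (simp add: resolution_eq)
    fix b r assume b: "b \<in> X.B (Suc n)" and r: "r \<in> carrier R'"
    obtain w where w: "w \<in> carrier (X.Z n)" "b = chain_cell R' w"
      using b by (auto simp: resolution_basis.simps)
    have \<kappa>w: "chain_map n w \<in> carrier (Z n)"
      using bij_betwE[OF chain_map_syzygy_bij[OF c]] w(1) by blast
    have "d n (chain_map (Suc n) (r \<odot>\<^bsub>X.F (Suc n)\<^esub> basis_vector R' b)) = \<rho> r \<odot>\<^bsub>F n\<^esub> chain_map n w"
      using chain_map_basis[OF \<beta>' b r] linear_map_smult[OF diff_linear \<rho>_closed[OF r] basis_closed_Suc[OF \<kappa>w]]
      by (simp add: w(2) cell_map_Suc[OF w(1)] diff_basis[OF \<kappa>w])
    moreover have "chain_map n (X.d n (r \<odot>\<^bsub>X.F (Suc n)\<^esub> basis_vector R' b)) = \<rho> r \<odot>\<^bsub>F n\<^esub> chain_map n w"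
      unfolding w(2)
      using linear_map_smult[OF X.diff_linear r X.basis_closed_Suc[OF w(1)]]
      by (simp add: X.diff_basis[OF w(1)] chain_map_smult[OF \<beta> r X.syzygy_subset[OF w(1)]])
    ultimately show "d n (chain_map (Suc n) (r \<odot>\<^bsub>free_module R' (X.B (Suc n))\<^esub> basis_vector R' b))
        = chain_map n (X.d n (r \<odot>\<^bsub>free_module R' (X.B (Suc n))\<^esub> basis_vector R' b))"
      by (simp add: resolution_eq)
  qed
qed

lemma compatible: "compatible n"
proof (induction n)
  case 0
  show ?case by (rule compatible_0)
next
  case (Suc n)
  have \<beta>: "bij_betw (cell_map n) (X.B n) (diagonal_basis n)"
    using Suc by (auto simp: compatible_def)
  note \<beta>' = cell_map_bij_Suc[OF Suc]
  have "\<zero>\<^bsub>X.F n\<^esub> \<in> carrier (X.F n)"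
    by (rule abelian_groupE(2)[OF left_module.axioms(2)[OF X.resolution_left_module]])
  moreover have "chain_map n \<zero>\<^bsub>X.F n\<^esub> = \<zero>\<^bsub>F n\<^esub>"
    by (rule additive_map_zero[OF left_module.axioms(2)[OF X.resolution_left_module]
          left_module.axioms(2)[OF resolution_left_module] chain_map_additive[OF \<beta>]])
  ultimately have "X.d n f = \<zero>\<^bsub>X.F n\<^esub> \<longleftrightarrow> d n (chain_map (Suc n) f) = \<zero>\<^bsub>F n\<^esub>"
    if "f \<in> carrier (X.F (Suc n))" for f
    using diff_chain_map_compatible[OF Suc that] linear_map_closed[OF X.diff_linear that]
      inj_onD[OF chain_map_inj[OF \<beta>]] by metis
  then show ?case
    using \<beta>' chain_map_carrier[OF \<beta>']
    by (simp add: compatible_def mem_syzygy_Suc X.mem_syzygy_Suc)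
qed

lemma cell_map_bij: "bij_betw (cell_map n) (X.B n) (diagonal_basis n)"
  using compatible by (simp add: compatible_def)

lemmas cell_map_inj' = cell_map_inj[OF cell_map_bij]
  and cell_map_image' = cell_map_image[OF cell_map_bij]
  and diff_chain_map = diff_chain_map_compatible[OF compatible]

section \<open>The corner complex inside \<open>M \<otimes> P\<close>\<close>

definition push :: "nat \<Rightarrow> (('s, 'n) cell \<Rightarrow> 'm) \<Rightarrow> ('r, 'n) cell \<Rightarrow> 'm" where
  "push n = transport \<zero>\<^bsub>M\<^esub> (X.B n) (cell_map n) (\<lambda>m. m)"

lemma push_image: "b \<in> X.B n \<Longrightarrow> push n y (cell_map n b) = y b"
  unfolding push_def by (rule transport_image[OF cell_map_inj'])

lemma push_outside: "c \<notin> diagonal_basis n \<Longrightarrow> push n y c = \<zero>\<^bsub>M\<^esub>"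
  unfolding push_def by (rule transport_outside) (simp add: cell_map_image')

lemma M'_M: "m \<in> carrier M' \<Longrightarrow> m \<in> carrier M"
  by (simp add: carrier_M')

lemma push_closed:
  assumes y: "y \<in> carrier (X.CC n)"
  shows "push n y \<in> carrier (CC n)"
proof -
  have "push n y c \<in> carrier M" for c
    by (rule diagonal_cases[OF cell_map_bij, of n c])
      (simp_all add: push_image push_outside M'_M[OF X.copower_mem'[OF y]])
  moreover have "push n y c = \<zero>\<^bsub>M\<^esub>" if "c \<notin> B n" for c
    using that by (intro push_outside) (simp add: diagonal_basis_def)
  moreover have "finite {c. push n y c \<noteq> \<zero>\<^bsub>M\<^esub>}"
    unfolding push_def using y
    by (intro transport_support[where g = "\<lambda>m. m" and z' = "\<zero>\<^bsub>M'\<^esub>", OF cell_map_inj' zero_M']) (simp add: carrier_direct_sum)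
  ultimately show ?thesis by (simp add: carrier_direct_sum)
qed

lemma push_linear: "linear_map K (X.CC n) (CC n) (push n)"
proof (rule linear_mapI)
  fix y z assume yz: "y \<in> carrier (X.CC n)" "z \<in> carrier (X.CC n)"
  show "push n (y \<oplus>\<^bsub>X.CC n\<^esub> z) = push n y \<oplus>\<^bsub>CC n\<^esub> push n z"
  proof
    fix c
    have 1: "(push n y \<oplus>\<^bsub>CC n\<^esub> push n z) c = push n y c \<oplus>\<^bsub>M\<^esub> push n z c"
      using copower_add_apply[OF underlying_abelian_group push_closed[OF yz(1)] push_closed[OF yz(2)]] by simp
    have 2: "(y \<oplus>\<^bsub>X.CC n\<^esub> z) b = y b \<oplus>\<^bsub>M\<^esub> z b" for b
      using copower_add_apply[OF X.underlying_abelian_group yz] by (simp add: add_M')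
    show "push n (y \<oplus>\<^bsub>X.CC n\<^esub> z) c = (push n y \<oplus>\<^bsub>CC n\<^esub> push n z) c"
      unfolding 1
      by (rule diagonal_cases[OF cell_map_bij, of n c]) (simp_all add: push_image push_outside 2)
  qed
next
  fix k y assume ky: "k \<in> carrier K" "y \<in> carrier (X.CC n)"
  show "push n (k \<odot>\<^bsub>X.CC n\<^esub> y) = k \<odot>\<^bsub>CC n\<^esub> push n y"
  proof
    fix c
    show "push n (k \<odot>\<^bsub>X.CC n\<^esub> y) c = (k \<odot>\<^bsub>CC n\<^esub> push n y) c"
      unfolding copower_smult_apply[OF ky(1) push_closed[OF ky(2)]]
      by (rule diagonal_cases[OF cell_map_bij, of n c])
        (simp_all add: push_image push_outside X.copower_smult_apply[OF ky] smult_M' ky(1) left_module.smult_r_null[OF underlying_left_module, simplified])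
  qed
qed (rule push_closed)

text \<open>Identifies \<open>push\<close> as the map of tensor products induced by the inclusion of
  \<open>M'\<close> into \<open>M\<close> and by \<open>chain_map\<close>.\<close>

lemma push_tens:
  assumes m: "m \<in> carrier M'" and f: "f \<in> carrier (X.F n)"
  shows "push n (X.tens m f) = tens m (chain_map n f)"
proof
  fix c
  show "push n (X.tens m f) c = tens m (chain_map n f) c"
    using m X.R.free_mem[OF f[unfolded resolution_eq]]
    by - (rule diagonal_cases[OF cell_map_bij, of n c],
      simp_all add: push_image push_outside X.tens_def tens_def chain_map_image[OF cell_map_bij]
        chain_map_outside[OF cell_map_bij] rsmult_M' M'_M)
qed

lemma DD_push:
  assumes y: "y \<in> carrier (X.CC (Suc n))"
  shows "DD n (push (Suc n) y) = push n (X.DD n y)"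
proof (rule X.additive_copower_tens_eq[OF CC_abelian _ _ _ y])
  show "additive_map (X.CC (Suc n)) (CC n) (\<lambda>y. DD n (push (Suc n) y))"
    by (rule additive_map_comp[OF linear_map_additive[OF push_linear] linear_map_additive[OF DD_linear]])
  show "additive_map (X.CC (Suc n)) (CC n) (\<lambda>y. push n (X.DD n y))"
    by (rule additive_map_comp[OF linear_map_additive[OF X.DD_linear] linear_map_additive[OF push_linear]])
  fix b m assume b: "b \<in> X.B (Suc n)" and m: "m \<in> carrier M'"
  let ?b = "basis_vector R' b"
  have bf: "?b \<in> carrier (free_module R' (X.B (Suc n)))" by (rule X.R.basis_closed[OF b])
  then have bF: "?b \<in> carrier (X.F (Suc n))" by (simp add: resolution_eq)
  have "DD n (push (Suc n) (X.tens m ?b)) = tens m (d n (chain_map (Suc n) ?b))"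
    using chain_map_carrier[OF cell_map_bij bF]
    by (simp add: push_tens[OF m bF] tensor_map_tens[OF diff_free M'_M[OF m]] resolution_eq)
  also have "\<dots> = push n (X.tens m (X.d n ?b))"
    using push_tens[OF m linear_map_closed[OF X.diff_linear bF]] by (simp add: diff_chain_map[OF bF])
  also have "\<dots> = push n (X.DD n (X.tens m ?b))"
    by (simp add: X.tensor_map_tens[OF X.diff_free m bf])
  finally show "DD n (push (Suc n) (X.tens m ?b)) = push n (X.DD n (X.tens m ?b))" .
qed

lemma push_fixed:
  assumes y: "y \<in> carrier (X.CC n)"
  shows "rsmult M (push n y c) (\<epsilon> \<delta>) = push n y c"
proof (rule diagonal_cases[OF cell_map_bij, of n c])
  fix b assume "b \<in> X.B n" "c = cell_map n b"
  then show ?thesis using X.copower_mem'[OF y, of b] by (simp add: push_image carrier_M')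
qed (simp add: push_outside \<delta>_I)

text \<open>The values are fixed by \<open>\<epsilon> \<delta>\<close>, and at a diagonal cell
  \<open>\<epsilon> \<delta>\<close> absorbs the idempotent
  \<open>triangular_idem n c\<close>.\<close>

lemma push_tensor_P:
  assumes y: "y \<in> carrier (X.CC n)"
  shows "push n y \<in> PS.tensor_P n"
proof -
  have pM: "push n y c \<in> carrier M" for c by (rule copower_mem'[OF push_closed[OF y]])
  have "rsmult M (push n y c) (triangular_idem n c) = push n y c" for c
  proof (cases "c \<in> diagonal_basis n")
    case True
    have "rsmult M (push n y c) (triangular_idem n c) = rsmult M (rsmult M (push n y c) (\<epsilon> \<delta>)) (triangular_idem n c)"
      by (simp add: push_fixed[OF y])
    also have "\<dots> = rsmult M (push n y c) (\<epsilon> \<delta> \<otimes>\<^bsub>R\<^esub> triangular_idem n c)"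
      by (rule rsmult_assoc[OF pM \<epsilon>_closed[OF \<delta>_I] triangular_idem_closed, symmetric])
    also have "\<dots> = push n y c"
      using True by (simp add: \<epsilon>_triangular_idem[OF \<delta>_I] diagonal_basis_def push_fixed[OF y])
    finally show ?thesis .
  qed (simp add: push_outside triangular_idem_closed)
  then show ?thesis using push_closed[OF y] by (simp add: PS.tensor_P_def)
qed

lemma push_eq_zero:
  assumes y: "y \<in> carrier (X.CC n)" and z: "\<And>c. push n y c = \<zero>\<^bsub>M\<^esub>"
  shows "y = \<zero>\<^bsub>X.CC n\<^esub>"
proof
  fix b
  have "y b = \<zero>\<^bsub>M'\<^esub>"
    using z[of "cell_map n b"] y by (cases "b \<in> X.B n") (auto simp: push_image zero_M' carrier_direct_sum)
  then show "y b = \<zero>\<^bsub>X.CC n\<^esub> b" by (simp add: zero_direct_sum)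
qed

text \<open>A diagonal cell comes from exactly one cell of the corner, so the products of
  \<open>p c\<close> with \<open>\<epsilon> \<delta>\<close>, which lie in \<open>M'\<close>, can be
  read back there. Cells outside \<open>B n\<close> cause no conflict since \<open>p\<close> is zero
  on them.\<close>

lemma ex_push:
  assumes p: "p \<in> carrier (CC n)"
  shows "\<exists>y\<in>carrier (X.CC n). \<forall>c. push n y c = (if \<delta> \<in> idx n c then rsmult M (p c) (\<epsilon> \<delta>) else \<zero>\<^bsub>M\<^esub>)"
proof -
  have pM: "p c \<in> carrier M" for c by (rule copower_mem'[OF p])
  define y where "y b = (if b \<in> X.B n then rsmult M (p (cell_map n b)) (\<epsilon> \<delta>) else \<zero>\<^bsub>M\<^esub>)" for b
  have "finite (cell_map n ` {b \<in> X.B n. p (cell_map n b) \<noteq> \<zero>\<^bsub>M\<^esub>})"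
    by (rule finite_subset[of _ "{c. p c \<noteq> \<zero>\<^bsub>M\<^esub>}"]) (use p in \<open>auto simp: carrier_direct_sum\<close>)
  then have "finite {b \<in> X.B n. p (cell_map n b) \<noteq> \<zero>\<^bsub>M\<^esub>}"
    by (rule finite_imageD) (rule inj_on_subset[OF cell_map_inj'], auto)
  moreover have "{b. y b \<noteq> \<zero>\<^bsub>M\<^esub>} \<subseteq> {b \<in> X.B n. p (cell_map n b) \<noteq> \<zero>\<^bsub>M\<^esub>}"
    using \<delta>_I by (auto simp: y_def)
  ultimately have "finite {b. y b \<noteq> \<zero>\<^bsub>M\<^esub>}" using finite_subset by blast
  moreover have "rsmult M (p c) (\<epsilon> \<delta>) \<in> carrier M'" for c
    using rsmult_assoc[OF pM[of c] \<epsilon>_closed[OF \<delta>_I] \<epsilon>_closed[OF \<delta>_I]] pM \<delta>_I by (simp add: carrier_M')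
  ultimately have y: "y \<in> carrier (X.CC n)"
    by (simp add: carrier_direct_sum zero_M') (simp add: y_def)
  have "push n y c = (if \<delta> \<in> idx n c then rsmult M (p c) (\<epsilon> \<delta>) else \<zero>\<^bsub>M\<^esub>)" for c
  proof (rule diagonal_cases[OF cell_map_bij, of n c])
    fix b assume "b \<in> X.B n" "c = cell_map n b"
    then show ?thesis using cell_map_idx[OF cell_map_bij] by (simp add: push_image y_def)
  next
    assume c: "c \<notin> diagonal_basis n"
    then have "p c = \<zero>\<^bsub>M\<^esub>" if "\<delta> \<in> idx n c"
      using that p by (auto simp: diagonal_basis_def carrier_direct_sum)
    then show ?thesis using c \<delta>_I by (auto simp: push_outside)
  qed
  with y show ?thesis by blast
qed

end

section \<open>Decomposition of Tor\<close>

text \<open>\<open>M_vanish\<close> is the vanishing of \<open>M\<close> at the indices of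
  \<open>T\<close> that belong to no corner; it leaves in \<open>M \<otimes> P\<close> only the
  contributions of the corners.\<close>

locale peirce_decomposition = peirce_pair K R M N I \<epsilon> T
  for K :: "('k, 'x) ring_scheme" and R :: "('r, 'y) ring_scheme"
    and M :: "('k, 'r, 'm) right_module" and N :: "('r, 'n) module"
    and I :: "'i set" and \<epsilon> :: "'i \<Rightarrow> 'r" and T :: "'i set" +
  fixes E :: "'e set" and R' :: "'e \<Rightarrow> ('s, 'z) ring_scheme" and M' :: "'e \<Rightarrow> ('k, 's, 'm) right_module"
    and N' :: "'e \<Rightarrow> ('s, 'n) module" and \<delta> :: "'e \<Rightarrow> 'i" and \<rho> :: "'e \<Rightarrow> 's \<Rightarrow> 'r"
  assumes finite_E: "finite E"
    and corner: "\<And>x. x \<in> E \<Longrightarrow> peirce_corner K R M N I \<epsilon> T (R' x) (M' x) (N' x) (\<delta> x) (\<rho> x)"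
    and \<delta>_inj: "inj_on \<delta> E"
    and M_vanish: "\<And>c m. c \<in> T \<Longrightarrow> c \<notin> \<delta> ` E \<Longrightarrow> m \<in> carrier M \<Longrightarrow> rsmult M m (\<epsilon> c) = \<zero>\<^bsub>M\<^esub>"
begin

abbreviation "B' x \<equiv> resolution_basis (R' x) (N' x)"
abbreviation "CC' x n \<equiv> copower (B' x n) (underlying_module (M' x))"
abbreviation "DD' x n \<equiv>
  right_module_over.tensor_map (R' x) (M' x) (B' x n) (resolution_diff (R' x) (N' x) n)"
abbreviation "push' x \<equiv> peirce_corner.push R M (R' x) (N' x) (\<rho> x)"

lemma \<delta>_T: "x \<in> E \<Longrightarrow> \<delta> x \<in> T"
  by (rule peirce_corner.\<delta>[OF corner])

lemma \<delta>_I: "x \<in> E \<Longrightarrow> \<delta> x \<in> I"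
  using \<delta>_T T_subset by blast

lemma push_mem: "x \<in> E \<Longrightarrow> y \<in> carrier (CC' x n) \<Longrightarrow> push' x n y c \<in> carrier M"
  by (rule copower_mem'[OF peirce_corner.push_closed[OF corner]])

lemma push_sum_apply:
  assumes "\<And>x. x \<in> E \<Longrightarrow> y x \<in> carrier (CC' x n)"
  shows "(\<Oplus>\<^bsub>CC n\<^esub>x\<in>E. push' x n (y x)) c = (\<Oplus>\<^bsub>M\<^esub>x\<in>E. push' x n (y x) c)"
proof -
  have "additive_map (CC n) M (\<lambda>y. y c)"
    using additive_apply[OF underlying_abelian_group, of "B n" c] by (simp add: additive_map_def)
  from additive_map_finsum[OF CC_abelian K.M.abelian_group_axioms this finite_E
      peirce_corner.push_closed[OF corner assms]]
  show ?thesis by simp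
qed

lemma push_sum_tensor_P:
  assumes "\<And>x. x \<in> E \<Longrightarrow> y x \<in> carrier (CC' x n)"
  shows "(\<Oplus>\<^bsub>CC n\<^esub>x\<in>E. push' x n (y x)) \<in> PS.tensor_P n"
  by (rule submodule_finsum[OF PS.tensor_P_submodule CC_abelian finite_E
        peirce_corner.push_tensor_P[OF corner assms]])

text \<open>Right multiplication by \<open>\<epsilon> (\<delta> x)\<close> isolates the summand of
  \<open>x\<close>: \<open>\<delta>\<close> is injective, so different corners have orthogonal
  idempotents.\<close>

lemma push_sum_zero:
  assumes y: "\<And>x. x \<in> E \<Longrightarrow> y x \<in> carrier (CC' x n)"
    and zero: "(\<Oplus>\<^bsub>CC n\<^esub>x\<in>E. push' x n (y x)) = \<zero>\<^bsub>CC n\<^esub>" and x: "x \<in> E"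
  shows "y x = \<zero>\<^bsub>CC' x n\<^esub>"
proof (rule peirce_corner.push_eq_zero[OF corner[OF x] y[OF x]])
  fix c
  have orth: "rsmult M (push' x' n (y x') c) (\<epsilon> (\<delta> x)) = (if x = x' then push' x' n (y x') c else \<zero>\<^bsub>M\<^esub>)"
    if x': "x' \<in> E" for x'
  proof (cases "x = x'")
    case True
    then show ?thesis using peirce_corner.push_fixed[OF corner[OF x] y[OF x]] by simp
  next
    case False
    then have ne: "\<delta> x' \<noteq> \<delta> x" using \<delta>_inj x x' by (auto simp: inj_on_def)
    have "rsmult M (push' x' n (y x') c) (\<epsilon> (\<delta> x))
        = rsmult M (rsmult M (push' x' n (y x') c) (\<epsilon> (\<delta> x'))) (\<epsilon> (\<delta> x))"
      using peirce_corner.push_fixed[OF corner[OF x'] y[OF x']] by simp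
    also have "\<dots> = rsmult M (push' x' n (y x') c) (\<epsilon> (\<delta> x') \<otimes>\<^bsub>R\<^esub> \<epsilon> (\<delta> x))"
      using push_mem[OF x' y[OF x']] \<delta>_I x x' by (simp add: rsmult_assoc)
    also have "\<dots> = \<zero>\<^bsub>M\<^esub>"
      using push_mem[OF x' y[OF x']] \<epsilon>_orth[OF \<delta>_I[OF x'] \<delta>_I[OF x] ne] by simp
    finally show ?thesis using False by simp
  qed
  have "(\<Oplus>\<^bsub>M\<^esub>x'\<in>E. push' x' n (y x') c) = \<zero>\<^bsub>M\<^esub>"
    using push_sum_apply[of y n c, OF y, symmetric] by (simp add: zero) (simp add: zero_direct_sum)
  then have "\<zero>\<^bsub>M\<^esub> = rsmult M (\<Oplus>\<^bsub>M\<^esub>x'\<in>E. push' x' n (y x') c) (\<epsilon> (\<delta> x))"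
    using \<delta>_I[OF x] by simp
  also have "\<dots> = (\<Oplus>\<^bsub>M\<^esub>x'\<in>E. rsmult M (push' x' n (y x') c) (\<epsilon> (\<delta> x)))"
    using push_mem y
    by (intro additive_map_finsum[OF K.M.abelian_group_axioms K.M.abelian_group_axioms
          additive_rsmult_left[OF \<epsilon>_closed[OF \<delta>_I[OF x]]] finite_E]) auto
  also have "\<dots> = (\<Oplus>\<^bsub>M\<^esub>x'\<in>E. if x = x' then push' x' n (y x') c else \<zero>\<^bsub>M\<^esub>)"
    using push_mem y by (intro K.M.finsum_cong') (auto simp: orth)
  also have "\<dots> = push' x n (y x) c"
    using push_mem y x finite_E by (intro K.M.finsum_singleton) auto
  finally show "push' x n (y x) c = \<zero>\<^bsub>M\<^esub>" by simp
qed

text \<open>Each value \<open>p c\<close> is fixed by \<open>esum (idx n c)\<close> and so expands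
  over \<open>idx n c\<close>. \<open>M_vanish\<close> removes the indices outside the range of
  \<open>\<delta>\<close>, and the surviving terms are the components supplied by
  \<open>ex_push\<close>.\<close>

lemma ex_push_sum:
  assumes p: "p \<in> PS.tensor_P n"
  shows "\<exists>y. (\<forall>x\<in>E. y x \<in> carrier (CC' x n)) \<and> p = (\<Oplus>\<^bsub>CC n\<^esub>x\<in>E. push' x n (y x))"
proof -
  have pC: "p \<in> carrier (CC n)" by (rule PS.tensor_P_closed[OF p])
  have pM: "p c \<in> carrier M" for c by (rule copower_mem'[OF pC])
  have pe: "rsmult M (p c) (triangular_idem n c) = p c" for c
    using p pC triangular_idem_closed by (cases "c \<in> B n") (auto simp: PS.tensor_P_def carrier_direct_sum)
  have "\<forall>x\<in>E. \<exists>y\<in>carrier (CC' x n).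
      \<forall>c. push' x n y c = (if \<delta> x \<in> idx n c then rsmult M (p c) (\<epsilon> (\<delta> x)) else \<zero>\<^bsub>M\<^esub>)"
    using peirce_corner.ex_push[OF corner pC] by blast
  then obtain y where y: "\<And>x. x \<in> E \<Longrightarrow> y x \<in> carrier (CC' x n)"
    and push: "\<And>x c. x \<in> E \<Longrightarrow> push' x n (y x) c = (if \<delta> x \<in> idx n c then rsmult M (p c) (\<epsilon> (\<delta> x)) else \<zero>\<^bsub>M\<^esub>)"
    by metis
  have "p c = (\<Oplus>\<^bsub>CC n\<^esub>x\<in>E. push' x n (y x)) c" for c
  proof -
    let ?J = "{x \<in> E. \<delta> x \<in> idx n c}"
    have fin: "finite (idx n c)" using idx_I finite_I finite_subset by blast
    have cl: "rsmult M (p c) (\<epsilon> i) \<in> carrier M" if "i \<in> I" for i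
      using that pM by simp
    have "p c = rsmult M (p c) (esum (idx n c))"
      using pe[of c] by (simp add: triangular_idem_eq)
    also have "\<dots> = (\<Oplus>\<^bsub>M\<^esub>i\<in>idx n c. rsmult M (p c) (\<epsilon> i))"
      unfolding esum_def using idx_I[of n c]
      by (intro additive_map_finsum[OF R.is_abelian_group K.M.abelian_group_axioms additive_rsmult_right[OF pM] fin]) auto
    also have "\<dots> = (\<Oplus>\<^bsub>M\<^esub>i\<in>\<delta> ` ?J. rsmult M (p c) (\<epsilon> i))"
      using M_vanish[OF _ _ pM[of c]] idx_T[of n c] idx_I[of n c] cl fin
      by (intro K.M.add.finprod_mono_neutral_cong_right) auto
    also have "\<dots> = (\<Oplus>\<^bsub>M\<^esub>x\<in>?J. rsmult M (p c) (\<epsilon> (\<delta> x)))"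
      using cl \<delta>_I by (intro K.M.finsum_reindex inj_on_subset[OF \<delta>_inj]) auto
    also have "\<dots> = (\<Oplus>\<^bsub>M\<^esub>x\<in>E. push' x n (y x) c)"
      using cl \<delta>_I finite_E push by (intro K.M.add.finprod_mono_neutral_cong_left) auto
    also have "\<dots> = (\<Oplus>\<^bsub>CC n\<^esub>x\<in>E. push' x n (y x)) c"
      by (rule push_sum_apply[OF y, symmetric])
    finally show ?thesis .
  qed
  then show ?thesis using y by (intro exI[of _ y]) auto
qed

lemma DD_push_sum:
  assumes y: "\<And>x. x \<in> E \<Longrightarrow> y x \<in> carrier (CC' x (Suc n))"
  shows "DD n (\<Oplus>\<^bsub>CC (Suc n)\<^esub>x\<in>E. push' x (Suc n) (y x)) = (\<Oplus>\<^bsub>CC n\<^esub>x\<in>E. push' x n (DD' x n (y x)))"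
proof -
  interpret C: abelian_group "CC n" by (rule CC_abelian)
  have "DD n (\<Oplus>\<^bsub>CC (Suc n)\<^esub>x\<in>E. push' x (Suc n) (y x)) = (\<Oplus>\<^bsub>CC n\<^esub>x\<in>E. DD n (push' x (Suc n) (y x)))"
    using peirce_corner.push_closed[OF corner y]
    by (intro additive_map_finsum[OF CC_abelian CC_abelian linear_map_additive[OF DD_linear] finite_E])
  also have "\<dots> = (\<Oplus>\<^bsub>CC n\<^esub>x\<in>E. push' x n (DD' x n (y x)))"
  proof (rule C.finsum_cong'[OF refl])
    have "DD' x n (y x) \<in> carrier (CC' x n)" if "x \<in> E" for x
      by (rule linear_map_closed[OF tor_setup.DD_linear[OF peirce_corner.axioms(2)[OF corner[OF that]]] y[OF that]])
    then show "(\<lambda>x. push' x n (DD' x n (y x))) \<in> E \<rightarrow> carrier (CC n)"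
      using peirce_corner.push_closed[OF corner] by blast
    show "DD n (push' x (Suc n) (y x)) = push' x n (DD' x n (y x))" if "x \<in> E" for x
      by (rule peirce_corner.DD_push[OF corner[OF that] y[OF that]])
  qed
  finally show ?thesis .
qed

lemma tor: "x \<in> E \<Longrightarrow> tor_setup K (R' x) (M' x) (N' x)"
  by (rule peirce_corner.axioms(2)[OF corner])

lemma CC'_abelian: "x \<in> E \<Longrightarrow> abelian_group (CC' x n)"
  by (rule tor_setup.CC_abelian[OF tor])

lemma DD'_closed: "x \<in> E \<Longrightarrow> y \<in> carrier (CC' x (Suc n)) \<Longrightarrow> DD' x n y \<in> carrier (CC' x n)"
  by (rule linear_map_closed[OF tor_setup.DD_linear[OF tor]])

lemma push_closed: "x \<in> E \<Longrightarrow> y \<in> carrier (CC' x n) \<Longrightarrow> push' x n y \<in> carrier (CC n)"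
  by (rule peirce_corner.push_closed[OF corner])

lemma push_sum_inj:
  assumes y: "\<And>x. x \<in> E \<Longrightarrow> y x \<in> carrier (CC' x n)" and z: "\<And>x. x \<in> E \<Longrightarrow> z x \<in> carrier (CC' x n)"
    and eq: "(\<Oplus>\<^bsub>CC n\<^esub>x\<in>E. push' x n (y x)) = (\<Oplus>\<^bsub>CC n\<^esub>x\<in>E. push' x n (z x))" and x: "x \<in> E"
  shows "y x = z x"
proof -
  interpret C: abelian_group "CC n" by (rule CC_abelian)
  have c: "y x \<ominus>\<^bsub>CC' x n\<^esub> z x \<in> carrier (CC' x n)" if "x \<in> E" for x
    using abelian_group.minus_closed[OF CC'_abelian y z] that by blast
  have "(\<Oplus>\<^bsub>CC n\<^esub>x\<in>E. push' x n (y x \<ominus>\<^bsub>CC' x n\<^esub> z x)) = (\<Oplus>\<^bsub>CC n\<^esub>x\<in>E. push' x n (y x) \<ominus>\<^bsub>CC n\<^esub> push' x n (z x))"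
    using push_closed y z
      additive_map_minus[OF CC'_abelian CC_abelian linear_map_additive[OF peirce_corner.push_linear[OF corner]]]
    by (intro C.finsum_cong') auto
  also have "\<dots> = \<zero>\<^bsub>CC n\<^esub>"
    using push_closed y z by (subst C.finsum_minus[OF finite_E]) (auto simp: eq)
  finally have "y x \<ominus>\<^bsub>CC' x n\<^esub> z x = \<zero>\<^bsub>CC' x n\<^esub>"
    using push_sum_zero[of "\<lambda>x. y x \<ominus>\<^bsub>CC' x n\<^esub> z x", OF c _ x] by simp
  then show ?thesis
    using abelian_group.minus_eq_zero_iff[OF CC'_abelian[OF x] y[OF x] z[OF x]] by simp
qed

section \<open>From coordinates back to cycles and boundaries of Tor\<close>

abbreviation "TC' x n \<equiv> Tor_complex K (R' x) (M' x) (N' x) n"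
abbreviation "TD' x n \<equiv> Tor_diff K (R' x) (M' x) (N' x) n"
abbreviation "\<theta>' x n \<equiv> right_module_over.free_tensor_map K (M' x) (B' x n)"
abbreviation "cycles n \<equiv> Tor_cycles K R M N n"
abbreviation "cycles' x n \<equiv> Tor_cycles K (R' x) (M' x) (N' x) n"
abbreviation "boundaries n \<equiv> TD n ` carrier (TC (Suc n))"
abbreviation "boundaries' x n \<equiv> TD' x n ` carrier (TC' x (Suc n))"

text \<open>\<open>push\<close> read between the Tor complexes themselves, through the coordinate
  isomorphisms on both sides.\<close>

definition cycle_map :: "nat \<Rightarrow> 'e \<Rightarrow> ('m \<times> (('s, 'n) cell \<Rightarrow> 's) \<Rightarrow> 'k) set \<Rightarrow>
    ('m \<times> (('r, 'n) cell \<Rightarrow> 'r) \<Rightarrow> 'k) set" where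
  "cycle_map n x X = the_inv_into (carrier (TC n)) (\<theta> n) (push' x n (\<theta>' x n X))"

lemma cycle'_D:
  assumes x: "x \<in> E" and X: "X \<in> carrier (cycles' x n)"
  shows "X \<in> carrier (TC' x n)" "\<theta>' x n X \<in> carrier (CC' x n)"
    "n = Suc j \<Longrightarrow> DD' x j (\<theta>' x n X) = \<zero>\<^bsub>CC' x j\<^esub>"
  using X tor_setup.mem_Tor_cycles[OF tor[OF x]] tor_setup.cycle_def[OF tor[OF x]] by auto

lemma
  assumes x: "x \<in> E" and X: "X \<in> carrier (cycles' x n)"
  shows \<theta>_cycle_map: "\<theta> n (cycle_map n x X) = push' x n (\<theta>' x n X)"
    and cycle_map_closed: "cycle_map n x X \<in> carrier (cycles n)"
proof -
  have p: "push' x n (\<theta>' x n X) \<in> \<theta> n ` carrier (TC n)"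
    using \<theta>_bij[of n] push_closed[OF x cycle'_D(2)[OF x X]] by (simp add: bij_betw_def)
  have inj: "inj_on (\<theta> n) (carrier (TC n))"
    using \<theta>_bij by (rule bij_betw_imp_inj_on)
  show \<theta>: "\<theta> n (cycle_map n x X) = push' x n (\<theta>' x n X)"
    unfolding cycle_map_def by (rule f_the_inv_into_f[OF inj p])
  have "cycle n (push' x n (\<theta>' x n X))"
    unfolding cycle_def
  proof (intro conjI allI impI push_closed[OF x cycle'_D(2)[OF x X]])
    fix j assume n: "n = Suc j"
    have "DD j (push' x n (\<theta>' x n X)) = push' x j (DD' x j (\<theta>' x n X))"
      using peirce_corner.DD_push[OF corner[OF x], of "\<theta>' x n X" j] cycle'_D(2)[OF x X] n by simp
    also have "\<dots> = push' x j \<zero>\<^bsub>CC' x j\<^esub>"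
      by (simp add: cycle'_D(3)[OF x X n])
    also have "\<dots> = \<zero>\<^bsub>CC j\<^esub>"
      by (rule additive_map_zero[OF CC'_abelian[OF x] CC_abelian
            linear_map_additive[OF peirce_corner.push_linear[OF corner[OF x]]]])
    finally show "DD j (push' x n (\<theta>' x n X)) = \<zero>\<^bsub>CC j\<^esub>" .
  qed
  then show "cycle_map n x X \<in> carrier (cycles n)"
    unfolding mem_Tor_cycles \<theta> unfolding cycle_map_def
    using the_inv_into_into[OF inj p subset_refl] by simp
qed

lemma cycle_map_eqI:
  assumes x: "x \<in> E" and X: "X \<in> carrier (cycles' x n)" and Y: "Y \<in> carrier (cycles n)"
    and "\<theta> n Y = push' x n (\<theta>' x n X)"
  shows "cycle_map n x X = Y"
proof -
  have "cycle_map n x X \<in> carrier (TC n)" "Y \<in> carrier (TC n)"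
    using cycle_map_closed[OF x X] Y by (auto simp: mem_Tor_cycles)
  then show ?thesis
    using inj_onD[OF bij_betw_imp_inj_on[OF \<theta>_bij[of n]]] \<theta>_cycle_map[OF x X] assms(4) by metis
qed

lemma cycle_map_linear:
  assumes x: "x \<in> E"
  shows "linear_map K (cycles' x n) (cycles n) (cycle_map n x)"
proof (rule linear_mapI)
  interpret Z: left_module K "cycles n" by (rule Tor_cycles_left_module)
  interpret Z': left_module K "cycles' x n" by (rule tor_setup.Tor_cycles_left_module[OF tor[OF x]])
  note \<theta> = \<theta>_cycles_linear[of n] and \<theta>' = tor_setup.\<theta>_cycles_linear[OF tor[OF x], of n]
    and push = peirce_corner.push_linear[OF corner[OF x], of n]
  fix X assume X: "X \<in> carrier (cycles' x n)"
  show "cycle_map n x X \<in> carrier (cycles n)" by (rule cycle_map_closed[OF x X])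
  show "cycle_map n x (k \<odot>\<^bsub>cycles' x n\<^esub> X) = k \<odot>\<^bsub>cycles n\<^esub> cycle_map n x X" if "k \<in> carrier K" for k
    using that X
    by (intro cycle_map_eqI[OF x])
      (simp_all add: cycle_map_closed[OF x] linear_map_smult[OF \<theta>] linear_map_smult[OF \<theta>']
        linear_map_smult[OF push] cycle'_D(2)[OF x] \<theta>_cycle_map[OF x])
  fix Y assume Y: "Y \<in> carrier (cycles' x n)"
  show "cycle_map n x (X \<oplus>\<^bsub>cycles' x n\<^esub> Y) = cycle_map n x X \<oplus>\<^bsub>cycles n\<^esub> cycle_map n x Y"
    using X Y
    by (intro cycle_map_eqI[OF x])
      (simp_all add: cycle_map_closed[OF x] linear_map_add[OF \<theta>] linear_map_add[OF \<theta>']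
        linear_map_add[OF push] cycle'_D(2)[OF x] \<theta>_cycle_map[OF x])
qed

lemma \<theta>_sum:
  assumes "\<And>x. x \<in> E \<Longrightarrow> Y x \<in> carrier (cycles' x n)"
  shows "\<theta> n (\<Oplus>\<^bsub>cycles n\<^esub>x\<in>E. cycle_map n x (Y x)) = (\<Oplus>\<^bsub>CC n\<^esub>x\<in>E. push' x n (\<theta>' x n (Y x)))"
proof -
  interpret Z: left_module K "cycles n" by (rule Tor_cycles_left_module)
  interpret C: abelian_group "CC n" by (rule CC_abelian)
  have "\<theta> n (\<Oplus>\<^bsub>cycles n\<^esub>x\<in>E. cycle_map n x (Y x)) = (\<Oplus>\<^bsub>CC n\<^esub>x\<in>E. \<theta> n (cycle_map n x (Y x)))"
    by (rule additive_map_finsum[OF Z.M.abelian_group_axioms CC_abelian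
          linear_map_additive[OF \<theta>_cycles_linear] finite_E cycle_map_closed[OF _ assms]])
  also have "\<dots> = (\<Oplus>\<^bsub>CC n\<^esub>x\<in>E. push' x n (\<theta>' x n (Y x)))"
    using assms push_closed cycle'_D(2) by (intro C.finsum_cong') (auto simp: \<theta>_cycle_map)
  finally show ?thesis .
qed

text \<open>In coordinates the sum lies in \<open>M \<otimes> P\<close>, so by
  \<open>tensor_P_injective\<close> it bounds there. Splitting the bounding chain over the corners
  and comparing summands exhibits each \<open>Y x\<close> as a boundary.\<close>

lemma cycle_map_injective:
  assumes Y: "\<And>x. x \<in> E \<Longrightarrow> Y x \<in> carrier (cycles' x n)"
    and b: "(\<Oplus>\<^bsub>cycles n\<^esub>x\<in>E. cycle_map n x (Y x)) \<in> boundaries n" and x: "x \<in> E"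
  shows "Y x \<in> boundaries' x n"
proof -
  let ?s = "\<Oplus>\<^bsub>CC n\<^esub>x\<in>E. push' x n (\<theta>' x n (Y x))"
  obtain w where w: "w \<in> carrier (CC (Suc n))" "?s = DD n w"
    using b \<theta>_sum[OF Y] unfolding mem_boundaries by auto
  have "?s \<in> PS.tensor_P n"
    by (rule push_sum_tensor_P[OF cycle'_D(2)[OF _ Y]])
  then obtain p where p: "p \<in> PS.tensor_P (Suc n)" "DD n p = ?s"
    using PS.tensor_P_injective[OF w(1)] w(2) by auto
  obtain z where z: "\<And>x. x \<in> E \<Longrightarrow> z x \<in> carrier (CC' x (Suc n))"
    and pz: "p = (\<Oplus>\<^bsub>CC (Suc n)\<^esub>x\<in>E. push' x (Suc n) (z x))"
    using ex_push_sum[OF p(1)] by blast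
  have "?s = (\<Oplus>\<^bsub>CC n\<^esub>x\<in>E. push' x n (DD' x n (z x)))"
    using p(2) DD_push_sum[OF z] pz by simp
  then have "\<theta>' x n (Y x) = DD' x n (z x)"
    by (intro push_sum_inj[of "\<lambda>x. \<theta>' x n (Y x)" n "\<lambda>x. DD' x n (z x)"])
      (simp_all add: cycle'_D(2)[OF _ Y] DD'_closed z x)
  then show ?thesis
    unfolding tor_setup.mem_boundaries[OF tor[OF x]] using cycle'_D(1)[OF x Y[OF x]] z[OF x] by blast
qed

lemma cycle_map_boundary:
  assumes x: "x \<in> E" and Y: "Y \<in> boundaries' x n"
  shows "cycle_map n x Y \<in> boundaries n"
proof -
  obtain w where w: "w \<in> carrier (CC' x (Suc n))" "\<theta>' x n Y = DD' x n w"
    using Y unfolding tor_setup.mem_boundaries[OF tor[OF x]] by blast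
  have Yc: "Y \<in> carrier (cycles' x n)"
    using submodule_subset[OF module_quotient.submodule[OF tor_setup.Tor_quotient[OF tor[OF x]]]] Y by blast
  have "\<theta> n (cycle_map n x Y) = DD n (push' x (Suc n) w)"
    unfolding \<theta>_cycle_map[OF x Yc] w(2) by (rule peirce_corner.DD_push[OF corner[OF x] w(1), symmetric])
  then show ?thesis
    unfolding mem_boundaries
    using cycle_map_closed[OF x Yc] push_closed[OF x w(1)] by (auto simp: mem_Tor_cycles)
qed

text \<open>A cycle is homologous to an element of \<open>M \<otimes> P\<close>, which splits over
  the corners; it remains to see that its components are cycles.\<close>

lemma cycle_map_surjective:
  assumes z: "z \<in> carrier (cycles n)"
  shows "\<exists>Y. (\<forall>x\<in>E. Y x \<in> carrier (cycles' x n)) \<and>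
    z \<ominus>\<^bsub>cycles n\<^esub> (\<Oplus>\<^bsub>cycles n\<^esub>x\<in>E. cycle_map n x (Y x)) \<in> boundaries n"
proof -
  interpret Z: left_module K "cycles n" by (rule Tor_cycles_left_module)
  interpret C: abelian_group "CC n" by (rule CC_abelian)
  have zc: "\<theta> n z \<in> carrier (CC n)" and Dz: "DD j (\<theta> n z) = \<zero>\<^bsub>CC j\<^esub>" if "n = Suc j" for j
    using z that by (auto simp: mem_Tor_cycles cycle_def)
  have zC: "\<theta> n z \<in> carrier (CC n)" using z by (auto simp: mem_Tor_cycles cycle_def)
  obtain p w where p: "p \<in> PS.tensor_P n" and w: "w \<in> carrier (CC (Suc n))" "\<theta> n z \<ominus>\<^bsub>CC n\<^esub> p = DD n w"
    using PS.tensor_P_surjective[OF zC Dz] by blast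
  have pC: "p \<in> carrier (CC n)" by (rule PS.tensor_P_closed[OF p])
  obtain y where y: "\<And>x. x \<in> E \<Longrightarrow> y x \<in> carrier (CC' x n)"
    and py: "p = (\<Oplus>\<^bsub>CC n\<^esub>x\<in>E. push' x n (y x))"
    using ex_push_sum[OF p] by blast
  \<comment> \<open>\<open>p\<close> has the same differential as the cycle
    \<open>\<theta> n z\<close>, namely zero, and a sum over the corners vanishes only summand by
    summand.\<close>
  have Dy: "DD' x j (y x) = \<zero>\<^bsub>CC' x j\<^esub>" if n: "n = Suc j" and x: "x \<in> E" for x j
  proof (rule push_sum_zero[where y = "\<lambda>x. DD' x j (y x)", OF _ _ x])
    interpret Cj: abelian_group "CC j" by (rule CC_abelian)
    show c: "DD' x j (y x) \<in> carrier (CC' x j)" if "x \<in> E" for x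
      using DD'_closed y that n by simp
    have pC': "p \<in> carrier (CC (Suc j))" and zC': "\<theta> n z \<in> carrier (CC (Suc j))" using pC zC n by simp_all
    have "DD j (\<theta> n z \<ominus>\<^bsub>CC (Suc j)\<^esub> p) = DD j (\<theta> n z) \<ominus>\<^bsub>CC j\<^esub> DD j p"
      by (rule additive_map_minus[OF CC_abelian CC_abelian linear_map_additive[OF DD_linear] zC' pC'])
    moreover have "DD j (\<theta> n z \<ominus>\<^bsub>CC (Suc j)\<^esub> p) = \<zero>\<^bsub>CC j\<^esub>"
      using w n DD_DD[of w j] by simp
    ultimately have "DD j (\<theta> n z) = DD j p"
      using Cj.minus_eq_zero_iff linear_map_closed[OF DD_linear zC'] linear_map_closed[OF DD_linear pC'] by metis
    then have "DD j p = \<zero>\<^bsub>CC j\<^esub>" using Dz[OF n] by simp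
    then show "(\<Oplus>\<^bsub>CC j\<^esub>x\<in>E. push' x j (DD' x j (y x))) = \<zero>\<^bsub>CC j\<^esub>"
      using DD_push_sum[of y j] y py n by simp
  qed
  have "\<forall>x\<in>E. \<exists>Y\<in>carrier (cycles' x n). \<theta>' x n Y = y x"
  proof
    fix x assume x: "x \<in> E"
    have "y x \<in> \<theta>' x n ` carrier (TC' x n)"
      using tor_setup.\<theta>_bij[OF tor[OF x], of n] y[OF x] by (simp add: bij_betw_def)
    then obtain Y where Y: "Y \<in> carrier (TC' x n)" "\<theta>' x n Y = y x" by auto
    then have "Y \<in> carrier (cycles' x n)"
      unfolding tor_setup.mem_Tor_cycles[OF tor[OF x]] tor_setup.cycle_def[OF tor[OF x]] Y(2)
      using Y(1) y[OF x] Dy[OF _ x] by blast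
    then show "\<exists>Y\<in>carrier (cycles' x n). \<theta>' x n Y = y x" using Y(2) by blast
  qed
  then obtain Y where Y: "\<And>x. x \<in> E \<Longrightarrow> Y x \<in> carrier (cycles' x n)"
    and \<theta>Y: "\<And>x. x \<in> E \<Longrightarrow> \<theta>' x n (Y x) = y x"
    by metis
  let ?S = "\<Oplus>\<^bsub>cycles n\<^esub>x\<in>E. cycle_map n x (Y x)"
  have S: "?S \<in> carrier (cycles n)"
    using cycle_map_closed Y by (intro Z.M.finsum_closed) auto
  have "\<theta> n ?S = (\<Oplus>\<^bsub>CC n\<^esub>x\<in>E. push' x n (\<theta>' x n (Y x)))"
    by (rule \<theta>_sum[OF Y])
  also have "\<dots> = p"
    unfolding py using push_closed y by (intro C.finsum_cong') (auto simp: \<theta>Y)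
  finally have "\<theta> n (z \<ominus>\<^bsub>cycles n\<^esub> ?S) = DD n w"
    using additive_map_minus[OF Z.M.abelian_group_axioms CC_abelian linear_map_additive[OF \<theta>_cycles_linear] z S] w(2)
    by simp
  moreover have "z \<ominus>\<^bsub>cycles n\<^esub> ?S \<in> carrier (TC n)"
    using Z.M.minus_closed[OF z S] by (simp add: mem_Tor_cycles)
  ultimately have "z \<ominus>\<^bsub>cycles n\<^esub> ?S \<in> boundaries n"
    unfolding mem_boundaries using w(1) by blast
  then show ?thesis using Y by blast
qed

theorem Tor_isomorphic_direct_sum:
  "module_isomorphic K (Tor K R M N n) (direct_sum E (\<lambda>x. Tor K (R' x) (M' x) (N' x) n))"
  unfolding Tor_def
proof (rule quotient_isomorphic_direct_sum[where g = "cycle_map n", OF finite_E Tor_quotient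
        tor_setup.Tor_quotient[OF tor] cycle_map_linear])
  show "Y x \<in> boundaries' x n"
    if "\<And>x. x \<in> E \<Longrightarrow> Y x \<in> carrier (cycles' x n)"
      "(\<Oplus>\<^bsub>cycles n\<^esub>x\<in>E. cycle_map n x (Y x)) \<in> boundaries n" "x \<in> E" for Y x
    by (rule cycle_map_injective[OF that])
  show "cycle_map n x Y \<in> boundaries n" if "x \<in> E" "Y \<in> boundaries' x n" for x Y
    by (rule cycle_map_boundary[OF that])
  show "\<exists>Y. (\<forall>x\<in>E. Y x \<in> carrier (cycles' x n)) \<and>
      z \<ominus>\<^bsub>cycles n\<^esub> (\<Oplus>\<^bsub>cycles n\<^esub>x\<in>E. cycle_map n x (Y x)) \<in> boundaries n"
    if "z \<in> carrier (cycles n)" for z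
    by (rule cycle_map_surjective[OF that])
qed

end

section \<open>The enveloping algebra\<close>

lemma scalar_right_module_simps [simp]:
  "carrier (scalar_right_module A) = carrier A" "zero (scalar_right_module A) = zero A"
  "add (scalar_right_module A) = add A" "smult (scalar_right_module A) = smult A"
  "rsmult (scalar_right_module A) = (\<lambda>m c. c \<odot>\<^bsub>A\<^esub> m)"
  by (simp_all add: scalar_right_module_def module.defs)

lemma opposite_simps [simp]:
  "carrier (opposite A) = carrier A" "zero (opposite A) = zero A" "one (opposite A) = one A"
  "add (opposite A) = add A" "smult (opposite A) = smult A"
  "x \<otimes>\<^bsub>opposite A\<^esub> y = y \<otimes>\<^bsub>A\<^esub> x"
  by (simp_all add: opposite_def)

lemma env_left_module_simps [simp]:
  "carrier (env_left_module K A) = carrier A" "zero (env_left_module K A) = zero A"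
  "add (env_left_module K A) = add A"
  by (simp_all add: env_left_module_def)

lemma env_right_module_simps [simp]:
  "carrier (env_right_module K A) = carrier A" "zero (env_right_module K A) = zero A"
  "add (env_right_module K A) = add A" "smult (env_right_module K A) = smult A"
  by (simp_all add: env_right_module_def module.defs)

lemma left_module_cong:
  fixes M :: "('r, 'm, 'y) module_scheme" and M' :: "('r, 'm, 'z) module_scheme"
  assumes "left_module R M" "carrier M' = carrier M" "zero M' = zero M" "add M' = add M"
    "smult M' = smult M"
  shows "left_module R M'"
proof -
  interpret M: left_module R M by fact
  show ?thesis
  proof (intro left_moduleI abelian_groupI)
    show "\<exists>y\<in>carrier M'. y \<oplus>\<^bsub>M'\<^esub> x = \<zero>\<^bsub>M'\<^esub>" if "x \<in> carrier M'" for x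
      using that M.M.l_neg assms(2-) by (intro bexI[of _ "\<ominus>\<^bsub>M\<^esub> x"]) auto
  qed (auto simp: assms(2-) M.M.a_ac M.smult_l_distr M.smult_r_distr M.smult_assoc M.ring_axioms)
qed

locale algebra_env = K: cring K + A: ring A + AM: left_module K A
  for K :: "('k, 'x) ring_scheme" and A :: "('k, 'a) module" +
  assumes smult_mult_left:
      "\<lbrakk>c \<in> carrier K; x \<in> carrier A; y \<in> carrier A\<rbrakk> \<Longrightarrow> (c \<odot>\<^bsub>A\<^esub> x) \<otimes>\<^bsub>A\<^esub> y = c \<odot>\<^bsub>A\<^esub> (x \<otimes>\<^bsub>A\<^esub> y)"
    and smult_mult_right:
      "\<lbrakk>c \<in> carrier K; x \<in> carrier A; y \<in> carrier A\<rbrakk> \<Longrightarrow> x \<otimes>\<^bsub>A\<^esub> (c \<odot>\<^bsub>A\<^esub> y) = c \<odot>\<^bsub>A\<^esub> (x \<otimes>\<^bsub>A\<^esub> y)"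

lemma assoc_algebra_imp_algebra_env: "assoc_algebra K A \<Longrightarrow> algebra_env K A"
  unfolding assoc_algebra_def assoc_algebra_axioms_def algebra_env_def algebra_env_axioms_def
  by (simp add: module_imp_left_module) (simp add: module_def)

context algebra_env
begin

lemma opposite_left_module: "left_module K (opposite A)"
  by (rule left_module_cong[OF AM.left_module]) simp_all

lemma scalar_right_module_over: "right_module_over K K (scalar_right_module A)"
proof (intro right_module_over.intro right_module_over_axioms.intro)
  show "left_module K (scalar_right_module A)"
    by (rule left_module_cong[OF AM.left_module]) simp_all
  show "ring K" by (rule K.ring_axioms)
qed (auto simp: AM.smult_l_distr AM.smult_r_distr AM.smult_assoc[symmetric] K.m_comm)

sublocale TP: tensor_product K K "scalar_right_module A" "opposite A"
  by (intro tensor_product.intro scalar_right_module_over opposite_left_module)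

abbreviation "Te \<equiv> tensor K K (scalar_right_module A) (opposite A)"
abbreviation "t \<equiv> pure_tensor K K (scalar_right_module A) (opposite A)"
abbreviation "Re \<equiv> enveloping_algebra K A"

lemma t_closed: "a \<in> carrier A \<Longrightarrow> b \<in> carrier A \<Longrightarrow> t a b \<in> carrier Te"
  using TP.pure_closed by simp

lemma t_add_left: "a \<in> carrier A \<Longrightarrow> a' \<in> carrier A \<Longrightarrow> b \<in> carrier A \<Longrightarrow>
    t (a \<oplus>\<^bsub>A\<^esub> a') b = t a b \<oplus>\<^bsub>Te\<^esub> t a' b"
  using TP.pure_add_left by simp

lemma t_add_right: "a \<in> carrier A \<Longrightarrow> b \<in> carrier A \<Longrightarrow> b' \<in> carrier A \<Longrightarrow>
    t a (b \<oplus>\<^bsub>A\<^esub> b') = t a b \<oplus>\<^bsub>Te\<^esub> t a b'"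
  using TP.pure_add_right by simp

lemma t_smult: "c \<in> carrier K \<Longrightarrow> a \<in> carrier A \<Longrightarrow> b \<in> carrier A \<Longrightarrow> t (c \<odot>\<^bsub>A\<^esub> a) b = c \<odot>\<^bsub>Te\<^esub> t a b"
  using TP.pure_smult by simp

lemma t_smult_right: "c \<in> carrier K \<Longrightarrow> a \<in> carrier A \<Longrightarrow> b \<in> carrier A \<Longrightarrow> t a (c \<odot>\<^bsub>A\<^esub> b) = c \<odot>\<^bsub>Te\<^esub> t a b"
  using TP.pure_rsmult[of a c b] t_smult by simp

lemma Te_abelian: "abelian_group Te"
  by (rule TP.T.M.abelian_group_axioms)

lemma additive_t_left: "b \<in> carrier A \<Longrightarrow> additive_map A Te (\<lambda>a. t a b)"
  by (intro additive_mapI t_closed t_add_left)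

lemma additive_t_right: "a \<in> carrier A \<Longrightarrow> additive_map A Te (t a)"
  by (intro additive_mapI t_closed t_add_right)

lemma t_zero_left: "b \<in> carrier A \<Longrightarrow> t \<zero>\<^bsub>A\<^esub> b = \<zero>\<^bsub>Te\<^esub>"
  by (rule additive_map_zero[OF A.is_abelian_group Te_abelian additive_t_left])

lemma t_zero_right: "a \<in> carrier A \<Longrightarrow> t a \<zero>\<^bsub>A\<^esub> = \<zero>\<^bsub>Te\<^esub>"
  by (rule additive_map_zero[OF A.is_abelian_group Te_abelian additive_t_right])

lemma additive_Te_eq:
  assumes "abelian_group G" "additive_map Te G h" "additive_map Te G h'"
    and "\<And>a b. a \<in> carrier A \<Longrightarrow> b \<in> carrier A \<Longrightarrow> h (t a b) = h' (t a b)"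
    and "X \<in> carrier Te"
  shows "h X = h' X"
  using TP.additive_tensor_eq[OF assms(1-3) _ assms(5)] assms(4) by simp

definition bilinear :: "('k, 't, 'z) module_scheme \<Rightarrow> ('a \<Rightarrow> 'a \<Rightarrow> 't) \<Rightarrow> bool" where
  "bilinear L \<phi> \<longleftrightarrow> balanced K K (scalar_right_module A) (opposite A) L \<phi>"

lemma bilinearI:
  assumes "\<And>a b. \<lbrakk>a \<in> carrier A; b \<in> carrier A\<rbrakk> \<Longrightarrow> \<phi> a b \<in> carrier L"
    and "\<And>a a' b. \<lbrakk>a \<in> carrier A; a' \<in> carrier A; b \<in> carrier A\<rbrakk> \<Longrightarrow>
      \<phi> (a \<oplus>\<^bsub>A\<^esub> a') b = \<phi> a b \<oplus>\<^bsub>L\<^esub> \<phi> a' b"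
    and "\<And>a b b'. \<lbrakk>a \<in> carrier A; b \<in> carrier A; b' \<in> carrier A\<rbrakk> \<Longrightarrow>
      \<phi> a (b \<oplus>\<^bsub>A\<^esub> b') = \<phi> a b \<oplus>\<^bsub>L\<^esub> \<phi> a b'"
    and "\<And>c a b. \<lbrakk>c \<in> carrier K; a \<in> carrier A; b \<in> carrier A\<rbrakk> \<Longrightarrow> \<phi> (c \<odot>\<^bsub>A\<^esub> a) b = c \<odot>\<^bsub>L\<^esub> \<phi> a b"
    and "\<And>c a b. \<lbrakk>c \<in> carrier K; a \<in> carrier A; b \<in> carrier A\<rbrakk> \<Longrightarrow> \<phi> a (c \<odot>\<^bsub>A\<^esub> b) = c \<odot>\<^bsub>L\<^esub> \<phi> a b"
  shows "bilinear L \<phi>"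
  unfolding bilinear_def using assms by (intro balancedI) simp_all

lemma lift_t:
  "left_module K L \<Longrightarrow> bilinear L \<phi> \<Longrightarrow> a \<in> carrier A \<Longrightarrow> b \<in> carrier A \<Longrightarrow>
    tensor_lift K L (\<lambda>(a, b). \<phi> a b) (t a b) = \<phi> a b"
  unfolding bilinear_def by (rule TP.tensor_lift_pure) simp_all

lemma lift_linear:
  "left_module K L \<Longrightarrow> bilinear L \<phi> \<Longrightarrow> linear_map K Te L (tensor_lift K L (\<lambda>(a, b). \<phi> a b))"
  unfolding bilinear_def by (rule TP.tensor_lift_linear)

lemmas lift_additive = linear_map_additive[OF lift_linear]

section \<open>Multiplication in the enveloping algebra\<close>

lemma Re_simps [simp]:
  "carrier Re = carrier Te" "zero Re = zero Te" "add Re = add Te" "smult Re = smult Te"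
  "one Re = t \<one>\<^bsub>A\<^esub> \<one>\<^bsub>A\<^esub>"
  by (simp_all add: enveloping_algebra_def tensor_algebra_def Let_def)

text \<open>Left multiplication by \<open>a \<otimes> b\<close>, the inner lift in the definition of
  the product. The second factors multiply in the opposite order.\<close>

definition mult_pure :: "'a \<Rightarrow> 'a \<Rightarrow> ('a \<times> 'a \<Rightarrow> 'k) set \<Rightarrow> ('a \<times> 'a \<Rightarrow> 'k) set" where
  "mult_pure a b Y = tensor_lift K Te (\<lambda>(a', b'). t (a \<otimes>\<^bsub>A\<^esub> a') (b' \<otimes>\<^bsub>A\<^esub> b)) Y"

lemma mult_Re: "X \<otimes>\<^bsub>Re\<^esub> Y = tensor_lift K Te (\<lambda>(a, b). mult_pure a b Y) X"
  by (simp add: enveloping_algebra_def tensor_algebra_def Let_def mult_pure_def)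

lemma mult_pure_bilinear:
  "a \<in> carrier A \<Longrightarrow> b \<in> carrier A \<Longrightarrow> bilinear Te (\<lambda>a' b'. t (a \<otimes>\<^bsub>A\<^esub> a') (b' \<otimes>\<^bsub>A\<^esub> b))"
  by (intro bilinearI) (simp_all add: t_closed t_add_left t_add_right t_smult t_smult_right A.r_distr
      A.l_distr smult_mult_left smult_mult_right)

lemma mult_pure_linear: "a \<in> carrier A \<Longrightarrow> b \<in> carrier A \<Longrightarrow> linear_map K Te Te (mult_pure a b)"
  unfolding mult_pure_def by (rule lift_linear[OF TP.T.left_module mult_pure_bilinear])

lemma mult_pure_t:
  "\<lbrakk>a \<in> carrier A; b \<in> carrier A; a' \<in> carrier A; b' \<in> carrier A\<rbrakk> \<Longrightarrow>
    mult_pure a b (t a' b') = t (a \<otimes>\<^bsub>A\<^esub> a') (b' \<otimes>\<^bsub>A\<^esub> b)"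
  unfolding mult_pure_def by (rule lift_t[OF TP.T.left_module mult_pure_bilinear])

text \<open>This is what the outer lift of the product requires. For fixed \<open>a\<close> and
  \<open>b\<close> each identity compares additive maps in \<open>Y\<close>, so it is enough to take
  \<open>Y\<close> a pure tensor.\<close>

lemma mult_bilinear:
  assumes Y: "Y \<in> carrier Te"
  shows "bilinear Te (\<lambda>a b. mult_pure a b Y)"
proof (rule bilinearI)
  note lin = mult_pure_linear and add = linear_map_additive[OF mult_pure_linear]
  have sm: "additive_map Te Te (\<lambda>Y. c \<odot>\<^bsub>Te\<^esub> f Y)" if "additive_map Te Te f" "c \<in> carrier K" for c f
    by (rule additive_map_comp[OF that(1) TP.T.additive_smult_right[OF that(2)]])
  show "mult_pure a b Y \<in> carrier Te" if "a \<in> carrier A" "b \<in> carrier A" for a b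
    by (rule linear_map_closed[OF lin[OF that] Y])
  show "mult_pure (a \<oplus>\<^bsub>A\<^esub> a') b Y = mult_pure a b Y \<oplus>\<^bsub>Te\<^esub> mult_pure a' b Y"
    if "a \<in> carrier A" "a' \<in> carrier A" "b \<in> carrier A" for a a' b
    by (rule additive_Te_eq[OF Te_abelian add additive_map_sum[OF Te_abelian add add] _ Y])
      (use that in \<open>simp_all add: mult_pure_t A.l_distr t_add_left\<close>)
  show "mult_pure a (b \<oplus>\<^bsub>A\<^esub> b') Y = mult_pure a b Y \<oplus>\<^bsub>Te\<^esub> mult_pure a b' Y"
    if "a \<in> carrier A" "b \<in> carrier A" "b' \<in> carrier A" for a b b'
    by (rule additive_Te_eq[OF Te_abelian add additive_map_sum[OF Te_abelian add add] _ Y])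
      (use that in \<open>simp_all add: mult_pure_t A.r_distr t_add_right\<close>)
  show "mult_pure (c \<odot>\<^bsub>A\<^esub> a) b Y = c \<odot>\<^bsub>Te\<^esub> mult_pure a b Y"
    if "c \<in> carrier K" "a \<in> carrier A" "b \<in> carrier A" for c a b
    by (rule additive_Te_eq[OF Te_abelian add sm[OF add] _ Y])
      (use that in \<open>simp_all add: mult_pure_t smult_mult_left t_smult\<close>)
  show "mult_pure a (c \<odot>\<^bsub>A\<^esub> b) Y = c \<odot>\<^bsub>Te\<^esub> mult_pure a b Y"
    if "c \<in> carrier K" "a \<in> carrier A" "b \<in> carrier A" for c a b
    by (rule additive_Te_eq[OF Te_abelian add sm[OF add] _ Y])
      (use that in \<open>simp_all add: mult_pure_t smult_mult_right t_smult_right\<close>)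
qed

lemma mult_t_left: "a \<in> carrier A \<Longrightarrow> b \<in> carrier A \<Longrightarrow> Y \<in> carrier Te \<Longrightarrow> t a b \<otimes>\<^bsub>Re\<^esub> Y = mult_pure a b Y"
  unfolding mult_Re by (rule lift_t[OF TP.T.left_module mult_bilinear])

lemma mult_t:
  "\<lbrakk>a \<in> carrier A; b \<in> carrier A; a' \<in> carrier A; b' \<in> carrier A\<rbrakk> \<Longrightarrow>
    t a b \<otimes>\<^bsub>Re\<^esub> t a' b' = t (a \<otimes>\<^bsub>A\<^esub> a') (b' \<otimes>\<^bsub>A\<^esub> b)"
  by (simp add: mult_t_left t_closed mult_pure_t)

lemma additive_mult_left: "Y \<in> carrier Te \<Longrightarrow> additive_map Te Te (\<lambda>X. X \<otimes>\<^bsub>Re\<^esub> Y)"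
  unfolding mult_Re by (rule lift_additive[OF TP.T.left_module mult_bilinear])

lemma additive_mult_right:
  assumes X: "X \<in> carrier Te"
  shows "additive_map Te Te (\<lambda>Y. X \<otimes>\<^bsub>Re\<^esub> Y)"
proof (rule additive_mapI)
  fix Y assume Y: "Y \<in> carrier Te"
  show "X \<otimes>\<^bsub>Re\<^esub> Y \<in> carrier Te" by (rule additive_map_closed[OF additive_mult_left[OF Y] X])
  fix Z assume Z: "Z \<in> carrier Te"
  have YZ: "Y \<oplus>\<^bsub>Te\<^esub> Z \<in> carrier Te" using Y Z by simp
  show "X \<otimes>\<^bsub>Re\<^esub> (Y \<oplus>\<^bsub>Te\<^esub> Z) = X \<otimes>\<^bsub>Re\<^esub> Y \<oplus>\<^bsub>Te\<^esub> X \<otimes>\<^bsub>Re\<^esub> Z"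
    by (rule additive_Te_eq[OF Te_abelian additive_mult_left[OF YZ]
          additive_map_sum[OF Te_abelian additive_mult_left[OF Y] additive_mult_left[OF Z]] _ X])
      (use Y Z YZ in \<open>simp_all add: mult_t_left linear_map_add[OF mult_pure_linear]\<close>)
qed

lemma Re_abelian: "abelian_group Re"
  by (rule left_module.axioms(2)[OF left_module_cong[OF TP.T.left_module]]) simp_all

lemma mult_closed: "X \<in> carrier Te \<Longrightarrow> Y \<in> carrier Te \<Longrightarrow> X \<otimes>\<^bsub>Re\<^esub> Y \<in> carrier Te"
  by (rule additive_map_closed[OF additive_mult_right])

text \<open>The product is additive in each argument, so associativity reduces to pure tensors one
  argument at a time, beginning with the last.\<close>

lemma Re_ring: "ring Re"
proof (rule ringI)
  show "abelian_group Re" by (rule Re_abelian)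
  show "monoid Re"
  proof (rule monoidI)
    fix X Y Z assume XYZ: "X \<in> carrier Re" "Y \<in> carrier Re" "Z \<in> carrier Re"
    then have X: "X \<in> carrier Te" and Y: "Y \<in> carrier Te" and Z: "Z \<in> carrier Te" by simp_all
    note l = additive_mult_left and r = additive_mult_right and c = additive_map_comp
    have 1: "t a b \<otimes>\<^bsub>Re\<^esub> t a' b' \<otimes>\<^bsub>Re\<^esub> Z = t a b \<otimes>\<^bsub>Re\<^esub> (t a' b' \<otimes>\<^bsub>Re\<^esub> Z)"
      if "a \<in> carrier A" "b \<in> carrier A" "a' \<in> carrier A" "b' \<in> carrier A" for a b a' b'
      by (rule additive_Te_eq[OF Te_abelian r c[OF r r] _ Z])
        (use that in \<open>simp_all add: t_closed mult_closed mult_t A.m_assoc\<close>)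
    have 2: "t a b \<otimes>\<^bsub>Re\<^esub> Y \<otimes>\<^bsub>Re\<^esub> Z = t a b \<otimes>\<^bsub>Re\<^esub> (Y \<otimes>\<^bsub>Re\<^esub> Z)"
      if "a \<in> carrier A" "b \<in> carrier A" for a b
      by (rule additive_Te_eq[OF Te_abelian c[OF r l] c[OF l r] _ Y])
        (use that Z in \<open>simp_all add: t_closed 1\<close>)
    show "X \<otimes>\<^bsub>Re\<^esub> Y \<otimes>\<^bsub>Re\<^esub> Z = X \<otimes>\<^bsub>Re\<^esub> (Y \<otimes>\<^bsub>Re\<^esub> Z)"
      by (rule additive_Te_eq[OF Te_abelian c[OF l l] l _ X])
        (use Y Z in \<open>simp_all add: mult_closed 2\<close>)
  next
    fix X assume "X \<in> carrier Re"
    then have X: "X \<in> carrier Te" by simp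
    have id: "additive_map Te Te (\<lambda>X. X)" by (rule additive_mapI) simp_all
    have o: "t \<one>\<^bsub>A\<^esub> \<one>\<^bsub>A\<^esub> \<in> carrier Te" by (simp add: t_closed)
    show "\<one>\<^bsub>Re\<^esub> \<otimes>\<^bsub>Re\<^esub> X = X" unfolding Re_simps
      by (rule additive_Te_eq[OF Te_abelian additive_mult_right[OF o] id _ X]) (simp add: mult_t)
    show "X \<otimes>\<^bsub>Re\<^esub> \<one>\<^bsub>Re\<^esub> = X" unfolding Re_simps
      by (rule additive_Te_eq[OF Te_abelian additive_mult_left[OF o] id _ X]) (simp add: mult_t)
  qed (simp_all add: mult_closed t_closed)
qed (simp_all add: additive_map_add[OF additive_mult_left] additive_map_add[OF additive_mult_right])

sublocale Re: ring Re
  by (rule Re_ring)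

section \<open>The algebra as a left and a right module over its enveloping algebra\<close>

lemma env_left_bilinear: "x \<in> carrier A \<Longrightarrow> bilinear A (\<lambda>a b. a \<otimes>\<^bsub>A\<^esub> x \<otimes>\<^bsub>A\<^esub> b)"
  by (intro bilinearI) (simp_all add: A.l_distr A.r_distr smult_mult_left smult_mult_right)

lemma env_right_bilinear: "x \<in> carrier A \<Longrightarrow> bilinear A (\<lambda>a b. b \<otimes>\<^bsub>A\<^esub> x \<otimes>\<^bsub>A\<^esub> a)"
  by (intro bilinearI) (simp_all add: A.l_distr A.r_distr smult_mult_left smult_mult_right)

abbreviation "Nl \<equiv> env_left_module K A"
abbreviation "Mr \<equiv> env_right_module K A"

lemma smult_env_left: "X \<odot>\<^bsub>Nl\<^esub> x = tensor_lift K A (\<lambda>(a, b). a \<otimes>\<^bsub>A\<^esub> x \<otimes>\<^bsub>A\<^esub> b) X"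
  by (simp add: env_left_module_def)

lemma rsmult_env_right: "rsmult Mr x X = tensor_lift K A (\<lambda>(a, b). b \<otimes>\<^bsub>A\<^esub> x \<otimes>\<^bsub>A\<^esub> a) X"
  by (simp add: env_right_module_def module.defs)

lemma smult_t: "\<lbrakk>a \<in> carrier A; b \<in> carrier A; x \<in> carrier A\<rbrakk> \<Longrightarrow> t a b \<odot>\<^bsub>Nl\<^esub> x = a \<otimes>\<^bsub>A\<^esub> x \<otimes>\<^bsub>A\<^esub> b"
  unfolding smult_env_left by (rule lift_t[OF AM.left_module env_left_bilinear])

lemma rsmult_t: "\<lbrakk>a \<in> carrier A; b \<in> carrier A; x \<in> carrier A\<rbrakk> \<Longrightarrow> rsmult Mr x (t a b) = b \<otimes>\<^bsub>A\<^esub> x \<otimes>\<^bsub>A\<^esub> a"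
  unfolding rsmult_env_right by (rule lift_t[OF AM.left_module env_right_bilinear])

lemma additive_smult_env: "x \<in> carrier A \<Longrightarrow> additive_map Te A (\<lambda>X. X \<odot>\<^bsub>Nl\<^esub> x)"
  unfolding smult_env_left by (rule lift_additive[OF AM.left_module env_left_bilinear])

lemma additive_rsmult_env: "x \<in> carrier A \<Longrightarrow> additive_map Te A (\<lambda>X. rsmult Mr x X)"
  unfolding rsmult_env_right by (rule lift_additive[OF AM.left_module env_right_bilinear])

lemma additive_smult_env_right:
  assumes X: "X \<in> carrier Te"
  shows "additive_map A A (\<lambda>x. X \<odot>\<^bsub>Nl\<^esub> x)"
proof (rule additive_mapI)
  fix x y assume xy: "x \<in> carrier A" "y \<in> carrier A"
  show "X \<odot>\<^bsub>Nl\<^esub> x \<in> carrier A" by (rule additive_map_closed[OF additive_smult_env[OF xy(1)] X])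
  show "X \<odot>\<^bsub>Nl\<^esub> (x \<oplus>\<^bsub>A\<^esub> y) = X \<odot>\<^bsub>Nl\<^esub> x \<oplus>\<^bsub>A\<^esub> X \<odot>\<^bsub>Nl\<^esub> y"
    by (rule additive_Te_eq[OF A.is_abelian_group additive_smult_env
          additive_map_sum[OF A.is_abelian_group additive_smult_env additive_smult_env] _ X])
      (use xy in \<open>simp_all add: smult_t A.l_distr A.r_distr\<close>)
qed

lemma additive_rsmult_env_left:
  assumes X: "X \<in> carrier Te"
  shows "additive_map A A (\<lambda>x. rsmult Mr x X)"
proof (rule additive_mapI)
  fix x y assume xy: "x \<in> carrier A" "y \<in> carrier A"
  show "rsmult Mr (x \<oplus>\<^bsub>A\<^esub> y) X = rsmult Mr x X \<oplus>\<^bsub>A\<^esub> rsmult Mr y X"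
    by (rule additive_Te_eq[OF A.is_abelian_group additive_rsmult_env
          additive_map_sum[OF A.is_abelian_group additive_rsmult_env additive_rsmult_env] _ X])
      (use xy in \<open>simp_all add: rsmult_t A.l_distr A.r_distr\<close>)
qed (rule additive_map_closed[OF additive_rsmult_env X])

lemma env_left: "left_module Re Nl"
proof (rule left_moduleI)
  show "ring Re" by (rule Re_ring)
  show "abelian_group Nl"
  proof (rule abelian_groupI)
    show "\<exists>y\<in>carrier Nl. y \<oplus>\<^bsub>Nl\<^esub> x = \<zero>\<^bsub>Nl\<^esub>" if "x \<in> carrier Nl" for x
      using that A.l_neg by auto
  qed (auto simp: A.a_ac)
  show "\<one>\<^bsub>Re\<^esub> \<odot>\<^bsub>Nl\<^esub> x = x" if "x \<in> carrier Nl" for x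
    using that by (simp add: smult_t)
  fix X Y x assume "X \<in> carrier Re" "Y \<in> carrier Re" "x \<in> carrier Nl"
  then have X: "X \<in> carrier Te" and Y: "Y \<in> carrier Te" and x: "x \<in> carrier A" by simp_all
  note l = additive_mult_left and r = additive_mult_right and c = additive_map_comp
    and s = additive_smult_env and sr = additive_smult_env_right
  have "t a b \<otimes>\<^bsub>Re\<^esub> Y \<odot>\<^bsub>Nl\<^esub> x = t a b \<odot>\<^bsub>Nl\<^esub> (Y \<odot>\<^bsub>Nl\<^esub> x)" if "a \<in> carrier A" "b \<in> carrier A" for a b
    by (rule additive_Te_eq[OF A.is_abelian_group c[OF r s] c[OF s sr] _ Y])
      (use that x in \<open>simp_all add: t_closed mult_t smult_t A.m_assoc\<close>)
  then show "X \<otimes>\<^bsub>Re\<^esub> Y \<odot>\<^bsub>Nl\<^esub> x = X \<odot>\<^bsub>Nl\<^esub> (Y \<odot>\<^bsub>Nl\<^esub> x)"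
    using additive_map_closed[OF s[OF x] Y]
    by (intro additive_Te_eq[OF A.is_abelian_group c[OF l s] s _ X]) (simp_all add: Y x)
qed (simp_all add: additive_map_closed[OF additive_smult_env] additive_map_add[OF additive_smult_env]
    additive_map_add[OF additive_smult_env_right])

lemma env_right: "right_module_over K Re Mr"
proof (intro right_module_over.intro right_module_over_axioms.intro)
  show "left_module K Mr"
    by (rule left_module_cong[OF AM.left_module]) simp_all
  show "ring Re" by (rule Re_ring)
  show "rsmult Mr x \<one>\<^bsub>Re\<^esub> = x" if "x \<in> carrier Mr" for x
    using that by (simp add: rsmult_t)
  note l = additive_mult_left and r = additive_mult_right and c = additive_map_comp
    and s = additive_rsmult_env and sr = additive_rsmult_env_left
  show "rsmult Mr x (X \<otimes>\<^bsub>Re\<^esub> Y) = rsmult Mr (rsmult Mr x X) Y"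
    if "x \<in> carrier Mr" "X \<in> carrier Re" "Y \<in> carrier Re" for x X Y
  proof -
    have X: "X \<in> carrier Te" and Y: "Y \<in> carrier Te" and x: "x \<in> carrier A" using that by simp_all
    have "rsmult Mr x (t a b \<otimes>\<^bsub>Re\<^esub> Y) = rsmult Mr (rsmult Mr x (t a b)) Y"
      if "a \<in> carrier A" "b \<in> carrier A" for a b
      by (rule additive_Te_eq[OF A.is_abelian_group c[OF r s] s _ Y])
        (use that x in \<open>simp_all add: t_closed mult_t rsmult_t A.m_assoc\<close>)
    then show ?thesis
      by (intro additive_Te_eq[OF A.is_abelian_group c[OF l s] c[OF s sr] _ X]) (simp_all add: Y x)
  qed
  show "rsmult Mr (k \<odot>\<^bsub>Mr\<^esub> x) X = k \<odot>\<^bsub>Mr\<^esub> rsmult Mr x X"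
    if "k \<in> carrier K" "x \<in> carrier Mr" "X \<in> carrier Re" for k x X
  proof -
    have X: "X \<in> carrier Te" and x: "x \<in> carrier A" using that by simp_all
    show ?thesis
      using additive_Te_eq[OF A.is_abelian_group s[of "k \<odot>\<^bsub>A\<^esub> x"] c[OF s[OF x] AM.additive_smult_right[OF that(1)]] _ X]
        that(1) x by (simp add: rsmult_t smult_mult_left smult_mult_right)
  qed
qed (simp_all add: additive_map_closed[OF additive_rsmult_env] additive_map_add[OF additive_rsmult_env]
    additive_map_add[OF additive_rsmult_env_left])

lemma tor_setup_env: "tor_setup K Re Mr Nl"
  by (intro tor_setup.intro module_resolution.intro env_right env_left)

end

section \<open>Peirce decomposition of Hochschild homology\<close>

lemma corner_simps [simp]:
  "mult (corner A x) = mult A" "one (corner A x) = x" "zero (corner A x) = zero A"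
  "add (corner A x) = add A" "smult (corner A x) = smult A"
  by (simp_all add: corner_def)

context algebra_env
begin

context
  fixes x
  assumes x: "x \<in> carrier A" "x \<otimes>\<^bsub>A\<^esub> x = x"
begin

lemma mem_corner:
  "a \<in> carrier (corner A x) \<longleftrightarrow> a \<in> carrier A \<and> x \<otimes>\<^bsub>A\<^esub> a = a \<and> a \<otimes>\<^bsub>A\<^esub> x = a"
proof
  assume "a \<in> carrier (corner A x)"
  then obtain b where b: "b \<in> carrier A" "a = x \<otimes>\<^bsub>A\<^esub> b \<otimes>\<^bsub>A\<^esub> x" by (auto simp: corner_def)
  have "x \<otimes>\<^bsub>A\<^esub> (x \<otimes>\<^bsub>A\<^esub> c) = x \<otimes>\<^bsub>A\<^esub> c" if "c \<in> carrier A" for c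
    using that x by (simp add: A.m_assoc[symmetric])
  then show "a \<in> carrier A \<and> x \<otimes>\<^bsub>A\<^esub> a = a \<and> a \<otimes>\<^bsub>A\<^esub> x = a"
    using b x by (simp add: A.m_assoc)
next
  assume "a \<in> carrier A \<and> x \<otimes>\<^bsub>A\<^esub> a = a \<and> a \<otimes>\<^bsub>A\<^esub> x = a"
  then show "a \<in> carrier (corner A x)" by (auto simp: corner_def intro!: exI[of _ a])
qed

lemma corner_submodule: "submodule (carrier (corner A x)) K A"
proof (rule AM.submoduleI)
  fix a b assume "a \<in> carrier (corner A x)" "b \<in> carrier (corner A x)"
  then show "a \<oplus>\<^bsub>A\<^esub> b \<in> carrier (corner A x)"
    using x by (auto simp: mem_corner A.l_distr A.r_distr)
next
  fix c a assume "c \<in> carrier K" "a \<in> carrier (corner A x)"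
  then show "c \<odot>\<^bsub>A\<^esub> a \<in> carrier (corner A x)"
    using x by (auto simp: mem_corner smult_mult_left smult_mult_right)
qed (use x in \<open>auto simp: mem_corner\<close>)

lemma corner_algebra_env: "algebra_env K (corner A x)"
proof (intro algebra_env.intro algebra_env_axioms.intro)
  show lm: "left_module K (corner A x)"
    by (rule left_module_cong[OF submodule_left_module[OF corner_submodule AM.left_module]]) simp_all
  show "ring (corner A x)"
  proof (rule ringI)
    show "abelian_group (corner A x)" by (rule left_module.axioms(2)[OF lm])
    show "monoid (corner A x)"
    proof (rule monoidI)
      fix a b assume "a \<in> carrier (corner A x)" "b \<in> carrier (corner A x)"
      then have a: "a \<in> carrier A" "x \<otimes>\<^bsub>A\<^esub> a = a" and b: "b \<in> carrier A" "b \<otimes>\<^bsub>A\<^esub> x = b"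
        by (auto simp: mem_corner)
      have "x \<otimes>\<^bsub>A\<^esub> (a \<otimes>\<^bsub>A\<^esub> b) = a \<otimes>\<^bsub>A\<^esub> b"
        using a b x by (simp add: A.m_assoc[symmetric])
      then show "a \<otimes>\<^bsub>corner A x\<^esub> b \<in> carrier (corner A x)"
        using a b x by (simp add: mem_corner A.m_assoc)
    qed (use x in \<open>auto simp: mem_corner A.m_assoc\<close>)
  qed (auto simp: mem_corner A.l_distr A.r_distr)
qed (auto simp: K.is_cring mem_corner smult_mult_left smult_mult_right)

section \<open>The enveloping algebra of a corner as a corner of the enveloping algebra\<close>

interpretation X: algebra_env K "corner A x"
  by (rule corner_algebra_env)

text \<open>Induced by the inclusion of the corner in both factors. It sends the unit to the
  idempotent \<open>t x x\<close>, not to the unit of \<open>Re\<close>.\<close>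

definition embed :: "('a \<times> 'a \<Rightarrow> 'k) set \<Rightarrow> ('a \<times> 'a \<Rightarrow> 'k) set" where
  "embed = tensor_lift K Te (\<lambda>(a, b). t a b)"

lemma embed_bilinear: "X.bilinear Te t"
  by (rule X.bilinearI) (simp_all add: mem_corner t_closed t_add_left t_add_right t_smult t_smult_right)

lemma embed_t: "a \<in> carrier (corner A x) \<Longrightarrow> b \<in> carrier (corner A x) \<Longrightarrow> embed (X.t a b) = t a b"
  unfolding embed_def by (rule X.lift_t[OF TP.T.left_module embed_bilinear])

lemma embed_additive: "additive_map X.Te Te embed"
  unfolding embed_def by (rule X.lift_additive[OF TP.T.left_module embed_bilinear])

lemma embed_closed: "X \<in> carrier X.Te \<Longrightarrow> embed X \<in> carrier Te"
  by (rule additive_map_closed[OF embed_additive])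

lemma corner_mult_closed: "a \<in> carrier A \<Longrightarrow> x \<otimes>\<^bsub>A\<^esub> a \<otimes>\<^bsub>A\<^esub> x \<in> carrier (corner A x)"
  by (auto simp: corner_def)

text \<open>
  A tensor product of submodules need not embed into the tensor product of the modules; here it
  does because \<open>retract\<close> splits \<open>embed\<close>.
\<close>

definition retract :: "('a \<times> 'a \<Rightarrow> 'k) set \<Rightarrow> ('a \<times> 'a \<Rightarrow> 'k) set" where
  "retract = tensor_lift K X.Te (\<lambda>(a, b). X.t (x \<otimes>\<^bsub>A\<^esub> a \<otimes>\<^bsub>A\<^esub> x) (x \<otimes>\<^bsub>A\<^esub> b \<otimes>\<^bsub>A\<^esub> x))"

lemma retract_bilinear: "bilinear X.Te (\<lambda>a b. X.t (x \<otimes>\<^bsub>A\<^esub> a \<otimes>\<^bsub>A\<^esub> x) (x \<otimes>\<^bsub>A\<^esub> b \<otimes>\<^bsub>A\<^esub> x))"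
proof (rule bilinearI)
  note [simp] = corner_mult_closed
  fix a b assume [simp]: "a \<in> carrier A" "b \<in> carrier A"
  show "X.t (x \<otimes>\<^bsub>A\<^esub> a \<otimes>\<^bsub>A\<^esub> x) (x \<otimes>\<^bsub>A\<^esub> b \<otimes>\<^bsub>A\<^esub> x) \<in> carrier X.Te"
    by (simp add: X.t_closed)
  show "X.t (x \<otimes>\<^bsub>A\<^esub> (c \<odot>\<^bsub>A\<^esub> a) \<otimes>\<^bsub>A\<^esub> x) (x \<otimes>\<^bsub>A\<^esub> b \<otimes>\<^bsub>A\<^esub> x)
      = c \<odot>\<^bsub>X.Te\<^esub> X.t (x \<otimes>\<^bsub>A\<^esub> a \<otimes>\<^bsub>A\<^esub> x) (x \<otimes>\<^bsub>A\<^esub> b \<otimes>\<^bsub>A\<^esub> x)" if "c \<in> carrier K" for c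
    using that x X.t_smult[of c "x \<otimes>\<^bsub>A\<^esub> a \<otimes>\<^bsub>A\<^esub> x" "x \<otimes>\<^bsub>A\<^esub> b \<otimes>\<^bsub>A\<^esub> x"]
    by (simp add: smult_mult_left smult_mult_right)
  show "X.t (x \<otimes>\<^bsub>A\<^esub> a \<otimes>\<^bsub>A\<^esub> x) (x \<otimes>\<^bsub>A\<^esub> (c \<odot>\<^bsub>A\<^esub> b) \<otimes>\<^bsub>A\<^esub> x)
      = c \<odot>\<^bsub>X.Te\<^esub> X.t (x \<otimes>\<^bsub>A\<^esub> a \<otimes>\<^bsub>A\<^esub> x) (x \<otimes>\<^bsub>A\<^esub> b \<otimes>\<^bsub>A\<^esub> x)" if "c \<in> carrier K" for c
    using that x X.t_smult_right[of c "x \<otimes>\<^bsub>A\<^esub> a \<otimes>\<^bsub>A\<^esub> x" "x \<otimes>\<^bsub>A\<^esub> b \<otimes>\<^bsub>A\<^esub> x"]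
    by (simp add: smult_mult_left smult_mult_right)
  fix a' assume [simp]: "a' \<in> carrier A"
  show "X.t (x \<otimes>\<^bsub>A\<^esub> (a \<oplus>\<^bsub>A\<^esub> a') \<otimes>\<^bsub>A\<^esub> x) (x \<otimes>\<^bsub>A\<^esub> b \<otimes>\<^bsub>A\<^esub> x)
      = X.t (x \<otimes>\<^bsub>A\<^esub> a \<otimes>\<^bsub>A\<^esub> x) (x \<otimes>\<^bsub>A\<^esub> b \<otimes>\<^bsub>A\<^esub> x) \<oplus>\<^bsub>X.Te\<^esub> X.t (x \<otimes>\<^bsub>A\<^esub> a' \<otimes>\<^bsub>A\<^esub> x) (x \<otimes>\<^bsub>A\<^esub> b \<otimes>\<^bsub>A\<^esub> x)"
    using x X.t_add_left[of "x \<otimes>\<^bsub>A\<^esub> a \<otimes>\<^bsub>A\<^esub> x" "x \<otimes>\<^bsub>A\<^esub> a' \<otimes>\<^bsub>A\<^esub> x" "x \<otimes>\<^bsub>A\<^esub> b \<otimes>\<^bsub>A\<^esub> x"]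
    by (simp add: A.l_distr A.r_distr)
  show "X.t (x \<otimes>\<^bsub>A\<^esub> a \<otimes>\<^bsub>A\<^esub> x) (x \<otimes>\<^bsub>A\<^esub> (b \<oplus>\<^bsub>A\<^esub> a') \<otimes>\<^bsub>A\<^esub> x)
      = X.t (x \<otimes>\<^bsub>A\<^esub> a \<otimes>\<^bsub>A\<^esub> x) (x \<otimes>\<^bsub>A\<^esub> b \<otimes>\<^bsub>A\<^esub> x) \<oplus>\<^bsub>X.Te\<^esub> X.t (x \<otimes>\<^bsub>A\<^esub> a \<otimes>\<^bsub>A\<^esub> x) (x \<otimes>\<^bsub>A\<^esub> a' \<otimes>\<^bsub>A\<^esub> x)"
    using x X.t_add_right[of "x \<otimes>\<^bsub>A\<^esub> a \<otimes>\<^bsub>A\<^esub> x" "x \<otimes>\<^bsub>A\<^esub> b \<otimes>\<^bsub>A\<^esub> x" "x \<otimes>\<^bsub>A\<^esub> a' \<otimes>\<^bsub>A\<^esub> x"]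
    by (simp add: A.l_distr A.r_distr)
qed

lemma retract_t:
  "a \<in> carrier A \<Longrightarrow> b \<in> carrier A \<Longrightarrow> retract (t a b) = X.t (x \<otimes>\<^bsub>A\<^esub> a \<otimes>\<^bsub>A\<^esub> x) (x \<otimes>\<^bsub>A\<^esub> b \<otimes>\<^bsub>A\<^esub> x)"
  unfolding retract_def by (rule lift_t[OF X.TP.T.left_module retract_bilinear])

lemma retract_additive: "additive_map Te X.Te retract"
  unfolding retract_def by (rule lift_additive[OF X.TP.T.left_module retract_bilinear])

lemma retract_embed:
  assumes X: "X \<in> carrier X.Te"
  shows "retract (embed X) = X"
proof (rule X.additive_Te_eq[OF X.Te_abelian _ _ _ X])
  show "additive_map X.Te X.Te (\<lambda>X. retract (embed X))"
    by (rule additive_map_comp[OF embed_additive retract_additive])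
  show "additive_map X.Te X.Te (\<lambda>X. X)" by (rule additive_mapI) simp_all
qed (simp add: embed_t, simp add: mem_corner retract_t)

text \<open>On a pure tensor the reversed order in the second factor also gives
  \<open>x b x\<close>, since \<open>t x x\<close> acts from both sides. The elements fixed by
  \<open>t x x\<close> on both sides are therefore in the range of \<open>embed\<close>.\<close>

lemma embed_retract:
  assumes X: "X \<in> carrier Te"
  shows "embed (retract X) = t x x \<otimes>\<^bsub>Re\<^esub> X \<otimes>\<^bsub>Re\<^esub> t x x"
proof (rule additive_Te_eq[OF Te_abelian _ _ _ X])
  have tx: "t x x \<in> carrier Te" using x by (simp add: t_closed)
  show "additive_map Te Te (\<lambda>X. embed (retract X))"
    by (rule additive_map_comp[OF retract_additive embed_additive])
  show "additive_map Te Te (\<lambda>X. t x x \<otimes>\<^bsub>Re\<^esub> X \<otimes>\<^bsub>Re\<^esub> t x x)"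
    by (rule additive_map_comp[OF additive_mult_right[OF tx] additive_mult_left[OF tx]])
  show "embed (retract (t a b)) = t x x \<otimes>\<^bsub>Re\<^esub> t a b \<otimes>\<^bsub>Re\<^esub> t x x"
    if ab: "a \<in> carrier A" "b \<in> carrier A" for a b
  proof -
    have "embed (retract (t a b)) = t (x \<otimes>\<^bsub>A\<^esub> a \<otimes>\<^bsub>A\<^esub> x) (x \<otimes>\<^bsub>A\<^esub> b \<otimes>\<^bsub>A\<^esub> x)"
      using ab by (simp add: retract_t embed_t corner_mult_closed)
    then show ?thesis using ab x by (simp add: mult_t A.m_assoc)
  qed
qed

lemma embed_mult:
  assumes X: "X \<in> carrier X.Te" and Y: "Y \<in> carrier X.Te"
  shows "embed (X \<otimes>\<^bsub>X.Re\<^esub> Y) = embed X \<otimes>\<^bsub>Re\<^esub> embed Y"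
proof -
  note c = additive_map_comp
  have "embed (X.t a b \<otimes>\<^bsub>X.Re\<^esub> Y) = embed (X.t a b) \<otimes>\<^bsub>Re\<^esub> embed Y"
    if ab: "a \<in> carrier (corner A x)" "b \<in> carrier (corner A x)" for a b
  proof (rule X.additive_Te_eq[OF Te_abelian
        c[OF X.additive_mult_right embed_additive] c[OF embed_additive additive_mult_right] _ Y])
    fix a' b' assume ab': "a' \<in> carrier (corner A x)" "b' \<in> carrier (corner A x)"
    have "a \<otimes>\<^bsub>A\<^esub> a' \<in> carrier (corner A x)" "b' \<otimes>\<^bsub>A\<^esub> b \<in> carrier (corner A x)"
      using ab ab' X.A.m_closed by auto
    then show "embed (X.t a b \<otimes>\<^bsub>X.Re\<^esub> X.t a' b') = embed (X.t a b) \<otimes>\<^bsub>Re\<^esub> embed (X.t a' b')"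
      using X.mult_t[OF ab ab'] ab ab' mult_t[of a b a' b'] by (simp add: embed_t) (simp add: mem_corner)
  qed (use ab in \<open>auto simp: X.t_closed embed_closed\<close>)
  then show ?thesis
    by (intro X.additive_Te_eq[OF Te_abelian c[OF X.additive_mult_left[OF Y] embed_additive]
          c[OF embed_additive additive_mult_left[OF embed_closed[OF Y]]] _ X])
qed

lemma embed_smult:
  assumes X: "X \<in> carrier X.Te" and v: "v \<in> carrier (corner A x)"
  shows "X \<odot>\<^bsub>X.Nl\<^esub> v = embed X \<odot>\<^bsub>Nl\<^esub> v"
proof (rule X.additive_Te_eq[OF A.is_abelian_group _ _ _ X])
  have vA: "v \<in> carrier A" using v by (simp add: mem_corner)
  show "additive_map X.Te A (\<lambda>X. X \<odot>\<^bsub>X.Nl\<^esub> v)"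
    using X.additive_smult_env[OF v] by (auto simp: additive_map_def mem_corner)
  show "additive_map X.Te A (\<lambda>X. embed X \<odot>\<^bsub>Nl\<^esub> v)"
    by (rule additive_map_comp[OF embed_additive additive_smult_env[OF vA]])
  show "X.t a b \<odot>\<^bsub>X.Nl\<^esub> v = embed (X.t a b) \<odot>\<^bsub>Nl\<^esub> v"
    if "a \<in> carrier (corner A x)" "b \<in> carrier (corner A x)" for a b
    using that v X.smult_t[OF that v] by (simp add: embed_t) (simp add: mem_corner smult_t)
qed

lemma embed_rsmult:
  assumes X: "X \<in> carrier X.Te" and v: "v \<in> carrier (corner A x)"
  shows "rsmult X.Mr v X = rsmult Mr v (embed X)"
proof (rule X.additive_Te_eq[OF A.is_abelian_group _ _ _ X])
  have vA: "v \<in> carrier A" using v by (simp add: mem_corner)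
  show "additive_map X.Te A (\<lambda>X. rsmult X.Mr v X)"
    using X.additive_rsmult_env[OF v] by (auto simp: additive_map_def mem_corner)
  show "additive_map X.Te A (\<lambda>X. rsmult Mr v (embed X))"
    by (rule additive_map_comp[OF embed_additive additive_rsmult_env[OF vA]])
  show "rsmult X.Mr v (X.t a b) = rsmult Mr v (embed (X.t a b))"
    if "a \<in> carrier (corner A x)" "b \<in> carrier (corner A x)" for a b
    using that v X.rsmult_t[OF that v] by (simp add: embed_t) (simp add: mem_corner rsmult_t)
qed

lemma corner_fixed_iff: "v \<in> carrier (corner A x) \<longleftrightarrow> v \<in> carrier A \<and> x \<otimes>\<^bsub>A\<^esub> v \<otimes>\<^bsub>A\<^esub> x = v"
proof
  assume "v \<in> carrier (corner A x)"
  then show "v \<in> carrier A \<and> x \<otimes>\<^bsub>A\<^esub> v \<otimes>\<^bsub>A\<^esub> x = v" by (auto simp: mem_corner)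
next
  assume "v \<in> carrier A \<and> x \<otimes>\<^bsub>A\<^esub> v \<otimes>\<^bsub>A\<^esub> x = v"
  then show "v \<in> carrier (corner A x)" using corner_mult_closed[of v] by simp
qed

lemma peirce_corner_env:
  assumes P: "peirce_pair K Re Mr Nl I \<epsilon> T" and \<delta>: "\<delta> \<in> T" "\<epsilon> \<delta> = t x x"
    and vanish: "\<And>c r. c \<in> T \<Longrightarrow> c \<noteq> \<delta> \<Longrightarrow> r \<in> carrier Te \<Longrightarrow> t x x \<otimes>\<^bsub>Re\<^esub> r \<otimes>\<^bsub>Re\<^esub> \<epsilon> c = \<zero>\<^bsub>Te\<^esub>"
  shows "peirce_corner K Re Mr Nl I \<epsilon> T X.Re X.Mr X.Nl \<delta> embed"
proof (intro peirce_corner.intro peirce_corner_axioms.intro P X.tor_setup_env)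
  show "additive_map X.Re Re embed"
    using embed_additive by (simp add: additive_map_def)
  show "inj_on embed (carrier X.Re)"
    using retract_embed by (intro inj_on_inverseI[of _ retract]) simp
  show "embed \<one>\<^bsub>X.Re\<^esub> = \<epsilon> \<delta>"
    using X.A.one_closed by (simp add: embed_t \<delta>)
  show "r \<in> embed ` carrier X.Re"
    if r: "r \<in> carrier Re" "\<epsilon> \<delta> \<otimes>\<^bsub>Re\<^esub> r = r" "r \<otimes>\<^bsub>Re\<^esub> \<epsilon> \<delta> = r" for r
  proof -
    have "r = embed (retract r)" using r embed_retract[of r] by (simp add: \<delta>)
    then show ?thesis using additive_map_closed[OF retract_additive, of r] r(1) by auto
  qed
qed (use \<delta> vanish x in \<open>auto simp: embed_mult embed_smult embed_rsmult corner_fixed_iff smult_t rsmult_t\<close>)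

end

end

lemma (in abelian_monoid) finsum_Times:
  assumes "finite S" "finite S'" "\<And>a b. a \<in> S \<Longrightarrow> b \<in> S' \<Longrightarrow> f a b \<in> carrier G"
  shows "(\<Oplus>p\<in>S \<times> S'. f (fst p) (snd p)) = (\<Oplus>a\<in>S. \<Oplus>b\<in>S'. f a b)"
  using assms(1,3)
proof (induction S)
  case (insert a S)
  have row: "(\<Oplus>p\<in>Pair a ` S'. f (fst p) (snd p)) = (\<Oplus>b\<in>S'. f a b)"
    using insert.prems by (subst finsum_reindex) (auto simp: inj_on_def)
  have "insert a S \<times> S' = Pair a ` S' \<union> S \<times> S'" by auto
  then have "(\<Oplus>p\<in>insert a S \<times> S'. f (fst p) (snd p))
      = (\<Oplus>p\<in>Pair a ` S'. f (fst p) (snd p)) \<oplus> (\<Oplus>p\<in>S \<times> S'. f (fst p) (snd p))"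
    using insert assms(2) by (simp only:) (intro finsum_Un_disjoint, auto)
  also have "\<dots> = (\<Oplus>b\<in>S'. f a b) \<oplus> (\<Oplus>a\<in>S. \<Oplus>b\<in>S'. f a b)"
    using insert by (simp add: row)
  also have "\<dots> = (\<Oplus>a\<in>insert a S. \<Oplus>b\<in>S'. f a b)"
    using insert by (intro finsum_insert[symmetric]) (auto intro!: finsum_closed)
  finally show ?case .
qed simp

locale triangular_algebra = algebra_env K A for K :: "('k, 'x) ring_scheme" and A :: "('k, 'a) module" +
  fixes E
  assumes triangular: "triangular A E"
begin

text \<open>An arrow runs from \<open>x\<close> to \<open>y\<close> when
  \<open>y \<Lambda> x\<close> is non zero, so a non zero \<open>a r b\<close> means that
  \<open>b\<close> reaches \<open>a\<close>; hence the swapped order in \<open>TT\<close>.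
  Reflexivity puts the diagonal pairs, which give the corners, into \<open>TT\<close>.\<close>

abbreviation "reach \<equiv> (peirce_quiver A E)\<^sup>*"
abbreviation "\<epsilon> \<equiv> \<lambda>c. t (fst c) (snd c)"
abbreviation "TT \<equiv> {(a, b) \<in> E \<times> E. (b, a) \<in> reach}"

lemma finite_E: "finite E"
  and E_A: "a \<in> E \<Longrightarrow> a \<in> carrier A"
  and E_idem: "a \<in> E \<Longrightarrow> a \<otimes>\<^bsub>A\<^esub> a = a"
  and E_orth: "a \<in> E \<Longrightarrow> b \<in> E \<Longrightarrow> a \<noteq> b \<Longrightarrow> a \<otimes>\<^bsub>A\<^esub> b = \<zero>\<^bsub>A\<^esub>"
  and E_sum: "(\<Oplus>\<^bsub>A\<^esub>a\<in>E. a) = \<one>\<^bsub>A\<^esub>"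
  and quiver_acyclic: "acyclic (peirce_quiver A E)"
  using triangular by (auto simp: triangular_def idempotent_system_def)

lemma reach_antisym: "(a, b) \<in> reach \<Longrightarrow> (b, a) \<in> reach \<Longrightarrow> a = b"
  by (rule antisymD[OF acyclic_impl_antisym_rtrancl[OF quiver_acyclic]])

lemma reachI:
  assumes "a \<in> E" "b \<in> E" "r \<in> carrier A" "b \<otimes>\<^bsub>A\<^esub> r \<otimes>\<^bsub>A\<^esub> a \<noteq> \<zero>\<^bsub>A\<^esub>"
  shows "(a, b) \<in> reach"
proof (cases "a = b")
  case False
  then have "(a, b) \<in> peirce_quiver A E" using assms unfolding peirce_quiver_def by blast
  then show ?thesis by (rule r_into_rtrancl)
qed simp

text \<open>For \<open>r = t p q\<close> the product is the tensor of \<open>u p a\<close> and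
  \<open>b q v\<close>, the second factor being multiplied in reverse. It can be non zero only if
  \<open>a\<close> reaches \<open>u\<close> and \<open>v\<close> reaches \<open>b\<close>.\<close>

lemma env_sandwich_zero:
  assumes "u \<in> E" "v \<in> E" "a \<in> E" "b \<in> E" and zero: "(a, u) \<notin> reach \<or> (v, b) \<notin> reach" and r: "r \<in> carrier Te"
  shows "t u v \<otimes>\<^bsub>Re\<^esub> r \<otimes>\<^bsub>Re\<^esub> t a b = \<zero>\<^bsub>Te\<^esub>"
proof (rule additive_Te_eq[OF Te_abelian _ _ _ r])
  have uv: "t u v \<in> carrier Te" and ab: "t a b \<in> carrier Te"
    using assms by (simp_all add: t_closed E_A)
  show "additive_map Te Te (\<lambda>X. t u v \<otimes>\<^bsub>Re\<^esub> X \<otimes>\<^bsub>Re\<^esub> t a b)"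
    by (rule additive_map_comp[OF additive_mult_right[OF uv] additive_mult_left[OF ab]])
  show "additive_map Te Te (\<lambda>X. \<zero>\<^bsub>Te\<^esub>)"
    by (rule additive_mapI) auto
  fix p q assume pq: "p \<in> carrier A" "q \<in> carrier A"
  have "t u v \<otimes>\<^bsub>Re\<^esub> t p q \<otimes>\<^bsub>Re\<^esub> t a b = t (u \<otimes>\<^bsub>A\<^esub> p \<otimes>\<^bsub>A\<^esub> a) (b \<otimes>\<^bsub>A\<^esub> q \<otimes>\<^bsub>A\<^esub> v)"
    using assms pq by (simp add: mult_t E_A A.m_assoc)
  also have "\<dots> = \<zero>\<^bsub>Te\<^esub>"
  proof -
    have "u \<otimes>\<^bsub>A\<^esub> p \<otimes>\<^bsub>A\<^esub> a = \<zero>\<^bsub>A\<^esub> \<or> b \<otimes>\<^bsub>A\<^esub> q \<otimes>\<^bsub>A\<^esub> v = \<zero>\<^bsub>A\<^esub>"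
      using zero reachI[OF assms(3,1) pq(1)] reachI[OF assms(2,4) pq(2)] by blast
    then show ?thesis
      using assms pq by (elim disjE) (simp_all add: t_zero_left t_zero_right E_A)
  qed
  finally show "t u v \<otimes>\<^bsub>Re\<^esub> t p q \<otimes>\<^bsub>Re\<^esub> t a b = \<zero>\<^bsub>Te\<^esub>" .
qed

lemma env_idempotents: "orthogonal_idempotents Re (E \<times> E) \<epsilon>"
proof (intro orthogonal_idempotents.intro orthogonal_idempotents_axioms.intro Re_ring)
  show "\<epsilon> c \<otimes>\<^bsub>Re\<^esub> \<epsilon> c' = \<zero>\<^bsub>Re\<^esub>" if "c \<in> E \<times> E" "c' \<in> E \<times> E" "c \<noteq> c'" for c c'
  proof -
    obtain a b a' b' where c: "c = (a, b)" "c' = (a', b')" by (cases c, cases c')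
    have E: "a \<in> E" "b \<in> E" "a' \<in> E" "b' \<in> E" using that c by auto
    have "a \<otimes>\<^bsub>A\<^esub> a' = \<zero>\<^bsub>A\<^esub> \<or> b' \<otimes>\<^bsub>A\<^esub> b = \<zero>\<^bsub>A\<^esub>"
      using that(3) c E_orth[of a a'] E_orth[of b' b] E by auto
    then show ?thesis
      using E unfolding c by (elim disjE) (simp_all add: mult_t E_A t_zero_left t_zero_right)
  qed
  have "(\<Oplus>\<^bsub>Re\<^esub>c\<in>E \<times> E. \<epsilon> c) = (\<Oplus>\<^bsub>Re\<^esub>a\<in>E. \<Oplus>\<^bsub>Re\<^esub>b\<in>E. t a b)"
    by (rule Re.finsum_Times[OF finite_E finite_E]) (simp add: t_closed E_A)
  also have "\<dots> = (\<Oplus>\<^bsub>Re\<^esub>a\<in>E. t a \<one>\<^bsub>A\<^esub>)"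
  proof (rule Re.finsum_cong'[OF refl])
    show "(\<lambda>a. t a \<one>\<^bsub>A\<^esub>) \<in> E \<rightarrow> carrier Re" by (auto simp: t_closed E_A)
    fix a assume a: "a \<in> E"
    have "additive_map A Re (t a)" using additive_t_right[OF E_A[OF a]] by (simp add: additive_map_def)
    from additive_map_finsum[OF A.is_abelian_group Re_abelian this finite_E, of "\<lambda>b. b"]
    show "(\<Oplus>\<^bsub>Re\<^esub>b\<in>E. t a b) = t a \<one>\<^bsub>A\<^esub>" by (simp add: E_A E_sum)
  qed
  also have "\<dots> = t \<one>\<^bsub>A\<^esub> \<one>\<^bsub>A\<^esub>"
  proof -
    have "additive_map A Re (\<lambda>a. t a \<one>\<^bsub>A\<^esub>)" using additive_t_left[OF A.one_closed] by (simp add: additive_map_def)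
    from additive_map_finsum[OF A.is_abelian_group Re_abelian this finite_E, of "\<lambda>b. b"]
    show ?thesis by (simp add: E_A E_sum)
  qed
  finally show "(\<Oplus>\<^bsub>Re\<^esub>c\<in>E \<times> E. \<epsilon> c) = \<one>\<^bsub>Re\<^esub>" by simp
qed (auto simp: finite_E t_closed E_A mult_t E_idem)

lemma env_peirce_pair: "peirce_pair K Re Mr Nl (E \<times> E) \<epsilon> TT"
proof (intro peirce_pair.intro peirce_pair_axioms.intro tor_setup_env env_idempotents)
  show "TT \<subseteq> E \<times> E" by auto
  show "\<epsilon> c \<odot>\<^bsub>Nl\<^esub> n = \<zero>\<^bsub>Nl\<^esub>" if "c \<in> E \<times> E - TT" "n \<in> carrier Nl" for c n
    using that reachI[of "snd c" "fst c" n] by (auto simp: smult_t E_A)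
  show "\<epsilon> c \<otimes>\<^bsub>Re\<^esub> r \<otimes>\<^bsub>Re\<^esub> \<epsilon> c' = \<zero>\<^bsub>Re\<^esub>"
    if "c \<in> E \<times> E - TT" "c' \<in> TT" "r \<in> carrier Re" for c c' r
  proof -
    obtain u v a b where c: "c = (u, v)" "c' = (a, b)" by (cases c, cases c')
    \<comment> \<open>Otherwise \<open>v\<close> reaches \<open>b\<close>, \<open>b\<close> reaches
      \<open>a\<close> and \<open>a\<close> reaches \<open>u\<close>, so \<open>(u, v)\<close> would
      belong to \<open>TT\<close>. This is where transitivity of \<open>reach\<close> is
      essential.\<close>
    have "(a, u) \<notin> reach \<or> (v, b) \<notin> reach"
      using that c by (auto dest: rtrancl_trans)
    then show ?thesis using that c env_sandwich_zero[of u v a b r] by auto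
  qed
qed

lemma env_peirce_corner:
  assumes x: "x \<in> E"
  shows "peirce_corner K Re Mr Nl (E \<times> E) \<epsilon> TT (enveloping_algebra K (corner A x))
    (env_right_module K (corner A x)) (env_left_module K (corner A x)) (x, x) (embed)"
proof (rule peirce_corner_env[OF E_A[OF x] E_idem[OF x] env_peirce_pair])
  show "(x, x) \<in> TT" using x by auto
  show "\<epsilon> (x, x) = t x x" by simp
  show "t x x \<otimes>\<^bsub>Re\<^esub> r \<otimes>\<^bsub>Re\<^esub> \<epsilon> c = \<zero>\<^bsub>Te\<^esub>" if "c \<in> TT" "c \<noteq> (x, x)" "r \<in> carrier Te" for c r
  proof -
    obtain a b where c: "c = (a, b)" by (cases c)
    \<comment> \<open>Paths from \<open>a\<close> to \<open>x\<close> and from \<open>x\<close> to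
      \<open>b\<close>, together with the one from \<open>b\<close> to \<open>a\<close>, close up,
      so acyclicity leaves only \<open>a = b = x\<close>.\<close>
    have "(a, x) \<notin> reach \<or> (x, b) \<notin> reach"
    proof (rule ccontr)
      assume "\<not> ?thesis"
      then have ax: "(a, x) \<in> reach" and xb: "(x, b) \<in> reach" by auto
      have ba: "(b, a) \<in> reach" using that c by auto
      have "a = x" using reach_antisym[OF ax] rtrancl_trans[OF xb ba] by blast
      moreover have "b = x" using reach_antisym[OF xb] rtrancl_trans[OF ba ax] by blast
      ultimately show False using that c by simp
    qed
    then show ?thesis using that c env_sandwich_zero[of x x a b r] x by auto
  qed
qed

lemma env_peirce_decomposition:
  "peirce_decomposition K Re Mr Nl (E \<times> E) \<epsilon> TT E (\<lambda>x. enveloping_algebra K (corner A x))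
    (\<lambda>x. env_right_module K (corner A x)) (\<lambda>x. env_left_module K (corner A x)) (\<lambda>x. (x, x)) (\<lambda>x. embed)"
proof (intro peirce_decomposition.intro peirce_decomposition_axioms.intro env_peirce_pair finite_E
    env_peirce_corner)
  show "inj_on (\<lambda>x. (x, x)) E" by (simp add: inj_on_def)
  show "rsmult Mr m (\<epsilon> c) = \<zero>\<^bsub>Mr\<^esub>"
    if "c \<in> TT" "c \<notin> (\<lambda>x. (x, x)) ` E" "m \<in> carrier Mr" for c m
  proof -
    obtain a b where c: "c = (a, b)" by (cases c)
    have "a \<noteq> b" "(b, a) \<in> reach" "a \<in> E" "b \<in> E" using that c by auto
    \<comment> \<open>\<open>a \<otimes> b\<close> acts on \<open>m\<close> from the right as
      \<open>b m a\<close>. A non zero value would give a path from \<open>a\<close> to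
      \<open>b\<close>, opposite to the one recorded in \<open>TT\<close>.\<close>
    then have "(a, b) \<notin> reach" using reach_antisym by blast
    then show ?thesis
      using reachI[of a b m] that c by (auto simp: rsmult_t E_A)
  qed
qed

end

theorem corollary2p20:
  fixes K :: "('k, 'x) ring_scheme" and A :: "('k, 'a) module" and E :: "'a set"
  assumes "field K"
    and "assoc_algebra K A"
    and "triangular A E"
  shows "\<forall>n. module_isomorphic K (HH K A n) (direct_sum E (\<lambda>x. HH K (corner A x) n))"
proof
  interpret triangular_algebra K A E
    by (intro triangular_algebra.intro triangular_algebra_axioms.intro
        assoc_algebra_imp_algebra_env assms(2,3))
  show "module_isomorphic K (HH K A n) (direct_sum E (\<lambda>x. HH K (corner A x) n))" for n
    unfolding HH_def by (rule peirce_decomposition.Tor_isomorphic_direct_sum[OF env_peirce_decomposition])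
qed

end
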